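(* Let $b>0$, let $V\ge 0$ and let $V\in L^1(\mathbb{R})$. Let $W_V(b)=W_0(b)-V$ be the self-adjoint operator on $L^2(\mathbb{R})$ defined in the context. If $W_V(b)\ge -2$, then the discrete eigenvalues $\lambda_j=-2\cos(\omega_j)\in[-2,2)$ of $W_V(b)$ (repeated with multiplicities, with $\omega_j\in[0,\pi]$) satisfy $$\sum_{j\ge 1}\frac{\sin\omega_j}{\omega_j}\le\frac{1}{2\pi b}\int_{\mathbb{R}}V(x)\,dx .$$ The constant in this inequality is sharp in the sense that there is a potential $V$ such that the inequality becomes an equality.
   Context: The Fourier transform is $\widehat\psi(k)=\int_{\mathbb{R}}e^{-2\pi i kx}\psi(x)\,dx$. For $b>0$, $W_0(b)$ is the self-adjoint operator on $L^2(\mathbb{R})$ acting in Fourier space as multiplication by $2\cosh(2\pi bk)$, i.e. $\widehat{W_0(b)\psi}(k)=2\cosh(2\pi bk)\widehat\psi(k)$, with domain $\{\psi\in L^2(\mathbb{R}):\ 2\cosh(2\pi bk)\widehat\psi(k)\in L^2(\mathbb{R})\}$. Equivalently, $(W_0(b)\psi)(x)=\psi(x+ib)+\psi(x-ib)$ in terms of analytic continuation to a strip. Its spectrum is $[2,\infty)$ and its quadratic form is $$2\|\psi\|^2+\int_{\mathbb{R}}|2\sinh(\pi bk)\widehat\psi(k)|^2\,dk$$ with form domain $Q_b=\{\psi\in L^2(\mathbb{R}):\ 2\cosh(\pi bk)\widehat\psi(k)\in L^2(\mathbb{R})\}\subset H^1(\mathbb{R})$. For a real-valued potential $V\in L^1(\mathbb{R})$,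 $V\ge 0$, $W_V(b)=W_0(b)-V$ denotes the self-adjoint, lower semibounded operator associated with the closed quadratic form $$2\|\psi\|^2+\int_{\mathbb{R}}|2\sinh(\pi bk)\widehat\psi(k)|^2\,dk-\int_{\mathbb{R}}V(x)|\psi(x)|^2\,dx,\qquad \psi\in Q_b .$$ It acts as $(W_V(b)\psi)(x)=\psi(x+ib)+\psi(x-ib)-V(x)\psi(x)$. The spectrum of $W_V(b)$ consists of the essential spectrum $[2,\infty)$ and discrete eigenvalues of finite multiplicity below $2$. "$W_V(b)\ge -2$" means $\langle\psi,W_V(b)\psi\rangle\ge -2\|\psi\|^2$ in the sense of quadratic forms. The quotient $\frac{\sin\omega}{\omega}$ is interpreted as $1$ at $\omega=0$. *)

theory Defs
  imports "HOL-Analysis.Analysis" "HOL-Probability.Sinc_Integral"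
begin

text \<open>Elements of \<open>L\<^sup>2(\<real>)\<close> are represented by square-integrable Borel functions;
  identities between them are understood almost everywhere.\<close>

definition L2 :: "(real \<Rightarrow> complex) set" where
  "L2 = {f \<in> borel_measurable lborel. integrable lborel (\<lambda>x. (norm (f x))\<^sup>2)}"

definition L2_inner :: "(real \<Rightarrow> complex) \<Rightarrow> (real \<Rightarrow> complex) \<Rightarrow> complex" where
  "L2_inner f g = (LINT x|lborel. cnj (f x) * g x)"

definition L2_norm :: "(real \<Rightarrow> complex) \<Rightarrow> real" where
  "L2_norm f = sqrt (LINT x|lborel. (norm (f x))\<^sup>2)"

definition fourier_integral :: "(real \<Rightarrow> complex) \<Rightarrow> real \<Rightarrow> complex" where
  "fourier_integral f k = (LINT x|lborel. exp (- 2 * pi * \<i> * k * x) * f x)"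

text \<open>On \<open>L\<^sup>2(\<real>)\<close> the Fourier integral need not converge; the transform is the
  \<open>L\<^sup>2\<close>-limit of the Fourier integrals over \<open>[-n, n]\<close>. By Plancherel's theorem this
  limit exists and is unique up to null sets.\<close>

definition is_fourier :: "(real \<Rightarrow> complex) \<Rightarrow> (real \<Rightarrow> complex) \<Rightarrow> bool" where
  "is_fourier f g \<longleftrightarrow> g \<in> L2 \<and>
     (\<lambda>n::nat. \<integral>\<^sup>+k. ennreal ((norm
         (fourier_integral (\<lambda>x. indicator {- real n..real n} x * f x) k - g k))\<^sup>2) \<partial>lborel)
       \<longlonglongrightarrow> 0"

definition fourier :: "(real \<Rightarrow> complex) \<Rightarrow> real \<Rightarrow> complex" where
  "fourier f = (SOME g. is_fourier f g)"

definition form_domain :: "real \<Rightarrow> (real \<Rightarrow> complex) set" where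
  "form_domain b = {\<psi> \<in> L2. (\<lambda>k. 2 * cosh (pi * b * k) * fourier \<psi> k) \<in> L2}"

text \<open>The form of \<open>W\<^sub>0(b) - V\<close>, where the parameter \<open>E\<close> is the sesquilinear form of the
  potential energy (conjugate-linear in the first argument).\<close>

definition W_form :: "real \<Rightarrow> ((real \<Rightarrow> complex) \<Rightarrow> (real \<Rightarrow> complex) \<Rightarrow> complex)
    \<Rightarrow> (real \<Rightarrow> complex) \<Rightarrow> (real \<Rightarrow> complex) \<Rightarrow> complex" where
  "W_form b E \<phi> \<psi> = 2 * L2_inner \<phi> \<psi>
     + L2_inner (\<lambda>k. 2 * sinh (pi * b * k) * fourier \<phi> k) (\<lambda>k. 2 * sinh (pi * b * k) * fourier \<psi> k)
     - E \<phi> \<psi>"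

definition potential_form :: "(real \<Rightarrow> real) \<Rightarrow> (real \<Rightarrow> complex) \<Rightarrow> (real \<Rightarrow> complex) \<Rightarrow> complex" where
  "potential_form V \<phi> \<psi> = (LINT x|lborel. V x * (cnj (\<phi> x) * \<psi> x))"

text \<open>Measure-valued potentials, such as multiples of a Dirac measure, are evaluated on
  continuous representatives, which exist since the form domain lies in \<open>H\<^sup>1(\<real>)\<close>.
  For a measure with density \<open>V\<close> this is the form above. The only potential in
  \<open>L\<^sup>1(\<real>)\<close> with equality in the spectral inequality is \<open>V = 0\<close>; a nontrivial one
  is \<open>V = c \<delta>\<^sub>0\<close> with \<open>0 < c \<le> 2 \<pi> b\<close>.\<close>

definition continuous_rep :: "(real \<Rightarrow> complex) \<Rightarrow> real \<Rightarrow> complex" where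
  "continuous_rep \<psi> = (SOME g. continuous_on UNIV g \<and> (AE x in lborel. g x = \<psi> x))"

definition measure_form :: "real measure \<Rightarrow> (real \<Rightarrow> complex) \<Rightarrow> (real \<Rightarrow> complex) \<Rightarrow> complex" where
  "measure_form M \<phi> \<psi> = (LINT x|M. cnj (continuous_rep \<phi> x) * continuous_rep \<psi> x)"

lemma W_form_potential_diag:
  "W_form b (potential_form V) \<psi> \<psi> = complex_of_real
     (2 * (L2_norm \<psi>)\<^sup>2 + (LINT k|lborel. (norm (2 * sinh (pi * b * k) * fourier \<psi> k))\<^sup>2)
       - (LINT x|lborel. V x * (norm (\<psi> x))\<^sup>2))"
proof -
  have inner: "L2_inner f f = complex_of_real (LINT x|lborel. (norm (f x))\<^sup>2)" for f
    unfolding L2_inner_def integral_complex_of_real[symmetric]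
    by (simp add: complex_norm_square mult.commute del: of_real_power)
  have pot: "potential_form V \<psi> \<psi> = complex_of_real (LINT x|lborel. V x * (norm (\<psi> x))\<^sup>2)"
    unfolding potential_form_def integral_complex_of_real[symmetric]
    by (simp add: complex_norm_square mult.commute del: of_real_power)
  have norm: "(L2_norm \<psi>)\<^sup>2 = (LINT x|lborel. (norm (\<psi> x))\<^sup>2)"
    unfolding L2_norm_def by (rule real_sqrt_pow2) (rule integral_nonneg_AE, simp)
  show ?thesis
    unfolding W_form_def inner pot norm by simp
qed

definition W_bounded_below :: "real \<Rightarrow> ((real \<Rightarrow> complex) \<Rightarrow> (real \<Rightarrow> complex) \<Rightarrow> complex)
    \<Rightarrow> real \<Rightarrow> bool" where
  "W_bounded_below b E c \<longleftrightarrow>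
     (\<forall>\<psi>\<in>form_domain b. Re (W_form b E \<psi> \<psi>) \<ge> c * (L2_norm \<psi>)\<^sup>2)"

text \<open>The operator associated with the form (first representation theorem), as a graph:
  \<open>W\<psi> = \<eta>\<close> iff \<open>\<psi>\<close> lies in the form domain and the form at \<open>(\<phi>, \<psi>)\<close> equals
  \<open>\<langle>\<phi>, \<eta>\<rangle>\<close> for all \<open>\<phi>\<close> in the form domain.\<close>

definition W_op :: "real \<Rightarrow> ((real \<Rightarrow> complex) \<Rightarrow> (real \<Rightarrow> complex) \<Rightarrow> complex)
    \<Rightarrow> ((real \<Rightarrow> complex) \<times> (real \<Rightarrow> complex)) set" where
  "W_op b E = {(\<psi>, \<eta>). \<psi> \<in> form_domain b \<and> \<eta> \<in> L2 \<and>
     (\<forall>\<phi>\<in>form_domain b. W_form b E \<phi> \<psi> = L2_inner \<phi> \<eta>)}"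

text \<open>Spectral notions for a linear operator in \<open>L\<^sup>2(\<real>)\<close> given by its graph \<open>T\<close>.\<close>

definition resolvent_set :: "((real \<Rightarrow> complex) \<times> (real \<Rightarrow> complex)) set \<Rightarrow> complex set" where
  "resolvent_set T = {z.
     (\<forall>(\<psi>, \<eta>)\<in>T. (AE x in lborel. \<eta> x = z * \<psi> x) \<longrightarrow> (AE x in lborel. \<psi> x = 0)) \<and>
     (\<exists>C. \<forall>f\<in>L2. \<exists>(\<psi>, \<eta>)\<in>T.
        (AE x in lborel. \<eta> x - z * \<psi> x = f x) \<and> L2_norm \<psi> \<le> C * L2_norm f)}"

definition spectrum :: "((real \<Rightarrow> complex) \<times> (real \<Rightarrow> complex)) set \<Rightarrow> complex set" where
  "spectrum T = - resolvent_set T"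

definition eigenspace ::
    "((real \<Rightarrow> complex) \<times> (real \<Rightarrow> complex)) set \<Rightarrow> real \<Rightarrow> (real \<Rightarrow> complex) set" where
  "eigenspace T \<mu> = {\<psi>. \<exists>\<eta>. (\<psi>, \<eta>) \<in> T \<and> (AE x in lborel. \<eta> x = of_real \<mu> * \<psi> x)}"

text \<open>\<open>\<psi> 0, \<dots>, \<psi> (n - 1)\<close> is a basis of \<open>S\<close> modulo null functions.\<close>

definition ae_basis :: "nat \<Rightarrow> (nat \<Rightarrow> real \<Rightarrow> complex) \<Rightarrow> (real \<Rightarrow> complex) set \<Rightarrow> bool" where
  "ae_basis n \<psi> S \<longleftrightarrow> (\<forall>i<n. \<psi> i \<in> S) \<and>
     (\<forall>c. (AE x in lborel. (\<Sum>i<n. c i * \<psi> i x) = 0) \<longrightarrow> (\<forall>i<n. c i = 0)) \<and>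
     (\<forall>f\<in>S. \<exists>c. AE x in lborel. f x = (\<Sum>i<n. c i * \<psi> i x))"

definition multiplicity :: "((real \<Rightarrow> complex) \<times> (real \<Rightarrow> complex)) set \<Rightarrow> real \<Rightarrow> nat" where
  "multiplicity T \<mu> = (THE n. \<exists>\<psi>. ae_basis n \<psi> (eigenspace T \<mu>))"

definition discrete_eigenvalues :: "((real \<Rightarrow> complex) \<times> (real \<Rightarrow> complex)) set \<Rightarrow> real set" where
  "discrete_eigenvalues T = {\<mu>.
     (\<exists>\<psi>\<in>eigenspace T \<mu>. \<not> (AE x in lborel. \<psi> x = 0)) \<and>
     (\<exists>n \<psi>. ae_basis n \<psi> (eigenspace T \<mu>)) \<and>
     complex_of_real \<mu> isolated_in spectrum T}"

text \<open>The sum of \<open>sin \<omega>\<^sub>j / \<omega>\<^sub>j\<close> over the discrete eigenvalues, counted with multiplicity.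
  For \<open>\<mu> \<in> [-2, 2)\<close>, \<open>arccos (- \<mu> / 2)\<close> is the unique \<open>\<omega> \<in> [0, \<pi>]\<close> with
  \<open>\<mu> = - 2 cos \<omega>\<close>.\<close>

definition sinc_sum :: "((real \<Rightarrow> complex) \<times> (real \<Rightarrow> complex)) set \<Rightarrow> ennreal" where
  "sinc_sum T = (\<Sum>\<^sub>\<infinity>\<mu>\<in>discrete_eigenvalues T.
     of_nat (multiplicity T \<mu>) * ennreal (sinc (arccos (- \<mu> / 2))))"

end

theory Submission
  imports Defs "HOL-Probability.Characteristic_Functions" "HOL-Complex_Analysis.Complex_Analysis"
begin

text \<open>
  A potential enters only through the measure \<open>V dx\<close>, so the argument is carried out for an
  arbitrary finite Borel measure \<open>M\<close>. By Plancherel's theorem the form of \<open>W\<close> becomes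
  \<open>\<integral> 2 cosh(2\<pi>bk) |h(k)|\<^sup>2 dk - \<integral> |\<psi>|\<^sup>2 dM\<close>, where \<open>h\<close> is the Fourier transform of \<open>\<psi>\<close>.

  The proof of the inequality follows the Birman--Schwinger principle together with the
  monotonicity argument of Hundertmark, Lieb and Thomas. For \<open>0 \<le> \<omega> < \<pi>\<close> consider the kernel
  \<open>\<rho>\<^sub>\<omega>(k) = (sin \<omega> / \<omega>) / (2 cosh(2\<pi>bk) + 2 cos \<omega>)\<close> and the positive operator \<open>L\<^sub>\<omega>\<close> on
  \<open>L\<^sup>2(M)\<close> with quadratic form \<open>\<integral> \<rho>\<^sub>\<omega>(k) |(u M)^(k)|\<^sup>2 dk\<close>. Up to the factor \<open>sin \<omega> / \<omega>\<close> this is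
  the Birman--Schwinger operator at the energy \<open>- 2 cos \<omega>\<close>. Three facts are combined.

  \<^item> The factor \<open>sin \<omega> / \<omega>\<close> makes \<open>\<integral> \<rho>\<^sub>\<omega> = 1 / (2\<pi>b)\<close> independent of \<open>\<omega>\<close>, whence the trace of
    \<open>L\<^sub>\<omega>\<close> is at most \<open>M(\<real>) / (2\<pi>b)\<close>; this is Bessel's inequality (\<open>qrho_trace_bound\<close>).

  \<^item> The Fourier transform of \<open>\<rho>\<^sub>\<omega>\<close> is proportional to \<open>(sinh(\<omega>x/b) / \<omega>) / sinh(\<pi>x/b)\<close>. For
    \<open>\<omega> < \<omega>'\<close> it is that of \<open>\<rho>\<^sub>\<omega>'\<close> times a function of the same family on a narrower strip,
    which is again the transform of a probability density. So \<open>L\<^sub>\<omega>\<close> is an average of operators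
    unitarily equivalent to \<open>L\<^sub>\<omega>'\<close>, and the sum of its \<open>n\<close> largest eigenvalues does not
    decrease when \<open>\<omega>\<close> grows (\<open>fourier_strip_kernel\<close>, \<open>sum_qrho_monotone\<close>).

  \<^item> If \<open>n\<close> eigenvalues of \<open>W\<close> are at most \<open>- 2 cos \<omega>\<close>, then \<open>L\<^sub>\<omega> \<ge> sin \<omega> / \<omega>\<close> on an
    \<open>n\<close>-dimensional subspace of \<open>L\<^sup>2(M)\<close> (\<open>birman_schwinger_bound\<close>).

  With the eigenvalues in increasing order, raise \<open>\<omega>\<close> from one eigenvalue to the next: by
  monotonicity nothing is lost, and at the \<open>j\<close>-th eigenvalue a \<open>j\<close>-dimensional subspace contains a
  unit vector orthogonal to the \<open>j - 1\<close> vectors collected so far, which contributes another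
  \<open>sin \<omega>\<^sub>j / \<omega>\<^sub>j\<close> (\<open>eigenvalue_moments_orthonormal\<close>). The trace bound then gives the inequality
  (\<open>sharp_moment_bound\<close>).

  That no discrete eigenvalue lies in \<open>[2, \<infinity>)\<close> follows because this half-line consists of
  spectrum (\<open>essential_spectrum\<close>). Equality holds for \<open>V = 0\<close>, and for the point mass
  \<open>2\<pi>b \<delta>\<^sub>0\<close>, whose resolvent is explicit: \<open>- 2\<close> is a discrete eigenvalue with
  \<open>sin \<omega> / \<omega> = 1\<close>, which alone exhausts the bound (\<open>dirac_sinc_sum\<close>).
\<close>

section \<open>Square-integrable functions over a measure\<close>

text \<open>The underlying measure is a parameter because two Hilbert spaces are in play: \<open>L\<^sup>2(\<real>)\<close>, on
  which the operator acts, and \<open>L\<^sup>2(M)\<close>, on which the Birman--Schwinger form lives.\<close>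

definition Lsq :: "'a measure \<Rightarrow> ('a \<Rightarrow> complex) set" where
  "Lsq N = {f \<in> borel_measurable N. integrable N (\<lambda>x. (norm (f x))\<^sup>2)}"

definition ip :: "'a measure \<Rightarrow> ('a \<Rightarrow> complex) \<Rightarrow> ('a \<Rightarrow> complex) \<Rightarrow> complex" where
  "ip N f g = (LINT x|N. cnj (f x) * g x)"

definition nrm :: "'a measure \<Rightarrow> ('a \<Rightarrow> complex) \<Rightarrow> real" where
  "nrm N f = sqrt (LINT x|N. (norm (f x))\<^sup>2)"

lemma L2_Lsq: "L2 = Lsq lborel" and L2_inner_ip: "L2_inner = ip lborel"
  and L2_norm_nrm: "L2_norm = nrm lborel"
  by (auto simp: L2_def Lsq_def L2_inner_def ip_def L2_norm_def nrm_def fun_eq_iff)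

lemma borel_measurable_cnj [measurable]:
  "f \<in> borel_measurable N \<Longrightarrow> (\<lambda>x. cnj (f x)) \<in> borel_measurable N"
  by (rule borel_measurable_continuous_on[of cnj]) (auto intro: continuous_intros)

lemma borel_measurable_cosh_real [measurable]:
  "f \<in> borel_measurable N \<Longrightarrow> (\<lambda>x. cosh (f x :: real)) \<in> borel_measurable N"
  by (rule borel_measurable_continuous_on[of cosh]) (auto intro: continuous_intros)

lemma borel_measurable_sinh_real [measurable]:
  "f \<in> borel_measurable N \<Longrightarrow> (\<lambda>x. sinh (f x :: real)) \<in> borel_measurable N"
  by (rule borel_measurable_continuous_on[of sinh]) (auto intro: continuous_intros)

lemma LsqI: "f \<in> borel_measurable N \<Longrightarrow> integrable N (\<lambda>x. (norm (f x))\<^sup>2) \<Longrightarrow> f \<in> Lsq N"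
  by (auto simp: Lsq_def)

lemma LsqD1 [dest]: "f \<in> Lsq N \<Longrightarrow> f \<in> borel_measurable N"
  and LsqD2 [simp]: "f \<in> Lsq N \<Longrightarrow> integrable N (\<lambda>x. (norm (f x))\<^sup>2)"
  by (auto simp: Lsq_def)

lemma Lsq_bounded:
  assumes "f \<in> Lsq N" "g \<in> borel_measurable N" "\<And>x. norm (g x) \<le> C * norm (f x)"
  shows "g \<in> Lsq N"
proof (rule LsqI)
  note assms(2)[measurable]
  show "integrable N (\<lambda>x. (norm (g x))\<^sup>2)"
  proof (rule Bochner_Integration.integrable_bound)
    show "integrable N (\<lambda>x. C\<^sup>2 * (norm (f x))\<^sup>2)" using assms(1) by simp
    have "(norm (g x))\<^sup>2 \<le> C\<^sup>2 * (norm (f x))\<^sup>2" for x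
      using power_mono[OF assms(3) norm_ge_zero, of x 2] by (simp add: power_mult_distrib)
    then show "AE x in N. norm ((norm (g x))\<^sup>2) \<le> norm (C\<^sup>2 * (norm (f x))\<^sup>2)" by simp
    show "(\<lambda>x. (norm (g x))\<^sup>2) \<in> borel_measurable N" by measurable
  qed
qed fact

lemma Lsq_cmult [intro]: "f \<in> Lsq N \<Longrightarrow> (\<lambda>x. c * f x) \<in> Lsq N"
  by (rule Lsq_bounded[where C="norm c"]) (auto simp: norm_mult)

lemma Lsq_cnj [intro]: "f \<in> Lsq N \<Longrightarrow> (\<lambda>x. cnj (f x)) \<in> Lsq N"
  by (rule Lsq_bounded[where C=1 and f=f]) (auto intro: borel_measurable_cnj)

lemma Lsq_add [intro]:
  assumes "f \<in> Lsq N" "g \<in> Lsq N" shows "(\<lambda>x. f x + g x) \<in> Lsq N"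
proof (rule LsqI)
  have [measurable]: "f \<in> borel_measurable N" "g \<in> borel_measurable N" using assms by auto
  show "integrable N (\<lambda>x. (norm (f x + g x))\<^sup>2)"
  proof (rule Bochner_Integration.integrable_bound)
    show "integrable N (\<lambda>x. 2 * (norm (f x))\<^sup>2 + 2 * (norm (g x))\<^sup>2)" using assms by simp
    have "(norm (f x + g x))\<^sup>2 \<le> 2 * (norm (f x))\<^sup>2 + 2 * (norm (g x))\<^sup>2" for x
    proof -
      have "(norm (f x + g x))\<^sup>2 \<le> (norm (f x) + norm (g x))\<^sup>2"
        by (intro power_mono norm_triangle_ineq) auto
      also have "\<dots> \<le> 2 * (norm (f x))\<^sup>2 + 2 * (norm (g x))\<^sup>2"
        using sum_squares_bound[of "norm (f x)" "norm (g x)"] by (simp add: power2_sum)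
      finally show ?thesis .
    qed
    then show "AE x in N. norm ((norm (f x + g x))\<^sup>2) \<le> norm (2 * (norm (f x))\<^sup>2 + 2 * (norm (g x))\<^sup>2)"
      by auto
    show "(\<lambda>x. (norm (f x + g x))\<^sup>2) \<in> borel_measurable N" by measurable
  qed
  show "(\<lambda>x. f x + g x) \<in> borel_measurable N" by measurable
qed

lemma Lsq_diff [intro]: "f \<in> Lsq N \<Longrightarrow> g \<in> Lsq N \<Longrightarrow> (\<lambda>x. f x - g x) \<in> Lsq N"
  using Lsq_add[OF _ Lsq_cmult, of f N g "-1"] by simp

lemma Lsq_0 [intro]: "(\<lambda>x. 0) \<in> Lsq N"
  by (rule LsqI) auto

lemma Lsq_sum [intro]: "(\<And>i. i \<in> I \<Longrightarrow> f i \<in> Lsq N) \<Longrightarrow> (\<lambda>x. \<Sum>i\<in>I. f i x) \<in> Lsq N"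
  by (induction I rule: infinite_finite_induct) auto

lemma integrable_norm_mult:
  assumes "f \<in> Lsq N" "g \<in> Lsq N"
  shows "integrable N (\<lambda>x. norm (f x) * norm (g x))"
proof (rule Bochner_Integration.integrable_bound)
  have [measurable]: "f \<in> borel_measurable N" "g \<in> borel_measurable N" using assms by auto
  show "integrable N (\<lambda>x. (norm (f x))\<^sup>2 + (norm (g x))\<^sup>2)" using assms by simp
  have "norm (f x) * norm (g x) \<le> (norm (f x))\<^sup>2 + (norm (g x))\<^sup>2" for x
  proof -
    have "0 \<le> norm (f x) * norm (g x)" by simp
    then show ?thesis using sum_squares_bound[of "norm (f x)" "norm (g x)"] by linarith
  qed
  then show "AE x in N. norm (norm (f x) * norm (g x)) \<le> norm ((norm (f x))\<^sup>2 + (norm (g x))\<^sup>2)" by auto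
  show "(\<lambda>x. norm (f x) * norm (g x)) \<in> borel_measurable N" by measurable
qed

lemma integrable_mult:
  assumes "f \<in> Lsq N" "g \<in> Lsq N"
  shows "integrable N (\<lambda>x. f x * g x)"
proof (rule Bochner_Integration.integrable_bound[OF integrable_norm_mult[OF assms]])
  have [measurable]: "f \<in> borel_measurable N" "g \<in> borel_measurable N" using assms by auto
  show "(\<lambda>x. f x * g x) \<in> borel_measurable N" by measurable
qed (auto simp: norm_mult)

lemma integrable_ip:
  assumes "f \<in> Lsq N" "g \<in> Lsq N"
  shows "integrable N (\<lambda>x. cnj (f x) * g x)"
  using integrable_mult[OF Lsq_cnj[OF assms(1)] assms(2)] .

lemma ip_add_right: "f \<in> Lsq N \<Longrightarrow> g \<in> Lsq N \<Longrightarrow> h \<in> Lsq N \<Longrightarrow>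
   ip N f (\<lambda>x. g x + h x) = ip N f g + ip N f h"
  unfolding ip_def by (simp add: integrable_ip distrib_left)

lemma ip_diff_right: "f \<in> Lsq N \<Longrightarrow> g \<in> Lsq N \<Longrightarrow> h \<in> Lsq N \<Longrightarrow>
   ip N f (\<lambda>x. g x - h x) = ip N f g - ip N f h"
  unfolding ip_def by (simp add: integrable_ip right_diff_distrib)

lemma ip_cmult_right: "ip N f (\<lambda>x. c * g x) = c * ip N f g"
  unfolding ip_def by (simp add: mult.left_commute[of _ c])

lemma ip_commute: "ip N g f = cnj (ip N f g)"
  unfolding ip_def by (subst Bochner_Integration.integral_cnj[symmetric]) (simp add: mult.commute)

lemma ip_cmult_left: "ip N (\<lambda>x. c * f x) g = cnj c * ip N f g"
  unfolding ip_def by (simp add: mult.assoc)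

lemma ip_add_left: "f \<in> Lsq N \<Longrightarrow> g \<in> Lsq N \<Longrightarrow> h \<in> Lsq N \<Longrightarrow>
   ip N (\<lambda>x. f x + g x) h = ip N f h + ip N g h"
  unfolding ip_def by (simp add: integrable_ip distrib_right)

lemma ip_diff_left: "f \<in> Lsq N \<Longrightarrow> g \<in> Lsq N \<Longrightarrow> h \<in> Lsq N \<Longrightarrow>
   ip N (\<lambda>x. f x - g x) h = ip N f h - ip N g h"
  unfolding ip_def by (simp add: integrable_ip left_diff_distrib)

lemma ip_sum_right: "f \<in> Lsq N \<Longrightarrow> (\<And>i. i \<in> I \<Longrightarrow> g i \<in> Lsq N) \<Longrightarrow>
   ip N f (\<lambda>x. \<Sum>i\<in>I. c i * g i x) = (\<Sum>i\<in>I. c i * ip N f (g i))"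
proof (induction I rule: infinite_finite_induct)
  case (insert i I)
  then show ?case
    by (simp add: ip_add_right Lsq_sum Lsq_cmult ip_cmult_right)
qed (simp_all add: ip_def)

lemma ip_sum_left: "f \<in> Lsq N \<Longrightarrow> (\<And>i. i \<in> I \<Longrightarrow> g i \<in> Lsq N) \<Longrightarrow>
   ip N (\<lambda>x. \<Sum>i\<in>I. c i * g i x) f = (\<Sum>i\<in>I. cnj (c i) * ip N (g i) f)"
  using arg_cong[OF ip_sum_right[of f N I g c], of cnj]
  by (simp add: ip_commute[symmetric])

lemma nrm_nonneg [simp]: "nrm N f \<ge> 0"
  unfolding nrm_def by (simp add: integral_nonneg_AE)

lemma nrm_sq: "(nrm N f)\<^sup>2 = (LINT x|N. (norm (f x))\<^sup>2)"
  unfolding nrm_def by (rule real_sqrt_pow2) (simp add: integral_nonneg_AE)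

lemma ip_self: "ip N f f = of_real ((nrm N f)\<^sup>2)"
  unfolding nrm_sq ip_def integral_complex_of_real[symmetric]
  by (simp add: complex_norm_square mult.commute del: of_real_power)

lemma ip_cong_AE:
  assumes "AE x in N. f x = f' x" "AE x in N. g x = g' x"
    "f \<in> borel_measurable N" "g \<in> borel_measurable N" "f' \<in> borel_measurable N" "g' \<in> borel_measurable N"
  shows "ip N f g = ip N f' g'"
  unfolding ip_def by (rule integral_cong_AE) (use assms in \<open>auto intro: borel_measurable_cnj borel_measurable_times borel_measurable_norm borel_measurable_power\<close>)

lemma ip_cong_Lsq:
  assumes "AE x in N. g x = g' x" "f \<in> Lsq N" "g \<in> Lsq N" "g' \<in> Lsq N"
  shows "ip N f g = ip N f g'"
  by (rule ip_cong_AE[OF _ assms(1)]) (use assms(2-4) in \<open>auto dest: LsqD1\<close>)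

lemma nrm_cong_AE:
  assumes "AE x in N. f x = g x" "f \<in> borel_measurable N" "g \<in> borel_measurable N"
  shows "nrm N f = nrm N g"
  unfolding nrm_def by (intro arg_cong[where f=sqrt] integral_cong_AE) (use assms in \<open>auto intro: borel_measurable_cnj borel_measurable_times borel_measurable_norm borel_measurable_power\<close>)

lemma Lsq_cong_AE:
  assumes "AE x in N. f x = g x" "f \<in> Lsq N" "g \<in> borel_measurable N"
  shows "g \<in> Lsq N"
proof (rule LsqI)
  have "integrable N (\<lambda>x. (norm (f x))\<^sup>2) = integrable N (\<lambda>x. (norm (g x))\<^sup>2)"
    by (rule integrable_cong_AE) (use assms in \<open>auto intro: borel_measurable_cnj borel_measurable_times borel_measurable_norm borel_measurable_power\<close>)
  then show "integrable N (\<lambda>x. (norm (g x))\<^sup>2)" using assms by auto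
qed fact

lemma nrm_cmult: "nrm N (\<lambda>x. c * f x) = norm c * nrm N f"
  unfolding nrm_def by (simp add: norm_mult power_mult_distrib real_sqrt_mult)

lemma nrm_cnj: "nrm N (\<lambda>x. cnj (f x)) = nrm N f"
  unfolding nrm_def by simp

lemma nrm_eq_0_iff:
  assumes "f \<in> Lsq N" shows "nrm N f = 0 \<longleftrightarrow> (AE x in N. f x = 0)"
proof -
  have "nrm N f = 0 \<longleftrightarrow> (LINT x|N. (norm (f x))\<^sup>2) = 0" by (simp add: nrm_def)
  also have "\<dots> \<longleftrightarrow> (AE x in N. (norm (f x))\<^sup>2 = 0)"
    by (rule integral_nonneg_eq_0_iff_AE) (use assms in auto)
  finally show ?thesis by simp
qed

text \<open>Integrating \<open>|f g| \<le> (t |f|\<^sup>2 + |g|\<^sup>2 / t) / 2\<close> and choosing the optimal \<open>t\<close> gives the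
  Cauchy--Schwarz inequality.\<close>

lemma Lsq_Cauchy_Schwarz:
  assumes f: "f \<in> Lsq N" and g: "g \<in> Lsq N"
  shows "(LINT x|N. norm (f x) * norm (g x)) \<le> nrm N f * nrm N g"
proof -
  let ?I = "LINT x|N. norm (f x) * norm (g x)"
  have young: "?I \<le> (t * (nrm N f)\<^sup>2 + (nrm N g)\<^sup>2 / t) / 2" if t: "t > 0" for t
  proof -
    have "norm (f x) * norm (g x) \<le> (t * (norm (f x))\<^sup>2 + (norm (g x))\<^sup>2 / t) / 2" for x
    proof -
      have "0 \<le> (t * norm (f x) - norm (g x))\<^sup>2" by simp
      then show ?thesis using t by (simp add: field_simps power2_diff power2_eq_square)
    qed
    then have "?I \<le> (LINT x|N. (t * (norm (f x))\<^sup>2 + (norm (g x))\<^sup>2 / t) / 2)"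
      by (intro integral_mono integrable_norm_mult f g) (use f g in simp_all)
    also have "\<dots> = (t * (nrm N f)\<^sup>2 + (nrm N g)\<^sup>2 / t) / 2"
      unfolding nrm_sq using f g by simp
    finally show ?thesis .
  qed
  show ?thesis
  proof (cases "nrm N f = 0 \<or> nrm N g = 0")
    case True
    then have "(AE x in N. f x = 0) \<or> (AE x in N. g x = 0)" using nrm_eq_0_iff f g by blast
    then have "AE x in N. norm (f x) * norm (g x) = 0" by auto
    then have "?I = 0" by (rule integral_eq_zero_AE)
    then show ?thesis by simp
  next
    case False
    then have "nrm N f > 0" "nrm N g > 0" using nrm_nonneg by (simp_all add: order_less_le)
    then show ?thesis using young[of "nrm N g / nrm N f"] 
      by (simp add: field_simps power2_eq_square)
  qed
qed

lemma norm_ip_le: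
  assumes f: "f \<in> Lsq N" and g: "g \<in> Lsq N"
  shows "norm (ip N f g) \<le> nrm N f * nrm N g"
proof -
  have "norm (ip N f g) \<le> (LINT x|N. norm (cnj (f x) * g x))"
    unfolding ip_def by (rule integral_norm_bound)
  also have "\<dots> \<le> nrm N f * nrm N g" using Lsq_Cauchy_Schwarz[OF f g] by (simp add: norm_mult)
  finally show ?thesis .
qed

lemma nrm_triangle:
  assumes f: "f \<in> Lsq N" and g: "g \<in> Lsq N"
  shows "nrm N (\<lambda>x. f x + g x) \<le> nrm N f + nrm N g"
proof (rule power2_le_imp_le)
  let ?h = "\<lambda>x. f x + g x"
  have "of_real ((nrm N ?h)\<^sup>2) = ip N f f + ip N f g + cnj (ip N f g) + ip N g g"
    using f g unfolding ip_self[symmetric] 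
    by (simp add: ip_add_left ip_add_right Lsq_add ip_commute[of N g f])
  also have "\<dots> = of_real ((nrm N f)\<^sup>2 + 2 * Re (ip N f g) + (nrm N g)\<^sup>2)"
    by (simp add: ip_self complex_eq_iff)
  finally have "(nrm N ?h)\<^sup>2 = (nrm N f)\<^sup>2 + 2 * Re (ip N f g) + (nrm N g)\<^sup>2"
    using of_real_eq_iff by blast
  also have "\<dots> \<le> (nrm N f + nrm N g)\<^sup>2"
    using complex_Re_le_cmod[of "ip N f g"] norm_ip_le[OF f g] by (simp add: power2_sum)
  finally show "(nrm N ?h)\<^sup>2 \<le> (nrm N f + nrm N g)\<^sup>2" .
qed simp

lemma nrm_minus_commute: "nrm N (\<lambda>x. f x - g x) = nrm N (\<lambda>x. g x - f x)"
  unfolding nrm_def by (simp add: norm_minus_commute)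

lemma nrm_triangle_diff:
  assumes "f \<in> Lsq N" "g \<in> Lsq N" "h \<in> Lsq N"
  shows "nrm N (\<lambda>x. f x - h x) \<le> nrm N (\<lambda>x. f x - g x) + nrm N (\<lambda>x. g x - h x)"
  using nrm_triangle[of "\<lambda>x. f x - g x" N "\<lambda>x. g x - h x"] assms by (simp add: Lsq_diff)

lemma nn_integral_nrm:
  assumes "f \<in> Lsq N" shows "(\<integral>\<^sup>+x. ennreal ((norm (f x))\<^sup>2) \<partial>N) = ennreal ((nrm N f)\<^sup>2)"
  unfolding nrm_sq by (rule nn_integral_eq_integral) (use assms in auto)

lemma Lsq_nnI:
  assumes "f \<in> borel_measurable N" "(\<integral>\<^sup>+x. ennreal ((norm (f x))\<^sup>2) \<partial>N) < \<infinity>"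
  shows "f \<in> Lsq N"
  using assms by (intro LsqI integrableI_bounded) auto

lemma nrm_tendsto:
  assumes "\<And>n. f n \<in> Lsq N" "g \<in> Lsq N" "(\<lambda>n. nrm N (\<lambda>x. f n x - g x)) \<longlonglongrightarrow> 0"
  shows "(\<lambda>n. nrm N (f n)) \<longlonglongrightarrow> nrm N g"
proof -
  have "\<bar>nrm N (f n) - nrm N g\<bar> \<le> nrm N (\<lambda>x. f n x - g x)" for n
    using nrm_triangle[of "\<lambda>x. f n x - g x" N g] nrm_triangle[of "\<lambda>x. g x - f n x" N "f n"] assms(1)[of n] assms(2)
    by (simp add: Lsq_diff nrm_minus_commute[of N g])
  then have "(\<lambda>n. nrm N (f n) - nrm N g) \<longlonglongrightarrow> 0"
    by (intro Lim_null_comparison[OF _ assms(3)]) auto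
  then show ?thesis by (simp add: LIM_zero_iff)
qed

lemma ip_tendsto:
  assumes "\<And>n. f n \<in> Lsq N" "g \<in> Lsq N" "(\<lambda>n. nrm N (\<lambda>x. f n x - g x)) \<longlonglongrightarrow> 0" "h \<in> Lsq N"
  shows "(\<lambda>n. ip N h (f n)) \<longlonglongrightarrow> ip N h g"
proof -
  have A: "norm (ip N h (f n) - ip N h g) \<le> nrm N h * nrm N (\<lambda>x. f n x - g x)" for n
    using norm_ip_le[of h N "\<lambda>x. f n x - g x"] assms by (simp add: ip_diff_right Lsq_diff)
  have B: "(\<lambda>n. nrm N h * nrm N (\<lambda>x. f n x - g x)) \<longlonglongrightarrow> 0"
    using tendsto_mult[OF tendsto_const assms(3)] by simp
  have "(\<lambda>n. ip N h (f n) - ip N h g) \<longlonglongrightarrow> 0"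
    by (rule Lim_null_comparison[OF always_eventually B]) (rule allI, rule A)
  then show ?thesis by (simp add: LIM_zero_iff)
qed

text \<open>A sequence converging in norm has a subsequence converging almost everywhere, so a pointwise
  limit must coincide with the limit in norm.\<close>

lemma nrm_tendsto_AE_unique:
  assumes f: "\<And>n. f n \<in> Lsq N" and g: "g \<in> Lsq N" and lim: "(\<lambda>n. nrm N (\<lambda>x. f n x - g x)) \<longlonglongrightarrow> 0"
    and ptw: "AE x in N. (\<lambda>n. f n x) \<longlonglongrightarrow> h x"
  shows "AE x in N. h x = g x"
proof -
  have "\<exists>r::nat\<Rightarrow>nat. strict_mono r \<and> (AE x in N. (\<lambda>n. (norm (f (r n) x - g x))\<^sup>2) \<longlonglongrightarrow> 0)"
  proof (rule tendsto_L1_AE_subseq)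
    show "integrable N (\<lambda>x. (norm (f n x - g x))\<^sup>2)" for n using Lsq_diff[OF f g] by simp
    have "(\<lambda>n. (nrm N (\<lambda>x. f n x - g x))\<^sup>2) \<longlonglongrightarrow> 0\<^sup>2" by (intro tendsto_intros lim)
    then show "(\<lambda>n. LINT x|N. norm ((cmod (f n x - g x))\<^sup>2)) \<longlonglongrightarrow> 0" by (simp add: nrm_sq)
  qed
  then obtain r where r: "strict_mono r" and ae: "AE x in N. (\<lambda>n. (norm (f (r n) x - g x))\<^sup>2) \<longlonglongrightarrow> 0"
    by blast
  show ?thesis using ae ptw
  proof eventually_elim
    case (elim x)
    have "(\<lambda>n. sqrt ((norm (f (r n) x - g x))\<^sup>2)) \<longlonglongrightarrow> sqrt 0" by (intro tendsto_intros elim(1))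
    then have "(\<lambda>n. f (r n) x) \<longlonglongrightarrow> g x" by (simp add: tendsto_norm_zero_iff LIM_zero_iff)
    moreover have "(\<lambda>n. f (r n) x) \<longlonglongrightarrow> h x"
      using LIMSEQ_subseq_LIMSEQ[OF elim(2) r] by (simp add: o_def)
    ultimately show ?case using LIMSEQ_unique by blast
  qed
qed

text \<open>The Riesz--Fischer theorem. Pass to a subsequence whose increments \<open>d\<^sub>k\<close> have norm at most
  \<open>2^(-k)\<close>. Then \<open>\<Sum> 2^k |d\<^sub>k|\<^sup>2\<close> is integrable, hence finite almost everywhere, and the increments
  decay geometrically there. Fatou's lemma turns the pointwise limit into a limit in norm.\<close>

lemma Lsq_complete:
  assumes f: "\<And>n. f n \<in> Lsq N"
    and cauchy: "\<And>e. e > 0 \<Longrightarrow> \<exists>n0. \<forall>m\<ge>n0. \<forall>n\<ge>n0. nrm N (\<lambda>x. f m x - f n x) < e"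
  shows "\<exists>g\<in>Lsq N. (\<lambda>n. nrm N (\<lambda>x. f n x - g x)) \<longlonglongrightarrow> 0"
proof -
  have [measurable]: "f n \<in> borel_measurable N" for n using f by auto
  have "\<exists>n0. \<forall>m\<ge>n0. \<forall>n\<ge>n0. nrm N (\<lambda>x. f m x - f n x) < (1/2) ^ k" for k :: nat
    by (rule cauchy) simp
  then obtain s where s: "\<And>k m n. m \<ge> s k \<Longrightarrow> n \<ge> s k \<Longrightarrow> nrm N (\<lambda>x. f m x - f n x) < (1/2) ^ k"
    by metis
  \<comment> \<open>Partial sums make the indices increasing while keeping \<open>r k \<ge> s k\<close>.\<close>
  define r where "r k = (\<Sum>i\<le>k. s i)" for k
  have r_ge: "r j \<ge> s k" if "j \<ge> k" for j k
    unfolding r_def using that by (intro member_le_sum) auto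
  define d where "d k x = f (r (Suc k)) x - f (r k) x" for k x
  have d: "d k \<in> Lsq N" for k unfolding d_def by (intro Lsq_diff f)
  have [measurable]: "d k \<in> borel_measurable N" for k using d by auto
  have nd: "(nrm N (d k))\<^sup>2 \<le> (1/4) ^ k" for k
  proof -
    have "nrm N (d k) \<le> (1/2) ^ k" unfolding d_def
      by (rule less_imp_le, rule s; rule r_ge) auto
    then have "(nrm N (d k))\<^sup>2 \<le> ((1/2) ^ k)\<^sup>2" by (intro power_mono) auto
    then show ?thesis by (simp add: power2_eq_square power_mult_distrib[symmetric])
  qed
  have "(\<integral>\<^sup>+x. (\<Sum>k. ennreal (2 ^ k * (norm (d k x))\<^sup>2)) \<partial>N) = (\<Sum>k. \<integral>\<^sup>+x. ennreal (2 ^ k * (norm (d k x))\<^sup>2) \<partial>N)"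
    by (rule nn_integral_suminf) measurable
  also have "\<dots> \<le> (\<Sum>k. ennreal ((1/2) ^ k))"
  proof (intro suminf_le summableI)
    fix k :: nat
    have "(\<integral>\<^sup>+x. ennreal (2 ^ k * (norm (d k x))\<^sup>2) \<partial>N) = ennreal (2 ^ k) * (\<integral>\<^sup>+x. ennreal ((norm (d k x))\<^sup>2) \<partial>N)"
      by (subst nn_integral_cmult[symmetric]) (auto simp: ennreal_mult')
    also have "\<dots> = ennreal (2 ^ k * (nrm N (d k))\<^sup>2)"
      by (simp add: nn_integral_nrm[OF d] ennreal_mult')
    also have "\<dots> \<le> ennreal (2 ^ k * (1/4) ^ k)"
      using nd by (intro ennreal_leI mult_left_mono) auto
    also have "2 ^ k * (1/4) ^ k = ((1/2) ^ k :: real)" by (simp add: power_mult_distrib[symmetric])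
    finally show "(\<integral>\<^sup>+x. ennreal (2 ^ k * (norm (d k x))\<^sup>2) \<partial>N) \<le> ennreal ((1/2) ^ k)" .
  qed
  also have "\<dots> = ennreal (\<Sum>k. (1/2) ^ k)"
    by (rule suminf_ennreal2) (auto intro: summable_geometric)
  finally have "(\<integral>\<^sup>+x. (\<Sum>k. ennreal (2 ^ k * (norm (d k x))\<^sup>2)) \<partial>N) \<noteq> \<infinity>" 
    by (metis ennreal_less_top infinity_ennreal_def order_le_less_trans order_less_irrefl)
  then have "AE x in N. (\<Sum>k. ennreal (2 ^ k * (norm (d k x))\<^sup>2)) \<noteq> \<infinity>"
    by (intro nn_integral_noteq_infinite) auto
  then have conv: "AE x in N. convergent (\<lambda>k. f (r k) x)"
  proof eventually_elim
    case (elim x)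
    then have sum: "summable (\<lambda>k. 2 ^ k * (norm (d k x))\<^sup>2)"
      by (intro summable_suminf_not_top) auto
    have "(\<lambda>k. 2 ^ k * (norm (d k x))\<^sup>2) \<longlonglongrightarrow> 0" by (rule summable_LIMSEQ_zero[OF sum])
    then have "Bseq (\<lambda>k. 2 ^ k * (norm (d k x))\<^sup>2)"
      by (intro convergent_imp_Bseq convergentI)
    then obtain B where B: "\<And>k. norm (2 ^ k * (norm (d k x))\<^sup>2) \<le> B"
      unfolding Bseq_def by blast
    have geo: "norm (d k x) \<le> sqrt B * (sqrt (1/2)) ^ k" for k
    proof (rule power2_le_imp_le)
      have "(norm (d k x))\<^sup>2 * 2 ^ k \<le> B" using B[of k] by (simp add: mult.commute)
      then have "(norm (d k x))\<^sup>2 \<le> B * (1/2) ^ k" by (simp add: field_simps power_divide)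
      also have "\<dots> = (sqrt B * (sqrt (1/2)) ^ k)\<^sup>2"
      proof -
        have "B \<ge> 0" using B[of 0] norm_ge_zero order_trans by blast
        moreover have "(sqrt (1/2) ^ k)\<^sup>2 = ((sqrt (1/2))\<^sup>2) ^ k"
          by (simp only: power_mult[symmetric] mult.commute)
        moreover have "(sqrt (1/2))\<^sup>2 = (1/2 :: real)" by (rule real_sqrt_pow2) simp
        ultimately show ?thesis by (simp add: power_mult_distrib)
      qed
      finally show "(norm (d k x))\<^sup>2 \<le> (sqrt B * (sqrt (1/2)) ^ k)\<^sup>2" .
    next
      have "B \<ge> 0" using B[of 0] norm_ge_zero order_trans by blast
      then show "0 \<le> sqrt B * (sqrt (1/2)) ^ k" by simp
    qed
    have "summable (\<lambda>k. sqrt B * (sqrt (1/2)) ^ k)"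
      by (intro summable_mult summable_geometric) (simp add: real_sqrt_divide)
    then have "summable (\<lambda>k. d k x)"
      by (rule summable_comparison_test'[of _ 0]) (rule geo)
    then have "convergent (\<lambda>n. \<Sum>k<n. d k x)" by (simp add: summable_iff_convergent)
    moreover have "(\<Sum>k<n. d k x) = f (r n) x - f (r 0) x" for n
      unfolding d_def by (rule sum_lessThan_telescope)
    ultimately have "convergent (\<lambda>n. (f (r n) x - f (r 0) x) + f (r 0) x)"
      by (intro convergent_add convergent_const) simp
    then show ?case by simp
  qed
  define g where "g x = lim (\<lambda>k. f (r k) x)" for x
  have [measurable]: "g \<in> borel_measurable N" unfolding g_def
    by (rule borel_measurable_lim_metric) measurable
  have lim: "AE x in N. (\<lambda>k. f (r k) x) \<longlonglongrightarrow> g x"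
    using conv by eventually_elim (simp add: g_def convergent_LIMSEQ_iff)
  have bound: "(\<integral>\<^sup>+x. ennreal ((norm (f n x - g x))\<^sup>2) \<partial>N) \<le> ennreal (((1/2) ^ k)\<^sup>2)" if n: "n \<ge> s k" for n k
  proof -
    have "(\<integral>\<^sup>+x. ennreal ((norm (f n x - g x))\<^sup>2) \<partial>N) = (\<integral>\<^sup>+x. liminf (\<lambda>j. ennreal ((norm (f n x - f (r j) x))\<^sup>2)) \<partial>N)"
    proof (rule nn_integral_cong_AE, use lim in eventually_elim)
      case (elim x)
      have "(\<lambda>j. ennreal ((norm (f n x - f (r j) x))\<^sup>2)) \<longlonglongrightarrow> ennreal ((norm (f n x - g x))\<^sup>2)"
        by (intro tendsto_intros tendsto_ennrealI elim)
      then show ?case by (rule lim_imp_Liminf[OF sequentially_bot, symmetric])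
    qed
    also have "\<dots> \<le> liminf (\<lambda>j. \<integral>\<^sup>+x. ennreal ((norm (f n x - f (r j) x))\<^sup>2) \<partial>N)"
      by (rule nn_integral_liminf) measurable
    also have "\<dots> \<le> liminf (\<lambda>j::nat. ennreal (((1/2) ^ k)\<^sup>2))"
    proof (intro Liminf_mono eventually_sequentiallyI[of k])
      fix j assume "k \<le> j"
      then have "nrm N (\<lambda>x. f n x - f (r j) x) \<le> (1/2) ^ k" by (rule less_imp_le[OF s[OF n r_ge]])
      then show "(\<integral>\<^sup>+x. ennreal ((norm (f n x - f (r j) x))\<^sup>2) \<partial>N) \<le> ennreal (((1/2) ^ k)\<^sup>2)"
        by (subst nn_integral_nrm[OF Lsq_diff[OF f f]]) (intro ennreal_leI power_mono, auto)
    qed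
    also have "\<dots> = ennreal (((1/2) ^ k)\<^sup>2)" by (rule Liminf_const) simp
    finally show ?thesis .
  qed
  have diff: "(\<lambda>x. f n x - g x) \<in> Lsq N" if "n \<ge> s 0" for n
    using bound[OF that] by (intro Lsq_nnI) (auto intro: order_le_less_trans)
  have g: "g \<in> Lsq N"
    using Lsq_diff[OF f[of "s 0"] diff[of "s 0"]] by simp
  have "nrm N (\<lambda>x. f n x - g x) \<le> (1/2) ^ k" if "n \<ge> s k" for n k
  proof (rule power2_le_imp_le)
    show "(nrm N (\<lambda>x. f n x - g x))\<^sup>2 \<le> ((1/2) ^ k)\<^sup>2"
      using bound[OF that] unfolding nn_integral_nrm[OF Lsq_diff[OF f g]]
      by (subst (asm) ennreal_le_iff) auto
  qed simp
  moreover have "\<exists>k. (1/2::real) ^ k < e" if "e > 0" for e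
    using real_arch_pow_inv[OF that, of "1/2"] by simp
  ultimately have "(\<lambda>n. nrm N (\<lambda>x. f n x - g x)) \<longlonglongrightarrow> 0"
    unfolding LIMSEQ_def by (metis abs_of_nonneg dist_0_norm dist_commute nrm_nonneg order_le_less_trans real_norm_def)
  then show ?thesis using g by blast
qed

lemma bessel_inequality:
  fixes n :: nat
  assumes f: "\<And>i. i < n \<Longrightarrow> f i \<in> Lsq N" and g: "g \<in> Lsq N"
    and orth: "\<And>i j. i < n \<Longrightarrow> j < n \<Longrightarrow> ip N (f i) (f j) = (if i = j then 1 else 0)"
  shows "(\<Sum>i<n. (norm (ip N (f i) g))\<^sup>2) \<le> (nrm N g)\<^sup>2"
proof -
  define c where "c i = ip N (f i) g" for i
  define S where "S x = (\<Sum>i<n. c i * f i x)" for x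
  have S: "S \<in> Lsq N" unfolding S_def by (intro Lsq_sum Lsq_cmult f) auto
  define h where "h x = g x - S x" for x
  have h: "h \<in> Lsq N" unfolding h_def by (intro Lsq_diff g S)
  have fS: "ip N (f i) S = c i" if "i < n" for i
  proof -
    have "ip N (f i) S = (\<Sum>j<n. c j * ip N (f i) (f j))"
      unfolding S_def using that by (intro ip_sum_right f) auto
    also have "\<dots> = (\<Sum>j<n. if i = j then c j else 0)"
      using that orth by (intro sum.cong) auto
    also have "\<dots> = c i" using that by (subst sum.delta') simp_all
    finally show ?thesis .
  qed
  have SS: "ip N S S = of_real (\<Sum>i<n. (norm (c i))\<^sup>2)"
  proof -
    have "ip N S S = (\<Sum>i<n. cnj (c i) * ip N (f i) S)"
      unfolding S_def[abs_def] using S f unfolding S_def[abs_def] by (intro ip_sum_left) auto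
    also have "\<dots> = (\<Sum>i<n. of_real ((norm (c i))\<^sup>2))"
      by (intro sum.cong) (auto simp: fS complex_norm_square mult.commute simp del: of_real_power)
    finally show ?thesis by simp
  qed
  have Sg: "ip N S g = of_real (\<Sum>i<n. (norm (c i))\<^sup>2)"
  proof -
    have "ip N S g = (\<Sum>i<n. cnj (c i) * ip N (f i) g)"
      unfolding S_def[abs_def] using g f by (intro ip_sum_left) auto
    also have "\<dots> = (\<Sum>i<n. of_real ((norm (c i))\<^sup>2))"
      by (intro sum.cong) (auto simp: c_def complex_norm_square mult.commute simp del: of_real_power)
    finally show ?thesis by simp
  qed
  have gS: "ip N g S = of_real (\<Sum>i<n. (norm (c i))\<^sup>2)"
    by (subst ip_commute) (simp add: Sg)
  have "ip N h h = ip N g g - ip N g S - ip N S g + ip N S S"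
    unfolding h_def using g S by (simp add: ip_diff_left ip_diff_right Lsq_diff)
  then have "complex_of_real ((nrm N h)\<^sup>2) = of_real ((nrm N g)\<^sup>2 - (\<Sum>i<n. (norm (c i))\<^sup>2))"
    unfolding gS Sg SS by (simp add: ip_self)
  then have "(nrm N h)\<^sup>2 = (nrm N g)\<^sup>2 - (\<Sum>i<n. (norm (c i))\<^sup>2)" using of_real_eq_iff by blast
  then show ?thesis unfolding c_def by (metis diff_ge_0_iff_ge zero_le_power2)
qed

text \<open>Gaussian elimination: an unknown with nonzero coefficient in the last equation is expressed by
  the others. This finds vectors orthogonal to a given finite system, and it shows that all
  bases of an eigenspace have the same length.\<close>

lemma underdetermined_system:
  fixes A :: "nat \<Rightarrow> 'i \<Rightarrow> complex"
  assumes "finite I" "card I > n"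
  shows "\<exists>c. (\<exists>p\<in>I. c p \<noteq> 0) \<and> (\<forall>i<n. (\<Sum>p\<in>I. A i p * c p) = 0)"
  using assms
proof (induction n arbitrary: I A)
  case 0
  then obtain p where "p \<in> I" by fastforce
  then show ?case by (intro exI[of _ "\<lambda>_. 1"]) auto
next
  case (Suc n)
  show ?case
  proof (cases "\<forall>p\<in>I. A n p = 0")
    case True
    from Suc.IH[of I A] Suc.prems obtain c where "\<exists>p\<in>I. c p \<noteq> 0" "\<forall>i<n. (\<Sum>p\<in>I. A i p * c p) = 0" by auto
    then show ?thesis using True by (intro exI[of _ c]) (auto simp: less_Suc_eq)
  next
    case False
    then obtain q where q: "q \<in> I" "A n q \<noteq> 0" by blast
    define I' where "I' = I - {q}"
    have I': "finite I'" "card I' > n" "I = insert q I'" "q \<notin> I'"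
      using Suc.prems q by (auto simp: I'_def)
    from Suc.IH[OF I'(1,2), of "\<lambda>i p. A i p - A i q * A n p / A n q"]
    obtain c where c: "\<exists>p\<in>I'. c p \<noteq> 0" "\<And>i. i < n \<Longrightarrow> (\<Sum>p\<in>I'. (A i p - A i q * A n p / A n q) * c p) = 0" by blast
    define t where "t = - (\<Sum>p\<in>I'. A n p * c p) / A n q"
    define c' where "c' = c(q := t)"
    have c'_sum: "(\<Sum>p\<in>I. A i p * c' p) = A i q * t + (\<Sum>p\<in>I'. A i p * c p)" for i
    proof -
      have "(\<Sum>p\<in>I'. A i p * c' p) = (\<Sum>p\<in>I'. A i p * c p)"
        using I'(4) by (intro sum.cong) (auto simp: c'_def)
      then show ?thesis using I' by (simp add: c'_def)
    qed
    have "(\<Sum>p\<in>I. A i p * c' p) = 0" if "i < Suc n" for i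
    proof (cases "i = n")
      case True
      then show ?thesis unfolding c'_sum t_def using q by simp
    next
      case False
      then have "i < n" using that by simp
      have "(\<Sum>p\<in>I'. A i p * c p) - (\<Sum>p\<in>I'. A i q / A n q * (A n p * c p))
          = (\<Sum>p\<in>I'. (A i p - A i q * A n p / A n q) * c p)"
        unfolding sum_subtractf[symmetric] by (intro sum.cong) (auto simp: left_diff_distrib)
      then have "(\<Sum>p\<in>I'. A i p * c p) = (\<Sum>p\<in>I'. A i q / A n q * (A n p * c p))"
        using c(2)[OF \<open>i < n\<close>] by simp
      also have "\<dots> = A i q / A n q * (\<Sum>p\<in>I'. A n p * c p)" by (simp add: sum_distrib_left)
      finally show ?thesis unfolding c'_sum t_def using q by simp
    qed
    moreover have "\<exists>p\<in>I. c' p \<noteq> 0" using c(1) I' by (auto simp: c'_def)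
    ultimately show ?thesis by blast
  qed
qed

section \<open>Fourier integrals of measures\<close>

text \<open>The transform of the complex measure \<open>f N\<close>; for \<open>N = lborel\<close> it is the usual Fourier
  integral.\<close>

definition FT :: "real measure \<Rightarrow> (real \<Rightarrow> complex) \<Rightarrow> real \<Rightarrow> complex" where
  "FT N f k = (LINT x|N. cis (- (2 * pi * k * x)) * f x)"

lemma fourier_integral_FT: "fourier_integral = FT lborel"
  by (simp add: fourier_integral_def FT_def fun_eq_iff cis_conv_exp mult_ac)

lemma borel_measurable_cis [measurable]:
  "f \<in> borel_measurable N \<Longrightarrow> (\<lambda>x. cis (f x)) \<in> borel_measurable N"
  by (rule borel_measurable_continuous_on[of cis]) (auto intro: continuous_intros)

lemma FT_measurable [measurable]:
  assumes "sigma_finite_measure N" and N[measurable_cong]: "sets N = sets borel" and [measurable]: "f \<in> borel_measurable borel"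
  shows "FT N f \<in> borel_measurable borel"
proof -
  interpret sigma_finite_measure N by fact
  show ?thesis unfolding FT_def[abs_def] by measurable
qed

lemma integrable_unimodular:
  fixes f :: "real \<Rightarrow> complex"
  assumes N[measurable_cong]: "sets N = sets borel" and f: "integrable N f"
  shows "integrable N (\<lambda>x. cis (a * x) * f x)" "integrable N (\<lambda>x. cis (- (a * x)) * f x)"
proof -
  have [measurable]: "f \<in> borel_measurable borel" using f N by (simp add: borel_measurable_integrable cong: measurable_cong_sets)
  show "integrable N (\<lambda>x. cis (a * x) * f x)" "integrable N (\<lambda>x. cis (- (a * x)) * f x)"
    by (rule Bochner_Integration.integrable_bound[OF f], measurable, simp add: norm_mult)+
qed

lemma norm_FT_le: 
  assumes "sets N = sets borel"
  shows "norm (FT N f k) \<le> (LINT x|N. norm (f x))"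
proof -
  have "norm (FT N f k) \<le> (LINT x|N. norm (cis (- (2 * pi * k * x)) * f x))"
    unfolding FT_def by (rule integral_norm_bound)
  then show ?thesis by (simp add: norm_mult)
qed

lemma FT_add:
  assumes "sets N = sets borel" "integrable N f" "integrable N g"
  shows "FT N (\<lambda>x. f x + g x) k = FT N f k + FT N g k"
  unfolding FT_def using assms integrable_unimodular(2)[of N _ "2 * pi * k"] by (simp add: distrib_left)

lemma FT_diff:
  assumes "sets N = sets borel" "integrable N f" "integrable N g"
  shows "FT N (\<lambda>x. f x - g x) k = FT N f k - FT N g k"
  unfolding FT_def using assms integrable_unimodular(2)[of N _ "2 * pi * k"] by (simp add: right_diff_distrib)

lemma FT_cmult: "FT N (\<lambda>x. c * f x) k = c * FT N f k"
  unfolding FT_def by (simp add: mult.left_commute[of _ c])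

lemma FT_continuous:
  assumes N: "sets N = sets borel" and f: "integrable N f"
  shows "continuous_on UNIV (FT N f)"
proof (rule continuous_at_imp_continuous_on, rule ballI)
  note N[measurable_cong]
  have [measurable]: "f \<in> borel_measurable borel" using f N by (simp add: borel_measurable_integrable cong: measurable_cong_sets)
  fix k :: real
  show "isCont (FT N f) k"
    unfolding continuous_at_sequentially o_def
  proof (intro allI impI)
    fix s :: "nat \<Rightarrow> real" assume s: "s \<longlonglongrightarrow> k"
    show "(\<lambda>n. FT N f (s n)) \<longlonglongrightarrow> FT N f k"
      unfolding FT_def
    proof (rule integral_dominated_convergence[where w="\<lambda>x. norm (f x)"])
      show "AE x in N. (\<lambda>n. cis (- (2 * pi * s n * x)) * f x) \<longlonglongrightarrow> cis (- (2 * pi * k * x)) * f x"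
        by (intro AE_I2 tendsto_intros s)
    qed (use f in \<open>auto simp: norm_mult\<close>)
  qed
qed

text \<open>Every application of Fubini's theorem below concerns a product of two integrable functions of
  separate variables and a bounded kernel.\<close>

lemma integrable_pair_bounded_mult:
  fixes f :: "'a \<Rightarrow> complex" and g :: "'b \<Rightarrow> complex" and u :: "'a \<times> 'b \<Rightarrow> complex"
  assumes "sigma_finite_measure M1" "sigma_finite_measure M2"
    and f: "integrable M1 f" and g: "integrable M2 g"
    and u[measurable]: "u \<in> borel_measurable (M1 \<Otimes>\<^sub>M M2)" and bd: "\<And>p. norm (u p) \<le> B"
  shows "integrable (M1 \<Otimes>\<^sub>M M2) (\<lambda>(x, y). u (x, y) * (f x * g y))"
proof -
  interpret M1: sigma_finite_measure M1 by fact
  interpret M2: sigma_finite_measure M2 by fact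
  interpret pair_sigma_finite M1 M2 ..
  note [measurable] = borel_measurable_integrable[OF f] borel_measurable_integrable[OF g]
  have fg: "integrable (M1 \<Otimes>\<^sub>M M2) (\<lambda>(x, y). f x * g y)"
  proof (rule Fubini_integrable)
    show "integrable M1 (\<lambda>x. LINT y|M2. norm (case (x, y) of (x, y) \<Rightarrow> f x * g y))"
      using f by (simp add: norm_mult)
  qed (use g in auto)
  show ?thesis
  proof (rule Bochner_Integration.integrable_bound[OF integrable_mult_right[OF fg, of "of_real B"]])
    have "norm (u (x, y) * (f x * g y)) \<le> norm (complex_of_real B * (f x * g y))" for x y
    proof -
      have "norm (u (x, y)) \<le> \<bar>B\<bar>" using bd[of "(x, y)"] by linarith
      then have "norm (u (x, y)) * norm (f x * g y) \<le> \<bar>B\<bar> * norm (f x * g y)"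
        by (rule mult_right_mono) simp
      then show ?thesis by (simp add: norm_mult)
    qed
    then show "AE p in M1 \<Otimes>\<^sub>M M2. norm (case p of (x, y) \<Rightarrow> u (x, y) * (f x * g y)) \<le>
        norm (complex_of_real B * (case p of (x, y) \<Rightarrow> f x * g y))" by auto
  qed measurable
qed

text \<open>Modulating \<open>f\<close> and \<open>g\<close> by \<open>exp(- 2\<pi>ikx)\<close> multiplies a kernel depending on \<open>x - y\<close> by
  \<open>exp(- 2\<pi>ik(x - y))\<close>; averaging over \<open>k\<close> with weight \<open>w\<close> therefore multiplies it by the
  Fourier transform of \<open>w\<close>. With \<open>w\<close> a Gaussian this regularises the Fourier transform, and
  with \<open>w\<close> a resolvent kernel it yields the monotonicity in \<open>\<omega>\<close>.\<close>

lemma FT_difference_average: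
  assumes N: "sigma_finite_measure N" and sN: "sets N = sets borel" and f: "integrable N f" and g: "integrable N g"
    and w: "integrable lborel w" and R[measurable]: "R \<in> borel_measurable borel" and bd: "\<And>x. norm (R x) \<le> B"
  shows "(LINT k|lborel. w k * (LINT x|N. LINT y|N. R (x - y) * ((cis (- (2 * pi * k * x)) * f x) * cnj (cis (- (2 * pi * k * y)) * g y)))) =
         (LINT x|N. LINT y|N. FT lborel w (x - y) * R (x - y) * (f x * cnj (g y)))"
proof -
  interpret N: sigma_finite_measure N by fact
  interpret NN: pair_sigma_finite N N ..
  note sN[measurable_cong]
  have [measurable]: "f \<in> borel_measurable borel" "g \<in> borel_measurable borel" "w \<in> borel_measurable borel" 
    using f g w sN by (simp_all add: borel_measurable_integrable cong: measurable_cong_sets)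
  let ?P = "N \<Otimes>\<^sub>M N"
  interpret L: pair_sigma_finite lborel ?P ..
  have cg: "integrable N (\<lambda>y. cnj (g y))" using g by simp
  let ?H = "\<lambda>p. R (fst p - snd p) * (f (fst p) * cnj (g (snd p)))"
  have H: "integrable ?P ?H"
    using integrable_pair_bounded_mult[OF N N f cg, of "\<lambda>p. R (fst p - snd p)" B] bd by (simp add: case_prod_beta')
  have P1: "(LINT x|N. LINT y|N. R (x - y) * ((cis (- (2 * pi * k * x)) * f x) * cnj (cis (- (2 * pi * k * y)) * g y)))
     = (LINT p|?P. cis (- (2 * pi * k * (fst p - snd p))) * ?H p)" for k
  proof -
    have bd': "norm (cis (- (2 * pi * k * (fst p - snd p))) * R (fst p - snd p)) \<le> B" for p using bd by (simp add: norm_mult)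
    have "integrable ?P (\<lambda>(x, y). (cis (- (2 * pi * k * (fst (x,y) - snd (x,y)))) * R (fst (x,y) - snd (x,y))) * (f x * cnj (g y)))"
      by (rule integrable_pair_bounded_mult[OF N N f cg, where u="\<lambda>p. cis (- (2 * pi * k * (fst p - snd p))) * R (fst p - snd p)", OF _ bd']) auto
    from NN.integral_fst'[OF this]
    have "(LINT p|?P. cis (- (2 * pi * k * (fst p - snd p))) * ?H p)
       = (LINT x|N. LINT y|N. cis (- (2 * pi * k * (x - y))) * R (x - y) * (f x * cnj (g y)))"
      by (simp add: case_prod_beta' mult.assoc)
    also have "\<dots> = (LINT x|N. LINT y|N. R (x - y) * ((cis (- (2 * pi * k * x)) * f x) * cnj (cis (- (2 * pi * k * y)) * g y)))"
    proof (intro Bochner_Integration.integral_cong refl)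
      fix x y
      have "cis (- (2 * pi * k * (x - y))) = cis (- (2 * pi * k * x)) * cis (2 * pi * k * y)" by (simp add: cis_mult algebra_simps)
      then show "cis (- (2 * pi * k * (x - y))) * R (x - y) * (f x * cnj (g y)) = R (x - y) * ((cis (- (2 * pi * k * x)) * f x) * cnj (cis (- (2 * pi * k * y)) * g y))"
        by (simp add: cis_cnj mult_ac)
    qed
    finally show ?thesis by simp
  qed
  have int: "integrable (lborel \<Otimes>\<^sub>M ?P) (\<lambda>(k, p). cis (- (2 * pi * k * (fst p - snd p))) * (w k * ?H p))"
    using integrable_pair_bounded_mult[OF lborel.sigma_finite_measure_axioms NN.sigma_finite_measure_axioms w H, where B=1 
        and u="\<lambda>(k,p). cis (- (2 * pi * k * (fst p - snd p)))"] by (simp add: case_prod_beta')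
  have "(LINT k|lborel. w k * (LINT x|N. LINT y|N. R (x - y) * ((cis (- (2 * pi * k * x)) * f x) * cnj (cis (- (2 * pi * k * y)) * g y)))) =
     (LINT k|lborel. LINT p|?P. cis (- (2 * pi * k * (fst p - snd p))) * (w k * ?H p))"
    unfolding P1 by (simp add: mult.left_commute[of _ "w _"])
  also have "\<dots> = (LINT p|?P. LINT k|lborel. cis (- (2 * pi * k * (fst p - snd p))) * (w k * ?H p))"
    by (rule L.Fubini_integral[OF int, symmetric])
  also have "\<dots> = (LINT p|?P. FT lborel w (fst p - snd p) * ?H p)"
    unfolding FT_def by (simp add: mult.assoc[symmetric] mult_ac(2)[of _ "fst _ - snd _"])
  also have "\<dots> = (LINT x|N. LINT y|N. FT lborel w (x - y) * R (x - y) * (f x * cnj (g y)))"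
  proof -
    have [measurable]: "FT lborel w \<in> borel_measurable borel"
      by (rule FT_measurable) (auto intro: lborel.sigma_finite_measure_axioms)
    have bd': "norm (FT lborel w (fst p - snd p) * R (fst p - snd p)) \<le> (LINT x|lborel. norm (w x)) * B" for p
      unfolding norm_mult by (intro mult_mono norm_FT_le bd) (auto intro: order_trans[OF norm_ge_zero norm_FT_le])
    have "integrable ?P (\<lambda>(x, y). (FT lborel w (fst (x,y) - snd (x,y)) * R (fst (x,y) - snd (x,y))) * (f x * cnj (g y)))"
      by (rule integrable_pair_bounded_mult[OF N N f cg, where u="\<lambda>p. FT lborel w (fst p - snd p) * R (fst p - snd p)", OF _ bd']) auto
    from NN.integral_fst'[OF this] show ?thesis by (simp add: case_prod_beta' mult.assoc)
  qed
  finally show ?thesis .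
qed

text \<open>For a constant kernel the inner double integral factors into the two transforms.\<close>

lemma FT_weighted_form:
  assumes N: "sigma_finite_measure N" and sN: "sets N = sets borel"
    and f: "integrable N f" and g: "integrable N g" and w: "integrable lborel w"
  shows "(LINT k|lborel. w k * (cnj (FT N g k) * FT N f k)) =
         (LINT x|N. LINT y|N. FT lborel w (x - y) * (f x * cnj (g y)))"
proof -
  have "cnj (FT N g k) * FT N f k =
      (LINT x|N. LINT y|N. 1 * ((cis (- (2 * pi * k * x)) * f x) * cnj (cis (- (2 * pi * k * y)) * g y)))" for k
  proof -
    have "cnj (FT N g k) = (LINT y|N. cnj (cis (- (2 * pi * k * y)) * g y))"
      unfolding FT_def by (rule Bochner_Integration.integral_cnj[symmetric])
    then show ?thesis by (simp only: mult_1 integral_mult_right_zero integral_mult_left_zero FT_def mult.commute)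
  qed
  then show ?thesis
    using FT_difference_average[OF N sN f g w, of "\<lambda>_. 1" 1] by simp
qed

section \<open>Gaussian regularisation\<close>

text \<open>Scaled so that its Fourier transform is the normal density with standard deviation \<open>\<sigma>\<close>.\<close>

definition gauss :: "real \<Rightarrow> real \<Rightarrow> complex" where
  "gauss \<sigma> k = of_real (exp (- (2 * pi * \<sigma> * k)\<^sup>2 / 2))"

lemma gauss_integrable: assumes "\<sigma> > 0" shows "integrable lborel (gauss \<sigma>)"
  and FT_gauss: "FT lborel (gauss \<sigma>) t = of_real (normal_density 0 \<sigma> t)"
proof -
  define c where "c = 2 * pi * \<sigma>"
  have c: "c > 0" using assms by (simp add: c_def)
  have g: "gauss \<sigma> k = of_real (sqrt (2 * pi) * std_normal_density (0 + c * k))" for k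
    by (simp add: gauss_def std_normal_density_def c_def)
  show int: "integrable lborel (gauss \<sigma>)"
    unfolding g[abs_def] using c
    by (intro integrable_of_real integrable_mult_right lborel_integrable_real_affine) auto
  have "char std_normal_distribution (- (2 * pi * t / c)) = (LINT x|lborel. of_real (std_normal_density x) * iexp (- (2 * pi * t / c) * x))"
    unfolding char_def by (subst integral_density) (auto simp: scaleR_conv_of_real)
  also have "\<dots> = c *\<^sub>R (LINT x|lborel. of_real (std_normal_density (0 + c * x)) * iexp (- (2 * pi * t / c) * (0 + c * x)))"
    by (subst lborel_integral_real_affine[of c _ 0]) (use c in auto)
  also have "\<dots> = c *\<^sub>R (LINT x|lborel. of_real (1 / sqrt (2 * pi)) * (cis (- (2 * pi * t * x)) * gauss \<sigma> x))"
    using c by (intro arg_cong2[where f=scaleR] refl Bochner_Integration.integral_cong)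
     (simp_all add: g cis_conv_exp mult_ac)
  also have "\<dots> = c *\<^sub>R (of_real (1 / sqrt (2 * pi)) * FT lborel (gauss \<sigma>) t)"
    unfolding FT_def by (simp only: integral_mult_right_zero)
  finally have "of_real (exp (- (2 * pi * t / c)\<^sup>2 / 2)) = c *\<^sub>R (of_real (1 / sqrt (2 * pi)) * FT lborel (gauss \<sigma>) t)"
    unfolding char_std_normal_distribution by simp
  then have "FT lborel (gauss \<sigma>) t = of_real (sqrt (2 * pi) / c * exp (- (2 * pi * t / c)\<^sup>2 / 2))"
    using c by (simp add: scaleR_conv_of_real field_simps)
  also have "sqrt (2 * pi) / c * exp (- (2 * pi * t / c)\<^sup>2 / 2) = normal_density 0 \<sigma> t"
  proof -
    \<comment> \<open>The constants of the two normalisations of the Gaussian agree.\<close>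
    have "sqrt (2 * pi) / c = 1 / sqrt (2 * pi * \<sigma>\<^sup>2)"
      using assms by (simp add: c_def real_sqrt_mult field_simps real_sqrt_mult_self)
    moreover have "2 * pi * t / c = t / \<sigma>" using assms by (simp add: c_def)
    ultimately show ?thesis by (simp add: normal_density_def power_divide)
  qed
  finally show "FT lborel (gauss \<sigma>) t = of_real (normal_density 0 \<sigma> t)" .
qed

lemma normal_density_translate:
  assumes "\<sigma> > 0"
  shows "integrable lborel (\<lambda>y. normal_density 0 \<sigma> (x - y))" "(LINT y|lborel. normal_density 0 \<sigma> (x - y)) = 1"
  using lborel_integrable_real_affine[OF integrable_normal_density[OF assms, of 0], of "-1" x]
    lborel_integral_real_affine[of "-1" "normal_density 0 \<sigma>" x] integral_normal_density[OF assms, of 0] by auto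

lemma nn_integral_translate_gauss:
  assumes "\<sigma> > 0"
  shows "(\<integral>\<^sup>+y. ennreal (normal_density 0 \<sigma> (x - y)) \<partial>lborel) = 1" 
    and "(\<integral>\<^sup>+y. ennreal (normal_density 0 \<sigma> (y - x)) \<partial>lborel) = 1"
proof -
  show *: "(\<integral>\<^sup>+y. ennreal (normal_density 0 \<sigma> (x - y)) \<partial>lborel) = 1" for x
    using normal_density_translate[OF assms, of x] assms by (subst nn_integral_eq_integral) auto
  have "normal_density 0 \<sigma> (y - x) = normal_density 0 \<sigma> (x - y)" for y 
    by (simp add: normal_density_def power2_commute)
  then show "(\<integral>\<^sup>+y. ennreal (normal_density 0 \<sigma> (y - x)) \<partial>lborel) = 1" by (simp add: *)
qed

text \<open>In position space the left-hand side is \<open>\<integral>\<integral> n\<^sub>\<sigma>(x - y) f(x) cnj (f(y)) dx dy\<close> with a normal density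
  \<open>n\<^sub>\<sigma>\<close>. Since \<open>n\<^sub>\<sigma>\<close> has mass one in either variable, \<open>|f(x) f(y)| \<le> (|f(x)|\<^sup>2 + |f(y)|\<^sup>2) / 2\<close>
  gives the bound.\<close>

lemma FT_gauss_bound:
  assumes f1: "integrable lborel f" and f2: "f \<in> Lsq lborel" and s: "\<sigma> > 0"
  shows "(\<integral>\<^sup>+k. ennreal (exp (- (2 * pi * \<sigma> * k)\<^sup>2 / 2) * (norm (FT lborel f k))\<^sup>2) \<partial>lborel) \<le> ennreal ((nrm lborel f)\<^sup>2)"
proof -
  have [measurable]: "f \<in> borel_measurable borel" using f1 by (simp add: borel_measurable_integrable)
  have [measurable]: "FT lborel f \<in> borel_measurable borel" 
    by (rule FT_measurable) (auto intro: lborel.sigma_finite_measure_axioms)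
  let ?n = "normal_density 0 \<sigma>"
  let ?B = "(LINT x|lborel. norm (f x))\<^sup>2"
  have bdd: "integrable lborel (\<lambda>k. exp (- (2 * pi * \<sigma> * k)\<^sup>2 / 2) * (norm (FT lborel f k))\<^sup>2)"
  proof (rule Bochner_Integration.integrable_bound)
    show "integrable lborel (\<lambda>k. ?B * norm (gauss \<sigma> k))" using gauss_integrable(1)[OF s] by simp
    show "AE k in lborel. norm (exp (- (2 * pi * \<sigma> * k)\<^sup>2 / 2) * (norm (FT lborel f k))\<^sup>2) \<le> norm (?B * norm (gauss \<sigma> k))"
      by (auto simp: gauss_def intro!: mult_mono power_mono norm_FT_le)
  qed measurable
  have "complex_of_real (LINT k|lborel. exp (- (2 * pi * \<sigma> * k)\<^sup>2 / 2) * (norm (FT lborel f k))\<^sup>2)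
     = (LINT k|lborel. gauss \<sigma> k * (cnj (FT lborel f k) * FT lborel f k))"
    unfolding integral_complex_of_real[symmetric] gauss_def
    by (simp add: complex_norm_square mult.commute del: of_real_power)
  also have "\<dots> = (LINT x|lborel. LINT y|lborel. of_real (?n (x - y)) * (f x * cnj (f y)))"
    by (subst FT_weighted_form[OF lborel.sigma_finite_measure_axioms _ f1 f1 gauss_integrable(1)[OF s]]) 
       (simp_all add: FT_gauss[OF s])
  finally have eq: "complex_of_real (LINT k|lborel. exp (- (2 * pi * \<sigma> * k)\<^sup>2 / 2) * (norm (FT lborel f k))\<^sup>2) = \<dots>" .
  have int: "integrable (lborel \<Otimes>\<^sub>M lborel) (\<lambda>(x,y). of_real (?n (fst (x,y) - snd (x,y))) * (f x * cnj (f y)))"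
  proof (rule integrable_pair_bounded_mult[OF lborel.sigma_finite_measure_axioms lborel.sigma_finite_measure_axioms f1, where B="1 / sqrt (2 * pi * \<sigma>\<^sup>2)" and u="\<lambda>p. of_real (?n (fst p - snd p))"])
    show "norm (complex_of_real (?n (fst p - snd p))) \<le> 1 / sqrt (2 * pi * \<sigma>\<^sup>2)" for p
      unfolding norm_of_real abs_of_nonneg[OF normal_density_nonneg]
      using s by (simp add: normal_density_def divide_right_mono)
  qed (use f1 in auto)
  have "ennreal (norm (LINT x|lborel. LINT y|lborel. of_real (?n (x - y)) * (f x * cnj (f y))))
     \<le> (\<integral>\<^sup>+x. \<integral>\<^sup>+y. ennreal (?n (x - y)) * ennreal (norm (f x) * norm (f y)) \<partial>lborel \<partial>lborel)"
  proof -
    have "ennreal (norm (LINT x|lborel. LINT y|lborel. of_real (?n (x - y)) * (f x * cnj (f y))))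
      = ennreal (norm (LINT p|(lborel \<Otimes>\<^sub>M lborel). (case p of (x,y) \<Rightarrow> of_real (?n (fst (x,y) - snd (x,y))) * (f x * cnj (f y)))))"
      using lborel_pair.integral_fst'[OF int] by simp
    also have "\<dots> \<le> (\<integral>\<^sup>+p. ennreal (norm (case p of (x,y) \<Rightarrow> complex_of_real (?n (fst (x,y) - snd (x,y))) * (f x * cnj (f y)))) \<partial>(lborel \<Otimes>\<^sub>M lborel))"
      by (rule integral_norm_bound_ennreal[OF int])
    also have "\<dots> = (\<integral>\<^sup>+x. \<integral>\<^sup>+y. ennreal (norm (complex_of_real (?n (x - y)) * (f x * cnj (f y)))) \<partial>lborel \<partial>lborel)"
      by (subst lborel.nn_integral_fst[symmetric]) (auto simp: case_prod_beta')
    finally show ?thesis using s by (simp add: norm_mult ennreal_mult'')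
  qed
  also have "\<dots> \<le> (\<integral>\<^sup>+x. \<integral>\<^sup>+y. ennreal (?n (x - y)) * (ennreal ((norm (f x))\<^sup>2 / 2) + ennreal ((norm (f y))\<^sup>2 / 2)) \<partial>lborel \<partial>lborel)"
  proof (intro nn_integral_mono mult_left_mono)
    fix x y
    have "norm (f x) * norm (f y) \<le> (norm (f x))\<^sup>2 / 2 + (norm (f y))\<^sup>2 / 2"
      using sum_squares_bound[of "norm (f x)" "norm (f y)"] by (simp add: field_simps)
    then show "ennreal (norm (f x) * norm (f y)) \<le> ennreal ((norm (f x))\<^sup>2 / 2) + ennreal ((norm (f y))\<^sup>2 / 2)"
      by (simp add: ennreal_plus[symmetric] ennreal_leI del: ennreal_plus)
  qed simp
  also have "\<dots> = (\<integral>\<^sup>+x. \<integral>\<^sup>+y. ennreal ((norm (f x))\<^sup>2 / 2) * ennreal (?n (x - y)) \<partial>lborel \<partial>lborel)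
     + (\<integral>\<^sup>+x. \<integral>\<^sup>+y. ennreal ((norm (f y))\<^sup>2 / 2) * ennreal (?n (x - y)) \<partial>lborel \<partial>lborel)"
    by (subst nn_integral_add[symmetric]) (auto intro!: nn_integral_cong simp: nn_integral_add[symmetric] distrib_left mult.commute)
  also have "(\<integral>\<^sup>+x. \<integral>\<^sup>+y. ennreal ((norm (f x))\<^sup>2 / 2) * ennreal (?n (x - y)) \<partial>lborel \<partial>lborel)
      = (\<integral>\<^sup>+x. ennreal ((norm (f x))\<^sup>2 / 2) \<partial>lborel)"
    by (subst nn_integral_cmult) (auto simp: nn_integral_translate_gauss[OF s])
  also have "(\<integral>\<^sup>+x. \<integral>\<^sup>+y. ennreal ((norm (f y))\<^sup>2 / 2) * ennreal (?n (x - y)) \<partial>lborel \<partial>lborel)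
      = (\<integral>\<^sup>+x. ennreal ((norm (f x))\<^sup>2 / 2) \<partial>lborel)"
    by (subst lborel_pair.Fubini') (auto simp: nn_integral_translate_gauss[OF s] nn_integral_cmult)
  also have "(\<integral>\<^sup>+x. ennreal ((norm (f x))\<^sup>2 / 2) \<partial>lborel) + (\<integral>\<^sup>+x. ennreal ((norm (f x))\<^sup>2 / 2) \<partial>lborel)
      = (\<integral>\<^sup>+x. ennreal ((norm (f x))\<^sup>2) \<partial>lborel)"
    by (subst nn_integral_add[symmetric]) (auto simp: ennreal_plus[symmetric] simp del: ennreal_plus)
  also have "\<dots> = ennreal ((nrm lborel f)\<^sup>2)" by (rule nn_integral_nrm[OF f2])
  finally have "ennreal (norm (complex_of_real (LINT k|lborel. exp (- (2 * pi * \<sigma> * k)\<^sup>2 / 2) * (norm (FT lborel f k))\<^sup>2))) \<le> ennreal ((nrm lborel f)\<^sup>2)"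
    unfolding eq[symmetric] .
  then show ?thesis
    by (subst nn_integral_eq_integral[OF bdd]) (auto simp: integral_nonneg_AE)
qed

text \<open>Fatou's lemma removes the Gaussian factor as \<open>\<sigma>\<close> tends to \<open>0\<close>.\<close>

lemma FT_contraction:
  assumes f1: "integrable lborel f" and f2: "f \<in> Lsq lborel"
  shows "FT lborel f \<in> Lsq lborel" "nrm lborel (FT lborel f) \<le> nrm lborel f"
proof -
  have [measurable]: "f \<in> borel_measurable borel" using f1 by (simp add: borel_measurable_integrable)
  have [measurable]: "FT lborel f \<in> borel_measurable borel" 
    by (rule FT_measurable) (auto intro: lborel.sigma_finite_measure_axioms)
  have "(\<integral>\<^sup>+k. ennreal ((norm (FT lborel f k))\<^sup>2) \<partial>lborel) =
     (\<integral>\<^sup>+k. liminf (\<lambda>n. ennreal (exp (- (2 * pi * (1 / real (Suc n)) * k)\<^sup>2 / 2) * (norm (FT lborel f k))\<^sup>2)) \<partial>lborel)"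
  proof (rule nn_integral_cong)
    fix k
    have "(\<lambda>n. exp (- (2 * pi * (1 / real (Suc n)) * k)\<^sup>2 / 2) * (norm (FT lborel f k))\<^sup>2) \<longlonglongrightarrow>
       exp (- (2 * pi * 0 * k)\<^sup>2 / 2) * (norm (FT lborel f k))\<^sup>2"
      by (intro tendsto_intros LIMSEQ_Suc[OF lim_1_over_n]) auto
    then have "(\<lambda>n. ennreal (exp (- (2 * pi * (1 / real (Suc n)) * k)\<^sup>2 / 2) * (norm (FT lborel f k))\<^sup>2)) \<longlonglongrightarrow>
       ennreal ((norm (FT lborel f k))\<^sup>2)" by (intro tendsto_ennrealI) simp
    then show "ennreal ((norm (FT lborel f k))\<^sup>2) = liminf (\<lambda>n. ennreal (exp (- (2 * pi * (1 / real (Suc n)) * k)\<^sup>2 / 2) * (norm (FT lborel f k))\<^sup>2))"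
      by (rule lim_imp_Liminf[OF sequentially_bot, symmetric])
  qed
  also have "\<dots> \<le> liminf (\<lambda>n. \<integral>\<^sup>+k. ennreal (exp (- (2 * pi * (1 / real (Suc n)) * k)\<^sup>2 / 2) * (norm (FT lborel f k))\<^sup>2) \<partial>lborel)"
    by (rule nn_integral_liminf) measurable
  also have "\<dots> \<le> liminf (\<lambda>n::nat. ennreal ((nrm lborel f)\<^sup>2))"
    by (intro Liminf_mono always_eventually allI FT_gauss_bound f1 f2) simp
  also have "\<dots> = ennreal ((nrm lborel f)\<^sup>2)" by (rule Liminf_const) simp
  finally have le: "(\<integral>\<^sup>+k. ennreal ((norm (FT lborel f k))\<^sup>2) \<partial>lborel) \<le> ennreal ((nrm lborel f)\<^sup>2)" .
  then show m: "FT lborel f \<in> Lsq lborel" by (intro Lsq_nnI) (auto intro: order_le_less_trans)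
  show "nrm lborel (FT lborel f) \<le> nrm lborel f"
  proof (rule power2_le_imp_le)
    show "(nrm lborel (FT lborel f))\<^sup>2 \<le> (nrm lborel f)\<^sup>2"
      using le unfolding nn_integral_nrm[OF m] by (subst (asm) ennreal_le_iff) auto
  qed simp
qed

lemma indicator_Ioc_Lsq: "integrable lborel (indicator {a<..b::real} :: real \<Rightarrow> complex)" "(indicator {a<..b::real} :: real \<Rightarrow> complex) \<in> Lsq lborel"
proof -
  have eq: "(indicator {a<..b::real} :: real \<Rightarrow> complex) = (\<lambda>x. of_real (indicator {a<..b} x))"
    by (auto simp: indicator_def)
  show 1: "integrable lborel (indicator {a<..b::real} :: real \<Rightarrow> complex)"
    unfolding eq by (intro integrable_of_real integrable_real_indicator) (cases "a \<le> b"; simp)+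
  have eq2: "(\<lambda>x. (norm (indicator {a<..b::real} x :: complex))\<^sup>2) = indicator {a<..b}" by (auto simp: indicator_def)
  show "(indicator {a<..b::real} :: real \<Rightarrow> complex) \<in> Lsq lborel"
    by (rule LsqI; cases "a \<le> b") (auto simp: eq2)
qed

text \<open>With a Gaussian factor inserted, the left-hand side is the integral of \<open>f\<close> against the
  mollified indicator function. The mollification is bounded by \<open>1\<close> and converges to the indicator
  function except at the two end points, so dominated convergence applies on both sides.\<close>

lemma FT_parseval_indicator:
  assumes f1: "integrable lborel f" and f2: "f \<in> Lsq lborel"
  shows "ip lborel (FT lborel (indicator {a<..b})) (FT lborel f) = ip lborel (indicator {a<..b}) f"
proof -
  have [measurable]: "f \<in> borel_measurable borel" using f1 by (simp add: borel_measurable_integrable)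
  let ?g = "indicator {a<..b} :: real \<Rightarrow> complex"
  note g = indicator_Ioc_Lsq[of a b]
  define s where "s n = 1 / real (Suc n)" for n
  have s0: "s n > 0" for n by (simp add: s_def)
  have s: "s \<longlonglongrightarrow> 0" unfolding s_def by (rule LIMSEQ_Suc[OF lim_1_over_n])
  let ?w = "\<lambda>k. cnj (FT lborel ?g k) * FT lborel f k"
  have F: "FT lborel f \<in> Lsq lborel" and G: "FT lborel ?g \<in> Lsq lborel" by (intro FT_contraction f1 f2 g)+
  have [measurable]: "FT lborel f \<in> borel_measurable borel" "FT lborel ?g \<in> borel_measurable borel" 
    using F G LsqD1 by force+
  have "(\<lambda>n. LINT k|lborel. gauss (s n) k * ?w k) \<longlonglongrightarrow> (LINT k|lborel. ?w k)"
  proof (rule integral_dominated_convergence[where w="\<lambda>k. norm (?w k)"])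
    show "integrable lborel (\<lambda>k. norm (?w k))" using integrable_ip[OF G F] by simp
    have "(\<lambda>n. gauss (s n) k * ?w k) \<longlonglongrightarrow> of_real (exp (- (2 * pi * 0 * k)\<^sup>2 / 2)) * ?w k" for k
      unfolding gauss_def by (intro tendsto_intros s) auto
    then show "AE k in lborel. (\<lambda>n. gauss (s n) k * ?w k) \<longlonglongrightarrow> ?w k" by simp
    show "AE k in lborel. norm (gauss (s n) k * ?w k) \<le> norm (?w k)" for n
      by (simp add: norm_mult gauss_def mult_left_le_one_le)
    have [measurable]: "gauss (s n) \<in> borel_measurable borel" for n unfolding gauss_def[abs_def] by measurable
    show "(\<lambda>k. gauss (s n) k * ?w k) \<in> borel_measurable lborel" for n by measurable
  qed measurable
  moreover have "(LINT k|lborel. gauss (s n) k * ?w k) = 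
     (LINT x|lborel. f x * (LINT u|lborel. of_real (std_normal_density u) * ?g (x - s n * u)))" for n
  proof -
    have step: "(LINT y|lborel. of_real (normal_density 0 (s n) (x - y)) * ?g y) = 
      (LINT u|lborel. of_real (std_normal_density u) * ?g (x - s n * u))" for x
    proof -
      have "s n * normal_density 0 (s n) (s n * u) = std_normal_density u" for u
        using s0[of n] by (simp add: normal_density_def real_sqrt_mult field_simps power_mult_distrib)
      then have "complex_of_real (s n) * of_real (normal_density 0 (s n) (s n * u)) = of_real (std_normal_density u)" for u
        by (metis of_real_mult)
      then show ?thesis using s0[of n]
        by (subst lborel_integral_real_affine[of "- s n" _ x]) 
          (auto simp: scaleR_conv_of_real mult.assoc[symmetric] simp flip: integral_mult_right_zero)
    qed
    have "(LINT k|lborel. gauss (s n) k * ?w k) = (LINT x|lborel. LINT y|lborel. of_real (normal_density 0 (s n) (x - y)) * (f x * cnj (?g y)))"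
      by (subst FT_weighted_form[OF lborel.sigma_finite_measure_axioms _ f1 g(1) gauss_integrable(1)[OF s0]]) 
       (simp_all add: FT_gauss[OF s0])
    also have "\<dots> = (LINT x|lborel. f x * (LINT y|lborel. of_real (normal_density 0 (s n) (x - y)) * ?g y))"
    proof -
      have "(LINT y|lborel. of_real (normal_density 0 (s n) (x - y)) * (f x * cnj (?g y))) =
        (LINT y|lborel. f x * (of_real (normal_density 0 (s n) (x - y)) * ?g y))" for x
        by (intro Bochner_Integration.integral_cong refl) (simp add: indicator_def)
      then show ?thesis by simp
    qed
    also have "\<dots> = (LINT x|lborel. f x * (LINT u|lborel. of_real (std_normal_density u) * ?g (x - s n * u)))"
      unfolding step ..
    finally show ?thesis .
  qed
  moreover have "(\<lambda>n. LINT x|lborel. f x * (LINT u|lborel. of_real (std_normal_density u) * ?g (x - s n * u))) \<longlonglongrightarrow> (LINT x|lborel. f x * ?g x)"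
  proof (rule integral_dominated_convergence[where w="\<lambda>x. norm (f x)"])
    show "AE x in lborel. (\<lambda>n. f x * (LINT u|lborel. of_real (std_normal_density u) * ?g (x - s n * u))) \<longlonglongrightarrow> f x * ?g x"
      using AE_lborel_singleton[of a] AE_lborel_singleton[of b]
    proof eventually_elim
      case (elim x)
      have "(\<lambda>n. LINT u|lborel. of_real (std_normal_density u) * ?g (x - s n * u)) \<longlonglongrightarrow> (LINT u|lborel. of_real (std_normal_density u) * ?g x)"
      proof (rule integral_dominated_convergence[where w="std_normal_density"])
        have "(\<lambda>n. of_real (std_normal_density u) * ?g (x - s n * u)) \<longlonglongrightarrow> of_real (std_normal_density u) * ?g x" for u
        proof -
          have l: "(\<lambda>n. x - s n * u) \<longlonglongrightarrow> x" using tendsto_diff[OF tendsto_const tendsto_mult[OF s tendsto_const], of x u] by simp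
          have "\<forall>\<^sub>F n in sequentially. ?g (x - s n * u) = ?g x"
          proof -
            consider "x < a" | "a < x" "x < b" | "b < x" using elim by linarith
            then show ?thesis
            proof cases
              case 1 show ?thesis using order_tendstoD(2)[OF l 1] by eventually_elim (use 1 in \<open>auto simp: indicator_def\<close>)
            next
              case 2 show ?thesis using order_tendstoD(1)[OF l 2(1)] order_tendstoD(2)[OF l 2(2)] 
                by eventually_elim (use 2 in \<open>auto simp: indicator_def\<close>)
            next
              case 3 show ?thesis using order_tendstoD(1)[OF l 3] by eventually_elim (use 3 in \<open>auto simp: indicator_def\<close>)
            qed
          qed
          then show ?thesis by (intro tendsto_intros tendsto_eventually)
        qed
        then show "AE u in lborel. (\<lambda>n. of_real (std_normal_density u) * ?g (x - s n * u)) \<longlonglongrightarrow> of_real (std_normal_density u) * ?g x" by simp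
        show "AE u in lborel. norm (of_real (std_normal_density u) * ?g (x - s n * u)) \<le> std_normal_density u" for n
          by (auto simp: norm_mult indicator_def)
      qed (auto)
      also have "(LINT u|lborel. of_real (std_normal_density u) * ?g x) = ?g x"
        by (simp add: integral_complex_of_real)
      finally show ?case by (intro tendsto_intros)
    qed
    show "AE x in lborel. norm (f x * (LINT u|lborel. of_real (std_normal_density u) * ?g (x - s n * u))) \<le> norm (f x)" for n
    proof (rule AE_I2)
      fix x
      have "norm (LINT u|lborel. of_real (std_normal_density u) * ?g (x - s n * u)) \<le> (LINT u|lborel. std_normal_density u)"
        by (rule Bochner_Integration.integral_norm_bound_integral) (auto simp: norm_mult indicator_def intro!: Bochner_Integration.integrable_bound[OF integrable_normal_density[of 1 0]])
      then show "norm (f x * (LINT u|lborel. of_real (std_normal_density u) * ?g (x - s n * u))) \<le> norm (f x)"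
        by (simp add: norm_mult mult_left_le)
    qed
  qed (use f1 in auto)
  ultimately have "(LINT k|lborel. ?w k) = (LINT x|lborel. f x * ?g x)"
    using LIMSEQ_unique by auto
  moreover have "(LINT x|lborel. f x * ?g x) = ip lborel ?g f"
    unfolding ip_def by (intro Bochner_Integration.integral_cong refl) (simp add: indicator_def)
  ultimately show ?thesis unfolding ip_def by simp
qed

lemma sets_borel_Ioc: "sets borel = sigma_sets UNIV (range (\<lambda>(a, b). {a <.. b::real}))"
  by (subst borel_sigma_sets_Ioc) (simp add: sets_measure_of)

text \<open>Half-open intervals form a generator of the Borel sets that is stable under intersection, so
  on each bounded window the integrals of \<open>u\<close> over all Borel sets vanish.\<close>

lemma AE_zero_if_interval_integrals_zero:
  fixes u :: "real \<Rightarrow> complex"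
  assumes u: "u \<in> Lsq lborel" and zero: "\<And>a b. ip lborel (indicator {a<..b}) u = 0"
  shows "AE x in lborel. u x = 0"
proof -
  have [measurable]: "u \<in> borel_measurable borel" using u by auto
  have "AE x in lborel. indicator {- real n<..real n} x * u x = 0" for n
  proof (rule sigma_finite_measure.density_zero[OF lborel.sigma_finite_measure_axioms])
    define v where "v x = indicator {- real n<..real n} x * u x" for x
    show int: "integrable lborel (\<lambda>x. indicator {- real n<..real n} x * u x)"
      by (rule integrable_mult[OF indicator_Ioc_Lsq(2) u])
    fix A :: "real set" assume "A \<in> sets lborel"
    then have "A \<in> sigma_sets UNIV (range (\<lambda>(a, b). {a <.. b::real}))"
      using sets_borel_Ioc by simp
    then have "(LINT x:A|lborel. v x) = 0"
    proof (rule sigma_sets_induct_disjoint[where P="\<lambda>A. (LINT x:A|lborel. v x) = 0", rotated 2])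
      show "Int_stable (range (\<lambda>(a, b). {a <.. b::real}))"
        by (auto simp: Int_stable_def Int_greaterThanAtMost)
    next
      fix A :: "real set" assume "A \<in> range (\<lambda>(a, b). {a <.. b::real})"
      then obtain a b where A: "A = {a<..b}" by auto
      have "(LINT x:A|lborel. v x) = ip lborel (indicator {max a (- real n)<..min b (real n)}) u"
        unfolding set_lebesgue_integral_def ip_def
        by (intro Bochner_Integration.integral_cong refl) (auto simp: A v_def indicator_def)
      then show "(LINT x:A|lborel. v x) = 0" using zero by simp
    next
      fix A :: "real set" assume A: "A \<in> sigma_sets UNIV (range (\<lambda>(a, b). {a <.. b::real}))" and 0: "(LINT x:A|lborel. v x) = 0"
      have [measurable]: "A \<in> sets borel" using A sets_borel_Ioc by simp
      have v: "integrable lborel v" unfolding v_def[abs_def] by (rule int)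
      have "(LINT x:UNIV - A|lborel. v x) = (LINT x|lborel. v x - indicator A x *\<^sub>R v x)"
        unfolding set_lebesgue_integral_def by (intro Bochner_Integration.integral_cong refl) (auto simp: indicator_def)
      also have "\<dots> = (LINT x|lborel. v x) - (LINT x:A|lborel. v x)"
        unfolding set_lebesgue_integral_def by (intro Bochner_Integration.integral_diff v integrable_mult_indicator) auto
      also have "(LINT x|lborel. v x) = ip lborel (indicator {- real n<..real n}) u"
        unfolding ip_def v_def by (intro Bochner_Integration.integral_cong refl) (auto simp: indicator_def)
      finally show "(LINT x:UNIV - A|lborel. v x) = 0" using zero 0 by simp
    next
      fix A :: "nat \<Rightarrow> real set" assume d: "disjoint_family A" and r: "range A \<subseteq> sigma_sets UNIV (range (\<lambda>(a, b). {a <.. b::real}))"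
        and z: "\<And>i. (LINT x:A i|lborel. v x) = 0"
      have A[measurable]: "A i \<in> sets borel" for i using r sets_borel_Ioc by auto
      have v: "integrable lborel v" unfolding v_def[abs_def] by (rule int)
      have "(LINT x:(\<Union>i. A i)|lborel. v x) = (\<Sum>i. (LINT x:A i|lborel. v x))"
        by (rule lebesgue_integral_countable_add) 
          (use d in \<open>auto simp: disjoint_family_on_def set_integrable_def intro!: integrable_mult_indicator v\<close>)
      then show "(LINT x:(\<Union>i. A i)|lborel. v x) = 0" using z by simp
    qed (auto simp: set_lebesgue_integral_def)
    then show "(LINT x:A|lborel. indicator {- real n<..real n} x * u x) = 0" unfolding v_def .
  qed
  then have "AE x in lborel. \<forall>n. indicator {- real n<..real n} x * u x = 0" by (subst AE_all_countable) blast
  then show ?thesis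
  proof eventually_elim
    case (elim x)
    obtain n :: nat where "\<bar>x\<bar> < real n" using reals_Archimedean2 by blast
    then show ?case using elim[rule_format, of n] by (auto simp: indicator_def split: if_splits)
  qed
qed

section \<open>Plancherel's theorem\<close>

definition trunc :: "nat \<Rightarrow> (real \<Rightarrow> complex) \<Rightarrow> real \<Rightarrow> complex" where
  "trunc n f x = indicator {- real n..real n} x * f x"

lemma trunc_L1_L2:
  assumes f: "f \<in> Lsq lborel"
  shows "integrable lborel (trunc n f)" "trunc n f \<in> Lsq lborel"
proof -
  have [measurable]: "f \<in> borel_measurable borel" using f by auto
  have "(indicator {- real n..real n} :: real \<Rightarrow> complex) \<in> Lsq lborel"
  proof (rule LsqI)
    have "(\<lambda>x. (norm (indicator {- real n..real n} x :: complex))\<^sup>2) = indicator {- real n..real n}"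
      by (auto simp: indicator_def)
    then show "integrable lborel (\<lambda>x. (norm (indicator {- real n..real n} x :: complex))\<^sup>2)" by simp
  qed measurable
  from integrable_mult[OF this f] show "integrable lborel (trunc n f)" unfolding trunc_def[abs_def] .
  show "trunc n f \<in> Lsq lborel"
    by (rule Lsq_bounded[OF f, where C=1]) (auto simp: trunc_def[abs_def] norm_mult indicator_def)
qed

lemma trunc_tendsto:
  assumes f: "f \<in> Lsq lborel"
  shows "(\<lambda>n. nrm lborel (\<lambda>x. trunc n f x - f x)) \<longlonglongrightarrow> 0"
proof -
  have [measurable]: "f \<in> borel_measurable borel" using f by auto
  have "(\<lambda>n. LINT x|lborel. (norm (trunc n f x - f x))\<^sup>2) \<longlonglongrightarrow> (LINT x::real|lborel. 0)"
  proof (rule integral_dominated_convergence[where w="\<lambda>x. (norm (f x))\<^sup>2"])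
    show "AE x in lborel. (\<lambda>n. (norm (trunc n f x - f x))\<^sup>2) \<longlonglongrightarrow> 0"
    proof (rule AE_I2)
      fix x :: real
      obtain N :: nat where N: "\<bar>x\<bar> < real N" using reals_Archimedean2 by blast
      have "\<forall>\<^sub>F n in sequentially. (norm (trunc n f x - f x))\<^sup>2 = 0"
        by (rule eventually_sequentiallyI[of N]) (use N in \<open>auto simp: trunc_def indicator_def\<close>)
      then show "(\<lambda>n. (norm (trunc n f x - f x))\<^sup>2) \<longlonglongrightarrow> 0" by (rule tendsto_eventually)
    qed
    show "AE x in lborel. norm ((norm (trunc n f x - f x))\<^sup>2) \<le> (norm (f x))\<^sup>2" for n
      by (auto simp: trunc_def indicator_def)
    show "(\<lambda>x. (norm (trunc n f x - f x))\<^sup>2) \<in> borel_measurable lborel" for n unfolding trunc_def by measurable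
  qed (use f in auto)
  from tendsto_real_sqrt[OF this] show ?thesis by (simp add: nrm_def)
qed

lemma FT_L1_diff: "integrable lborel f \<Longrightarrow> integrable lborel g \<Longrightarrow> FT lborel (\<lambda>x. f x - g x) = (\<lambda>k. FT lborel f k - FT lborel g k)"
  by (rule ext, rule FT_diff) auto

lemma is_fourier_iff:
  assumes f: "f \<in> Lsq lborel"
  shows "is_fourier f g \<longleftrightarrow> g \<in> Lsq lborel \<and> (\<lambda>n. nrm lborel (\<lambda>k. FT lborel (trunc n f) k - g k)) \<longlonglongrightarrow> 0"
proof -
  have eq: "(\<integral>\<^sup>+k. ennreal ((norm (fourier_integral (\<lambda>x. indicator {- real n..real n} x * f x) k - g k))\<^sup>2) \<partial>lborel)
      = ennreal ((nrm lborel (\<lambda>k. FT lborel (trunc n f) k - g k))\<^sup>2)" if "g \<in> Lsq lborel" for n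
    using nn_integral_nrm[OF Lsq_diff[OF FT_contraction(1)[OF trunc_L1_L2[OF f, of n]] that]]
    by (simp add: fourier_integral_FT trunc_def[abs_def])
  have "((\<lambda>n. ennreal ((r n)\<^sup>2)) \<longlonglongrightarrow> 0) = (r \<longlonglongrightarrow> 0)" for r :: "nat \<Rightarrow> real"
  proof -
    have "((\<lambda>n. ennreal ((r n)\<^sup>2)) \<longlonglongrightarrow> ennreal 0) = ((\<lambda>n. (r n)\<^sup>2) \<longlonglongrightarrow> 0)"
      by (rule tendsto_ennreal_iff) auto
    also have "\<dots> = (r \<longlonglongrightarrow> 0)"
    proof
      assume "(\<lambda>n. (r n)\<^sup>2) \<longlonglongrightarrow> 0"
      from tendsto_real_sqrt[OF this] show "r \<longlonglongrightarrow> 0" by (simp add: tendsto_rabs_zero_iff)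
    next
      assume "r \<longlonglongrightarrow> 0"
      from tendsto_power[OF this, of 2] show "(\<lambda>n. (r n)\<^sup>2) \<longlonglongrightarrow> 0" by simp
    qed
    finally show ?thesis by simp
  qed
  then show ?thesis unfolding is_fourier_def L2_Lsq using eq by auto
qed

text \<open>The truncations of \<open>f\<close> are a Cauchy sequence, and the Fourier integral is a contraction on
  them.\<close>

lemma is_fourier_exists:
  assumes f: "f \<in> Lsq lborel" shows "\<exists>g. is_fourier f g"
proof -
  note t = trunc_L1_L2[OF f]
  have "\<exists>g\<in>Lsq lborel. (\<lambda>n. nrm lborel (\<lambda>k. FT lborel (trunc n f) k - g k)) \<longlonglongrightarrow> 0"
  proof (rule Lsq_complete)
    show "FT lborel (trunc n f) \<in> Lsq lborel" for n by (intro FT_contraction t)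
    fix e :: real assume "e > 0"
    then have "e / 2 > 0" by simp
    from order_tendstoD(2)[OF trunc_tendsto[OF f] this] obtain n0 where 
      n0: "\<And>n. n \<ge> n0 \<Longrightarrow> nrm lborel (\<lambda>x. trunc n f x - f x) < e / 2" by (auto simp: eventually_sequentially)
    show "\<exists>n0. \<forall>m\<ge>n0. \<forall>n\<ge>n0. nrm lborel (\<lambda>k. FT lborel (trunc m f) k - FT lborel (trunc n f) k) < e"
    proof (intro exI allI impI)
      fix m n assume mn: "m \<ge> n0" "n \<ge> n0"
      have "nrm lborel (\<lambda>k. FT lborel (trunc m f) k - FT lborel (trunc n f) k) = nrm lborel (FT lborel (\<lambda>x. trunc m f x - trunc n f x))"
        by (simp add: FT_L1_diff t)
      also have "\<dots> \<le> nrm lborel (\<lambda>x. trunc m f x - trunc n f x)"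
        by (intro FT_contraction Bochner_Integration.integrable_diff Lsq_diff t)
      also have "\<dots> \<le> nrm lborel (\<lambda>x. trunc m f x - f x) + nrm lborel (\<lambda>x. f x - trunc n f x)"
        by (intro nrm_triangle_diff t f)
      also have "\<dots> < e" using n0[OF mn(1)] n0[OF mn(2)] by (simp add: nrm_minus_commute[of _ f])
      finally show "nrm lborel (\<lambda>k. FT lborel (trunc m f) k - FT lborel (trunc n f) k) < e" .
    qed
  qed
  then show ?thesis using is_fourier_iff[OF f] by blast
qed

lemma fourier_Lsq [intro]: "f \<in> Lsq lborel \<Longrightarrow> fourier f \<in> Lsq lborel"
  and fourier_lim: "f \<in> Lsq lborel \<Longrightarrow> (\<lambda>n. nrm lborel (\<lambda>k. FT lborel (trunc n f) k - fourier f k)) \<longlonglongrightarrow> 0"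
  using someI_ex[OF is_fourier_exists] is_fourier_iff unfolding fourier_def by blast+

lemma is_fourier_unique:
  assumes f: "f \<in> Lsq lborel" and g: "is_fourier f g"
  shows "AE k in lborel. fourier f k = g k"
proof -
  note F = FT_contraction(1)[OF trunc_L1_L2[OF f]]
  have gL: "g \<in> Lsq lborel" and lim: "(\<lambda>n. nrm lborel (\<lambda>k. FT lborel (trunc n f) k - g k)) \<longlonglongrightarrow> 0"
    using g is_fourier_iff[OF f] by auto
  have "nrm lborel (\<lambda>k. fourier f k - g k) \<le> nrm lborel (\<lambda>k. FT lborel (trunc n f) k - fourier f k) + nrm lborel (\<lambda>k. FT lborel (trunc n f) k - g k)" for n
    using nrm_triangle_diff[OF fourier_Lsq[OF f] F gL, of n] by (simp add: nrm_minus_commute[of _ "fourier f"])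
  then have "nrm lborel (\<lambda>k. fourier f k - g k) \<le> 0 + 0"
    by (intro LIMSEQ_le_const[OF tendsto_add[OF fourier_lim[OF f] lim]]) auto
  then have "nrm lborel (\<lambda>k. fourier f k - g k) = 0" using nrm_nonneg[of lborel "\<lambda>k. fourier f k - g k"] by linarith
  then show ?thesis using nrm_eq_0_iff[OF Lsq_diff[OF fourier_Lsq[OF f] gL]] by simp
qed

lemma fourier_cong_AE:
  assumes "AE x in lborel. f x = g x" "f \<in> borel_measurable borel" "g \<in> borel_measurable borel"
  shows "fourier f = fourier g"
proof -
  note [measurable] = assms(2,3)
  have "fourier_integral (\<lambda>x. indicator {- real n..real n} x * f x) = fourier_integral (\<lambda>x. indicator {- real n..real n} x * g x)" for n
    unfolding fourier_integral_FT FT_def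
    by (rule ext, rule integral_cong_AE) (use assms(1) in auto)
  then show ?thesis unfolding fourier_def is_fourier_def by simp
qed

lemma fourier_cong_Lsq:
  assumes "AE x in lborel. f x = g x" "f \<in> Lsq lborel" "g \<in> Lsq lborel"
  shows "fourier f = fourier g"
  using LsqD1[OF assms(2)] LsqD1[OF assms(3)] by (intro fourier_cong_AE[OF assms(1)]) simp_all

lemma fourier_lincomb:
  assumes f: "f \<in> Lsq lborel" and g: "g \<in> Lsq lborel"
  shows "AE k in lborel. fourier (\<lambda>x. a * f x + b * g x) k = a * fourier f k + b * fourier g k"
proof (rule is_fourier_unique)
  let ?h = "\<lambda>x. a * f x + b * g x" and ?H = "\<lambda>k. a * fourier f k + b * fourier g k"
  show h: "?h \<in> Lsq lborel" by (intro Lsq_add Lsq_cmult f g)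
  have e: "trunc n ?h = (\<lambda>x. a * trunc n f x + b * trunc n g x)" for n
    by (auto simp: trunc_def algebra_simps)
  have tr: "FT lborel (trunc n ?h) = (\<lambda>k. a * FT lborel (trunc n f) k + b * FT lborel (trunc n g) k)" for n
    using trunc_L1_L2(1)[OF f, of n] trunc_L1_L2(1)[OF g, of n] unfolding e by (intro ext) (simp add: FT_add FT_cmult)
  note F = FT_contraction(1)[OF trunc_L1_L2[OF f]] and G = FT_contraction(1)[OF trunc_L1_L2[OF g]]
  have bd: "nrm lborel (\<lambda>k. FT lborel (trunc n ?h) k - ?H k) \<le>
    norm a * nrm lborel (\<lambda>k. FT lborel (trunc n f) k - fourier f k) + norm b * nrm lborel (\<lambda>k. FT lborel (trunc n g) k - fourier g k)" for n
  proof -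
    have "(\<lambda>k. FT lborel (trunc n ?h) k - ?H k) = (\<lambda>k. a * (FT lborel (trunc n f) k - fourier f k) + b * (FT lborel (trunc n g) k - fourier g k))"
      unfolding tr by (auto simp: algebra_simps)
    then show ?thesis
      using nrm_triangle[OF Lsq_cmult[OF Lsq_diff[OF F[of n] fourier_Lsq[OF f]], of a] Lsq_cmult[OF Lsq_diff[OF G[of n] fourier_Lsq[OF g]], of b]]
      by (simp add: nrm_cmult)
  qed
  have lim: "(\<lambda>n. norm a * nrm lborel (\<lambda>k. FT lborel (trunc n f) k - fourier f k) + norm b * nrm lborel (\<lambda>k. FT lborel (trunc n g) k - fourier g k)) \<longlonglongrightarrow> norm a * 0 + norm b * 0"
    by (intro tendsto_intros fourier_lim f g)
  have "(\<lambda>n. nrm lborel (\<lambda>k. FT lborel (trunc n ?h) k - ?H k)) \<longlonglongrightarrow> 0"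
    by (rule tendsto_sandwich[OF _ _ tendsto_const]) (use bd lim in auto)
  moreover have "?H \<in> Lsq lborel" by (intro Lsq_add Lsq_cmult fourier_Lsq f g)
  ultimately show "is_fourier ?h ?H" using is_fourier_iff[OF h] by blast
qed

text \<open>The Fourier integrals of the truncations converge pointwise by dominated convergence.\<close>

lemma fourier_L1:
  assumes f1: "integrable lborel f" and f2: "f \<in> Lsq lborel"
  shows "AE k in lborel. fourier f k = FT lborel f k"
proof -
  have [measurable]: "f \<in> borel_measurable borel" using f2 by auto
  have "(\<lambda>n. FT lborel (trunc n f) k) \<longlonglongrightarrow> FT lborel f k" for k
    unfolding FT_def
  proof (rule integral_dominated_convergence[where w="\<lambda>x. norm (f x)"])
    show "AE x in lborel. (\<lambda>n. cis (- (2 * pi * k * x)) * trunc n f x) \<longlonglongrightarrow> cis (- (2 * pi * k * x)) * f x"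
    proof (rule AE_I2)
      fix x :: real
      obtain N :: nat where N: "\<bar>x\<bar> < real N" using reals_Archimedean2 by blast
      have "\<forall>\<^sub>F n in sequentially. trunc n f x = f x"
        by (rule eventually_sequentiallyI[of N]) (use N in \<open>auto simp: trunc_def indicator_def\<close>)
      then show "(\<lambda>n. cis (- (2 * pi * k * x)) * trunc n f x) \<longlonglongrightarrow> cis (- (2 * pi * k * x)) * f x"
        by (intro tendsto_intros tendsto_eventually)
    qed
    show "AE x in lborel. norm (cis (- (2 * pi * k * x)) * trunc n f x) \<le> norm (f x)" for n
      by (auto simp: trunc_def norm_mult indicator_def)
    show "(\<lambda>x. cis (- (2 * pi * k * x)) * trunc n f x) \<in> borel_measurable lborel" for n unfolding trunc_def by measurable
  qed (use f1 in auto)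
  then have "AE k in lborel. FT lborel f k = fourier f k"
    by (intro nrm_tendsto_AE_unique[OF FT_contraction(1)[OF trunc_L1_L2[OF f2]] fourier_Lsq[OF f2] fourier_lim[OF f2]]) simp
  then show ?thesis by eventually_elim simp
qed

text \<open>Conjugating the Fourier transform reverses the sign in the exponent. Defining the inverse
  transform in this way transfers every property of the transform to it.\<close>

definition inv_fourier :: "(real \<Rightarrow> complex) \<Rightarrow> real \<Rightarrow> complex" where
  "inv_fourier h x = cnj (fourier (\<lambda>k. cnj (h k)) x)"

lemma inv_fourier_Lsq [intro]: "h \<in> Lsq lborel \<Longrightarrow> inv_fourier h \<in> Lsq lborel"
  unfolding inv_fourier_def[abs_def] by (intro Lsq_cnj fourier_Lsq)

lemma FT_multiplication_formula:
  assumes f: "integrable lborel f" and g: "integrable lborel g"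
  shows "(LINT k|lborel. g k * FT lborel f k) = (LINT x|lborel. FT lborel g x * f x)"
proof -
  have [measurable]: "f \<in> borel_measurable borel" "g \<in> borel_measurable borel" using f g by auto
  have int: "integrable (lborel \<Otimes>\<^sub>M lborel) (\<lambda>(k, x). cis (- (2 * pi * fst (k,x) * snd (k,x))) * (g k * f x))"
    by (rule integrable_pair_bounded_mult[OF lborel.sigma_finite_measure_axioms lborel.sigma_finite_measure_axioms g f, 
          where B=1 and u="\<lambda>p. cis (- (2 * pi * fst p * snd p))"]) auto
  have "(LINT k|lborel. g k * FT lborel f k) = (LINT k|lborel. LINT x|lborel. cis (- (2 * pi * k * x)) * (g k * f x))"
    unfolding FT_def by (simp only: integral_mult_right_zero[symmetric] mult.left_commute)
  also have "\<dots> = (LINT x|lborel. LINT k|lborel. cis (- (2 * pi * k * x)) * (g k * f x))"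
    using lborel_pair.Fubini_integral[OF int] by simp
  also have "\<dots> = (LINT x|lborel. FT lborel g x * f x)"
    unfolding FT_def by (simp only: integral_mult_left_zero[symmetric])
      (simp only: mult_ac)
  finally show ?thesis .
qed

text \<open>For truncated functions this is Fubini's theorem. The two truncations are removed one after the
  other, since the inner product is continuous in each argument.\<close>

lemma fourier_multiplication_formula:
  assumes g: "g \<in> Lsq lborel" and h: "h \<in> Lsq lborel"
  shows "(LINT x|lborel. g x * fourier h x) = (LINT x|lborel. fourier g x * h x)"
proof -
  define B where "B u v = (LINT x|lborel. u x * v x)" for u v :: "real \<Rightarrow> complex"
  have B_sym: "B u v = B v u" for u v by (simp add: B_def mult.commute)
  have B_lim: "(\<lambda>n. B u (v n)) \<longlonglongrightarrow> B u w"
    if "u \<in> Lsq lborel" "\<And>n. v n \<in> Lsq lborel" "w \<in> Lsq lborel" "(\<lambda>n. nrm lborel (\<lambda>x. v n x - w x)) \<longlonglongrightarrow> 0" for u v w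
    using ip_tendsto[OF that(2-4) Lsq_cnj[OF that(1)]] by (simp add: B_def ip_def)
  note tg = trunc_L1_L2[OF g] and th = trunc_L1_L2[OF h]
  have step: "B (trunc n g) (fourier h) = B (FT lborel (trunc n g)) h" for n
  proof (rule LIMSEQ_unique)
    show "(\<lambda>m. B (trunc n g) (FT lborel (trunc m h))) \<longlonglongrightarrow> B (trunc n g) (fourier h)"
      by (intro B_lim FT_contraction tg th fourier_Lsq fourier_lim h)
    have "(\<lambda>m. B (FT lborel (trunc n g)) (trunc m h)) \<longlonglongrightarrow> B (FT lborel (trunc n g)) h"
      by (intro B_lim FT_contraction tg th trunc_tendsto h)
    then show "(\<lambda>m. B (trunc n g) (FT lborel (trunc m h))) \<longlonglongrightarrow> B (FT lborel (trunc n g)) h"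
      unfolding B_def FT_multiplication_formula[OF th(1) tg(1)] .
  qed
  have "B (fourier h) g = B h (fourier g)"
  proof (rule LIMSEQ_unique)
    show "(\<lambda>n. B (fourier h) (trunc n g)) \<longlonglongrightarrow> B (fourier h) g"
      by (intro B_lim tg fourier_Lsq h g trunc_tendsto)
    have "(\<lambda>n. B h (FT lborel (trunc n g))) \<longlonglongrightarrow> B h (fourier g)"
      by (intro B_lim FT_contraction tg fourier_Lsq fourier_lim h g)
    then show "(\<lambda>n. B (fourier h) (trunc n g)) \<longlonglongrightarrow> B h (fourier g)"
      using step by (simp add: B_sym[of "fourier h"] B_sym[of h])
  qed
  then show ?thesis unfolding B_def by (simp add: mult.commute)
qed

lemma fourier_adjoint:
  assumes g: "g \<in> Lsq lborel" and h: "h \<in> Lsq lborel"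
  shows "ip lborel g (inv_fourier h) = ip lborel (fourier g) h"
proof -
  have "ip lborel g (inv_fourier h) = cnj (LINT x|lborel. g x * fourier (\<lambda>k. cnj (h k)) x)"
    unfolding ip_def inv_fourier_def by (subst Bochner_Integration.integral_cnj[symmetric]) simp
  also have "\<dots> = cnj (LINT x|lborel. fourier g x * cnj (h x))"
    by (simp add: fourier_multiplication_formula[OF g Lsq_cnj[OF h]])
  also have "\<dots> = ip lborel (fourier g) h"
    unfolding ip_def by (subst Bochner_Integration.integral_cnj[symmetric]) simp
  finally show ?thesis .
qed

text \<open>By adjointness and the Parseval identity for indicator functions, both sides have the same
  integral over every interval.\<close>

lemma fourier_inversion:
  assumes f: "f \<in> Lsq lborel"
  shows "AE x in lborel. inv_fourier (fourier f) x = f x"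
proof -
  let ?u = "inv_fourier (fourier f)"
  have u: "?u \<in> Lsq lborel" by (intro inv_fourier_Lsq fourier_Lsq f)
  have "ip lborel (indicator {a<..b}) ?u = ip lborel (indicator {a<..b}) f" for a b
  proof -
    let ?g = "indicator {a<..b} :: real \<Rightarrow> complex"
    note g = indicator_Ioc_Lsq[of a b]
    have "ip lborel ?g ?u = ip lborel (fourier ?g) (fourier f)"
      by (rule fourier_adjoint[OF g(2) fourier_Lsq[OF f]])
    also have "\<dots> = ip lborel (FT lborel ?g) (fourier f)"
      by (rule ip_cong_AE[OF fourier_L1[OF g]])
        (use fourier_Lsq[OF f] fourier_Lsq[OF g(2)] FT_contraction(1)[OF g] in auto)
    also have "\<dots> = ip lborel ?g f"
    proof (rule LIMSEQ_unique)
      show "(\<lambda>n. ip lborel (FT lborel ?g) (FT lborel (trunc n f))) \<longlonglongrightarrow> ip lborel (FT lborel ?g) (fourier f)"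
        by (intro ip_tendsto FT_contraction trunc_L1_L2 fourier_Lsq fourier_lim f g)
      have "(\<lambda>n. ip lborel ?g (trunc n f)) \<longlonglongrightarrow> ip lborel ?g f"
        by (intro ip_tendsto trunc_L1_L2 trunc_tendsto f g)
      then show "(\<lambda>n. ip lborel (FT lborel ?g) (FT lborel (trunc n f))) \<longlonglongrightarrow> ip lborel ?g f"
        by (simp add: FT_parseval_indicator[OF trunc_L1_L2[OF f]])
    qed
    finally show ?thesis .
  qed
  then have "ip lborel (indicator {a<..b}) (\<lambda>x. ?u x - f x) = 0" for a b
    by (simp add: ip_diff_right[OF indicator_Ioc_Lsq(2) u f])
  from AE_zero_if_interval_integrals_zero[OF Lsq_diff[OF u f] this] show ?thesis by simp
qed

lemma fourier_parseval:
  assumes f: "f \<in> Lsq lborel" and g: "g \<in> Lsq lborel"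
  shows "ip lborel (fourier f) (fourier g) = ip lborel f g"
proof -
  have "ip lborel (fourier f) (fourier g) = ip lborel f (inv_fourier (fourier g))"
    by (rule fourier_adjoint[OF f fourier_Lsq[OF g], symmetric])
  also have "\<dots> = ip lborel f g"
    by (rule ip_cong_AE[OF _ fourier_inversion[OF g]])
      (use f g inv_fourier_Lsq[OF fourier_Lsq[OF g]] in \<open>auto dest: LsqD1\<close>)
  finally show ?thesis .
qed

lemma fourier_plancherel:
  assumes f: "f \<in> Lsq lborel" shows "nrm lborel (fourier f) = nrm lborel f"
proof -
  have "complex_of_real ((nrm lborel (fourier f))\<^sup>2) = of_real ((nrm lborel f)\<^sup>2)"
    using fourier_parseval[OF f f] unfolding ip_self .
  then have "(nrm lborel (fourier f))\<^sup>2 = (nrm lborel f)\<^sup>2" using of_real_eq_iff by blast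
  then show ?thesis by (simp add: power2_eq_iff_nonneg)
qed

text \<open>The conjugate of the inversion formula for the conjugate of \<open>h\<close>.\<close>

lemma fourier_inv_fourier:
  assumes h: "h \<in> Lsq lborel"
  shows "AE k in lborel. fourier (inv_fourier h) k = h k"
proof -
  have "AE k in lborel. inv_fourier (fourier (\<lambda>k. cnj (h k))) k = cnj (h k)"
    by (rule fourier_inversion[OF Lsq_cnj[OF h]])
  then show ?thesis by eventually_elim (simp add: inv_fourier_def[abs_def])
qed

lemma nrm_inv_fourier:
  assumes h: "h \<in> Lsq lborel" shows "nrm lborel (inv_fourier h) = nrm lborel h"
proof -
  note L = inv_fourier_Lsq[OF h]
  have "nrm lborel (fourier (inv_fourier h)) = nrm lborel h"
    by (rule nrm_cong_AE[OF fourier_inv_fourier[OF h] LsqD1[OF fourier_Lsq[OF L]] LsqD1[OF h]])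
  then show ?thesis using fourier_plancherel[OF L] by simp
qed

lemma inv_fourier_L1:
  assumes h1: "integrable lborel h" and h2: "h \<in> Lsq lborel"
  shows "AE x in lborel. inv_fourier h x = FT lborel h (- x)"
  using fourier_L1[OF _ Lsq_cnj[OF h2]] h1
proof simp
  assume "AE k in lborel. fourier (\<lambda>k. cnj (h k)) k = FT lborel (\<lambda>k. cnj (h k)) k"
  then show ?thesis
  proof eventually_elim
    case (elim x)
    have "inv_fourier h x = cnj (FT lborel (\<lambda>k. cnj (h k)) x)" by (simp add: inv_fourier_def elim)
    also have "\<dots> = FT lborel h (- x)"
      unfolding FT_def by (subst Bochner_Integration.integral_cnj[symmetric]) (simp add: cis_cnj)
    finally show ?case .
  qed
qed

section \<open>The quadratic form in Fourier space\<close>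

text \<open>The Fourier symbol of \<open>W\<^sub>0(b)\<close>.\<close>

definition symb :: "real \<Rightarrow> real \<Rightarrow> real" where
  "symb b k = 2 * cosh (2 * pi * b * k)"

lemma symb_ge_2: "symb b k \<ge> 2"
  by (simp add: symb_def cosh_real_ge_1)

lemma symb_cosh_sq: "symb b k + 2 = (2 * cosh (pi * b * k))\<^sup>2"
  and symb_sinh_sq: "symb b k = 2 + (2 * sinh (pi * b * k))\<^sup>2"
  using cosh_double_cosh[of "pi * b * k"] cosh_square_eq[of "pi * b * k"]
  by (simp_all add: symb_def mult.assoc power_mult_distrib)

lemma symb_measurable [measurable]: "symb b \<in> borel_measurable borel"
  unfolding symb_def[abs_def] by measurable

text \<open>The function \<open>tanh(\<pi>bk) / (4\<pi>b)\<close> is a primitive of the integrand, because the denominator is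
  \<open>4 cosh\<^sup>2(\<pi>bk)\<close>.\<close>

lemma symb_integral:
  assumes b: "b > 0"
  shows "integrable lborel (\<lambda>k. 1 / (symb b k + 2))" "(LINT k|lborel. 1 / (symb b k + 2)) = 1 / (2 * pi * b)"
proof -
  let ?F = "\<lambda>k. tanh (pi * b * k) / (4 * pi * b)"
  let ?f = "\<lambda>k. 1 / (symb b k + 2)"
  have F: "(?F has_real_derivative ?f k) (at k)" for k
  proof -
    have "(?F has_real_derivative ((1 - (tanh (pi * b * k))\<^sup>2) * (pi * b)) / (4 * pi * b)) (at k)"
      by (auto intro!: derivative_eq_intros)
    also have "((1 - (tanh (pi * b * k))\<^sup>2) * (pi * b)) / (4 * pi * b) = (1 - (tanh (pi * b * k))\<^sup>2) / 4"
      using b by simp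
    also have "1 - (tanh (pi * b * k))\<^sup>2 = 1 / (cosh (pi * b * k))\<^sup>2"
    proof -
      have "1 - (tanh (pi * b * k))\<^sup>2 = ((cosh (pi * b * k))\<^sup>2 - (sinh (pi * b * k))\<^sup>2) / (cosh (pi * b * k))\<^sup>2"
        unfolding tanh_def power_divide by (simp add: diff_divide_distrib)
      then show ?thesis unfolding hyperbolic_pythagoras .
    qed
    also have "\<dots> / 4 = ?f k" unfolding symb_cosh_sq by (simp add: power_mult_distrib)
    finally show ?thesis .
  qed
  have cont: "isCont ?f k" for k
    using symb_ge_2[of b k] unfolding symb_def by (intro continuous_intros) auto
  have lin: "LIM k at_top. pi * b * k :> at_top" "LIM k at_bot. pi * b * k :> at_bot"
    using b by (auto intro!: filterlim_tendsto_pos_mult_at_top[OF tendsto_const] filterlim_tendsto_pos_mult_at_bot[OF tendsto_const] filterlim_ident)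
  have tanh_bot: "(tanh \<longlongrightarrow> -1) (at_bot :: real filter)"
    using tendsto_minus[OF filterlim_compose[OF tanh_real_at_top filterlim_uminus_at_top_at_bot]] by simp
  have A: "((?F \<circ> real_of_ereal) \<longlongrightarrow> - 1 / (4 * pi * b)) (at_right (- \<infinity>))"
    unfolding ereal_tendsto_simps by (intro tendsto_intros filterlim_compose[OF tanh_bot] lin) (use b in auto)
  have B: "((?F \<circ> real_of_ereal) \<longlongrightarrow> 1 / (4 * pi * b)) (at_left \<infinity>)"
    unfolding ereal_tendsto_simps by (intro tendsto_intros filterlim_compose[OF tanh_real_at_top] lin) (use b in auto)
  have pos: "AE k in lborel. - \<infinity> < ereal k \<longrightarrow> ereal k < \<infinity> \<longrightarrow> 0 \<le> ?f k"
  proof (intro AE_I2 impI)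
    show "0 \<le> ?f k" for k using symb_ge_2[of b k] by simp
  qed
  from interval_integral_FTC_nonneg[OF _ F cont pos A B]
  have "set_integrable lborel UNIV ?f" "(LBINT k=-\<infinity>..\<infinity>. ?f k) = 1 / (4 * pi * b) - - 1 / (4 * pi * b)"
    by (auto simp: einterval_eq_UNIV)
  then show "integrable lborel ?f" "(LINT k|lborel. ?f k) = 1 / (2 * pi * b)"
    by (auto simp: set_integrable_def interval_lebesgue_integral_def einterval_eq_UNIV set_lebesgue_integral_def)
qed

text \<open>The Fourier transforms of the functions in the form domain.\<close>

definition Hdom :: "real \<Rightarrow> (real \<Rightarrow> complex) set" where
  "Hdom b = {h \<in> Lsq lborel. (\<lambda>k. of_real (2 * cosh (pi * b * k)) * h k) \<in> Lsq lborel}"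

definition sesq :: "real \<Rightarrow> (real \<Rightarrow> complex) \<Rightarrow> (real \<Rightarrow> complex) \<Rightarrow> complex" where
  "sesq b g h = (LINT k|lborel. of_real (symb b k) * (cnj (g k) * h k))"

text \<open>The inverse Fourier integral. It is a continuous function, which for \<open>h = fourier \<psi>\<close> represents
  \<open>\<psi>\<close> and can therefore be integrated against arbitrary finite measures.\<close>

definition iFT :: "(real \<Rightarrow> complex) \<Rightarrow> real \<Rightarrow> complex" where
  "iFT h x = FT lborel h (- x)"

lemma Hdom_Lsq [dest]: "h \<in> Hdom b \<Longrightarrow> h \<in> Lsq lborel"
  and Hdom_cosh: "h \<in> Hdom b \<Longrightarrow> (\<lambda>k. of_real (2 * cosh (pi * b * k)) * h k) \<in> Lsq lborel"
  by (auto simp: Hdom_def)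

lemma Hdom_sinh:
  assumes h: "h \<in> Hdom b" shows "(\<lambda>k. of_real (2 * sinh (pi * b * k)) * h k) \<in> Lsq lborel"
proof (rule Lsq_bounded[OF Hdom_cosh[OF h], where C=1])
  have [measurable]: "h \<in> borel_measurable borel" using Hdom_Lsq[OF h] by auto
  show "(\<lambda>k. of_real (2 * sinh (pi * b * k)) * h k) \<in> borel_measurable lborel" by measurable
  have "\<bar>sinh x\<bar> \<le> cosh x" for x :: real
    using sinh_le_cosh_real[of x] sinh_le_cosh_real[of "-x"] by (simp add: abs_le_iff)
  then show "norm (of_real (2 * sinh (pi * b * k)) * h k) \<le> 1 * norm (of_real (2 * cosh (pi * b * k)) * h k)" for k
    by (simp add: norm_mult mult_right_mono)
qed

lemma Hdom_add [intro]: "g \<in> Hdom b \<Longrightarrow> h \<in> Hdom b \<Longrightarrow> (\<lambda>k. g k + h k) \<in> Hdom b"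
  using Lsq_add[OF Hdom_cosh Hdom_cosh, of g b h] unfolding Hdom_def by (auto simp: distrib_left)

lemma Hdom_cmult [intro]: "h \<in> Hdom b \<Longrightarrow> (\<lambda>k. c * h k) \<in> Hdom b"
  using Lsq_cmult[OF Hdom_cosh, of h b c] unfolding Hdom_def by (auto simp: mult_ac)

lemma Hdom_0: "(\<lambda>k. 0) \<in> Hdom b" by (auto simp: Hdom_def)

lemma Hdom_sum [intro]: "(\<And>i. i \<in> I \<Longrightarrow> h i \<in> Hdom b) \<Longrightarrow> (\<lambda>k. \<Sum>i\<in>I. h i k) \<in> Hdom b"
  by (induction I rule: infinite_finite_induct) (auto simp: Hdom_0)

lemma Hdom_cong_AE:
  assumes "AE k in lborel. g k = h k" "g \<in> Hdom b" "h \<in> borel_measurable borel"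
  shows "h \<in> Hdom b"
proof -
  note [measurable] = assms(3)
  show ?thesis unfolding Hdom_def
    using Lsq_cong_AE[OF assms(1) Hdom_Lsq[OF assms(2)]] Lsq_cong_AE[OF _ Hdom_cosh[OF assms(2)], of "\<lambda>k. of_real (2 * cosh (pi * b * k)) * h k"]
      assms(1) by auto
qed

lemma sesq_ip:
  assumes g: "g \<in> Hdom b" and h: "h \<in> Hdom b"
  shows "integrable lborel (\<lambda>k. of_real (symb b k) * (cnj (g k) * h k))"
    "sesq b g h = 2 * ip lborel g h + ip lborel (\<lambda>k. of_real (2 * sinh (pi * b * k)) * g k) (\<lambda>k. of_real (2 * sinh (pi * b * k)) * h k)"
proof -
  have eq: "of_real (symb b k) * (cnj (g k) * h k) = 2 * (cnj (g k) * h k) +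
     cnj (of_real (2 * sinh (pi * b * k)) * g k) * (of_real (2 * sinh (pi * b * k)) * h k)" for k
    unfolding symb_sinh_sq by (simp add: power2_eq_square algebra_simps)
  note i1 = integrable_ip[OF Hdom_Lsq[OF g] Hdom_Lsq[OF h]]
  note i2 = integrable_ip[OF Hdom_sinh[OF g] Hdom_sinh[OF h]]
  show "integrable lborel (\<lambda>k. of_real (symb b k) * (cnj (g k) * h k))"
    unfolding eq using i1 i2 by (intro Bochner_Integration.integrable_add) auto
  show "sesq b g h = 2 * ip lborel g h + ip lborel (\<lambda>k. of_real (2 * sinh (pi * b * k)) * g k) (\<lambda>k. of_real (2 * sinh (pi * b * k)) * h k)"
    unfolding sesq_def eq ip_def using i1 i2 by (subst Bochner_Integration.integral_add) auto
qed

lemma sesq_cong_AE: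
  assumes "AE k in lborel. g k = g' k" "AE k in lborel. h k = h' k"
    "g \<in> Lsq lborel" "g' \<in> Lsq lborel" "h \<in> Lsq lborel" "h' \<in> Lsq lborel"
  shows "sesq b g h = sesq b g' h'"
proof -
  have [measurable]: "g \<in> borel_measurable borel" "g' \<in> borel_measurable borel" 
    "h \<in> borel_measurable borel" "h' \<in> borel_measurable borel" using assms(3-) LsqD1 by force+
  show ?thesis unfolding sesq_def by (rule integral_cong_AE) (use assms(1,2) in auto)
qed

lemma iFT_cong_AE:
  assumes "AE k in lborel. g k = h k" "g \<in> Lsq lborel" "h \<in> Lsq lborel"
  shows "iFT g = iFT h"
proof
  have [measurable]: "g \<in> borel_measurable borel" "h \<in> borel_measurable borel" using assms(2-) LsqD1 by force+
  show "iFT g x = iFT h x" for x unfolding iFT_def FT_def by (rule integral_cong_AE) (use assms(1) in auto)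
qed

lemma Lsq_inverse_sqrt:
  assumes [measurable]: "w \<in> borel_measurable borel" and pos: "\<And>k. w k > 0" and int: "integrable lborel (\<lambda>k. 1 / w k)"
  shows "(\<lambda>k. complex_of_real (1 / sqrt (w k))) \<in> Lsq lborel" "(nrm lborel (\<lambda>k. complex_of_real (1 / sqrt (w k))))\<^sup>2 = (LINT k|lborel. 1 / w k)"
proof -
  have eq: "(norm (complex_of_real (1 / sqrt (w k))))\<^sup>2 = 1 / w k" for k
    unfolding norm_of_real power2_abs using less_imp_le[OF pos[of k]] by (simp add: power_divide)
  show "(\<lambda>k. complex_of_real (1 / sqrt (w k))) \<in> Lsq lborel" by (rule LsqI, measurable) (simp only: eq int)
  show "(nrm lborel (\<lambda>k. complex_of_real (1 / sqrt (w k))))\<^sup>2 = (LINT k|lborel. 1 / w k)"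
    unfolding nrm_sq eq ..
qed

text \<open>The Cauchy--Schwarz inequality for the factors \<open>1 / sqrt w\<close> and \<open>sqrt w |h|\<close>. As \<open>iFT h\<close> is
  bounded by the integral of \<open>|h|\<close>, this controls point evaluations by the quadratic form.\<close>

lemma weighted_L1_bound:
  fixes h :: "real \<Rightarrow> complex"
  assumes [measurable]: "w \<in> borel_measurable borel" "h \<in> borel_measurable borel" and pos: "\<And>k. w k > 0" 
    and int: "integrable lborel (\<lambda>k. 1 / w k)" and h: "integrable lborel (\<lambda>k. w k * (norm (h k))\<^sup>2)"
  shows "integrable lborel h" 
    "(LINT k|lborel. norm (h k))\<^sup>2 \<le> (LINT k|lborel. 1 / w k) * (LINT k|lborel. w k * (norm (h k))\<^sup>2)"
proof -
  let ?u = "\<lambda>k. complex_of_real (1 / sqrt (w k))" and ?v = "\<lambda>k. complex_of_real (sqrt (w k)) * h k"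
  note u = Lsq_inverse_sqrt[OF assms(1) pos int]
  have eq: "(norm (?v k))\<^sup>2 = w k * (norm (h k))\<^sup>2" for k
    using less_imp_le[OF pos[of k]] by (simp add: norm_mult power_mult_distrib)
  have v: "?v \<in> Lsq lborel" by (rule LsqI) (auto simp: eq h)
  have uv: "?u k * ?v k = h k" for k using pos[of k] by simp
  show "integrable lborel h" using integrable_mult[OF u(1) v] unfolding uv .
  have nuv: "norm (?u k) * norm (?v k) = norm (h k)" for k unfolding norm_mult[symmetric] uv ..
  have "(LINT k|lborel. norm (h k)) \<le> nrm lborel ?u * nrm lborel ?v" using Lsq_Cauchy_Schwarz[OF u(1) v] unfolding nuv .
  then have "(LINT k|lborel. norm (h k))\<^sup>2 \<le> (nrm lborel ?u * nrm lborel ?v)\<^sup>2"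
    by (intro power_mono) (auto simp: integral_nonneg_AE)
  then show "(LINT k|lborel. norm (h k))\<^sup>2 \<le> (LINT k|lborel. 1 / w k) * (LINT k|lborel. w k * (norm (h k))\<^sup>2)"
    unfolding power_mult_distrib u(2) nrm_sq[of lborel ?v] eq .
qed

lemma Hdom_weighted:
  assumes h: "h \<in> Hdom b"
  shows "integrable lborel (\<lambda>k. (symb b k + a) * (norm (h k))\<^sup>2)"
    "(LINT k|lborel. (symb b k + a) * (norm (h k))\<^sup>2) = Re (sesq b h h) + a * (nrm lborel h)\<^sup>2"
    "sesq b h h = of_real (LINT k|lborel. symb b k * (norm (h k))\<^sup>2)"
proof -
  have eq: "of_real (symb b k) * (cnj (h k) * h k) = complex_of_real (symb b k * (norm (h k))\<^sup>2)" for k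
    by (simp add: complex_norm_square mult.commute del: of_real_power)
  have i: "integrable lborel (\<lambda>k. symb b k * (norm (h k))\<^sup>2)"
    using sesq_ip(1)[OF h h] unfolding eq complex_of_real_integrable_eq .
  show 3: "sesq b h h = of_real (LINT k|lborel. symb b k * (norm (h k))\<^sup>2)"
    unfolding sesq_def eq by (rule integral_complex_of_real)
  have j: "integrable lborel (\<lambda>k. a * (norm (h k))\<^sup>2)" using Hdom_Lsq[OF h] by simp
  show "integrable lborel (\<lambda>k. (symb b k + a) * (norm (h k))\<^sup>2)"
    unfolding distrib_right by (rule Bochner_Integration.integrable_add[OF i j])
  show "(LINT k|lborel. (symb b k + a) * (norm (h k))\<^sup>2) = Re (sesq b h h) + a * (nrm lborel h)\<^sup>2"
    unfolding distrib_right Bochner_Integration.integral_add[OF i j] 3 nrm_sq by simp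
qed

lemma Hdom_L1:
  assumes b: "b > 0" and h: "h \<in> Hdom b" shows "integrable lborel h"
proof (rule weighted_L1_bound(1)[where w="\<lambda>k. symb b k + 2"])
  show "symb b k + 2 > 0" for k using symb_ge_2[of b k] by simp
  show "h \<in> borel_measurable borel" using Hdom_Lsq[OF h] by auto
  show "integrable lborel (\<lambda>k. 1 / (symb b k + 2))" by (rule symb_integral[OF b])
  show "integrable lborel (\<lambda>k. (symb b k + 2) * (norm (h k))\<^sup>2)" by (rule Hdom_weighted(1)[OF h])
qed measurable

lemma iFT_continuous: "integrable lborel h \<Longrightarrow> continuous_on UNIV (iFT h)"
  unfolding iFT_def[abs_def]
  by (rule continuous_on_compose2[OF FT_continuous]) (auto intro: continuous_intros)

lemma norm_iFT_le: "norm (iFT h x) \<le> (LINT k|lborel. norm (h k))"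
  unfolding iFT_def by (rule norm_FT_le) simp

lemma iFT_measurable [measurable]: "integrable lborel h \<Longrightarrow> iFT h \<in> borel_measurable borel"
  by (intro borel_measurable_continuous_onI iFT_continuous)

lemma iFT_add: "integrable lborel g \<Longrightarrow> integrable lborel h \<Longrightarrow> iFT (\<lambda>k. g k + h k) x = iFT g x + iFT h x"
  unfolding iFT_def by (rule FT_add) auto

lemma iFT_cmult: "iFT (\<lambda>k. c * h k) x = c * iFT h x"
  unfolding iFT_def by (rule FT_cmult)

lemma iFT_sum: "(\<And>i. i \<in> I \<Longrightarrow> integrable lborel (h i)) \<Longrightarrow> iFT (\<lambda>k. \<Sum>i\<in>I. c i * h i k) x = (\<Sum>i\<in>I. c i * iFT (h i) x)"
proof (induction I rule: infinite_finite_induct)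
  case (insert i I)
  then show ?case by (simp add: iFT_add iFT_cmult)
qed (auto simp: iFT_def FT_def)

text \<open>The set where the functions differ is open and has measure zero.\<close>

lemma continuous_AE_eq:
  fixes f g :: "real \<Rightarrow> complex"
  assumes f: "continuous_on UNIV f" and g: "continuous_on UNIV g" and ae: "AE x in lborel. f x = g x"
  shows "f = g"
proof (rule ccontr)
  assume "f \<noteq> g"
  let ?S = "{x. f x \<noteq> g x}"
  have o: "open ?S" by (intro open_Collect_neq f g)
  have "?S \<noteq> {}" using \<open>f \<noteq> g\<close> by auto
  moreover have "negligible ?S"
  proof -
    have "?S \<in> null_sets lborel"
      using ae o by (subst AE_iff_null_sets) auto
    then show ?thesis by (auto simp: negligible_iff_null_sets intro: null_sets_completionI)
  qed
  ultimately show False using open_not_negligible[OF o] by blast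
qed

lemma form_domain_Hdom: "\<psi> \<in> form_domain b \<longleftrightarrow> \<psi> \<in> Lsq lborel \<and> fourier \<psi> \<in> Hdom b"
  unfolding form_domain_def L2_Lsq Hdom_def using fourier_Lsq by auto

lemma continuous_rep_unique:
  assumes "continuous_on UNIV g" "AE x in lborel. g x = \<psi> x"
  shows "continuous_rep \<psi> = g"
proof -
  let ?P = "\<lambda>g. continuous_on UNIV g \<and> (AE x in lborel. g x = \<psi> x)"
  have P: "?P (continuous_rep \<psi>)" unfolding continuous_rep_def by (rule someI[of ?P g]) (use assms in simp)
  show ?thesis
  proof (rule continuous_AE_eq)
    show "AE x in lborel. continuous_rep \<psi> x = g x" using P[THEN conjunct2] assms(2) by eventually_elim simp
  qed (use P assms in auto)
qed

lemma continuous_rep_iFT: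
  assumes b: "b > 0" and psi: "\<psi> \<in> form_domain b"
  shows "continuous_rep \<psi> = iFT (fourier \<psi>)"
proof (rule continuous_rep_unique)
  have L: "\<psi> \<in> Lsq lborel" and H: "fourier \<psi> \<in> Hdom b" using psi form_domain_Hdom by auto
  note i = Hdom_L1[OF b H]
  show "continuous_on UNIV (iFT (fourier \<psi>))" by (rule iFT_continuous[OF i])
  show "AE x in lborel. iFT (fourier \<psi>) x = \<psi> x"
    using fourier_inversion[OF L] inv_fourier_L1[OF i Hdom_Lsq[OF H]]
    by eventually_elim (simp add: iFT_def)
qed

lemma inv_fourier_form_domain:
  assumes h: "h \<in> Hdom b"
  shows "inv_fourier h \<in> form_domain b" "AE k in lborel. fourier (inv_fourier h) k = h k"
proof -
  show 1: "AE k in lborel. fourier (inv_fourier h) k = h k" by (rule fourier_inv_fourier[OF Hdom_Lsq[OF h]])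
  have L: "inv_fourier h \<in> Lsq lborel" by (rule inv_fourier_Lsq[OF Hdom_Lsq[OF h]])
  have "fourier (inv_fourier h) \<in> Hdom b"
    by (rule Hdom_cong_AE[OF _ h]) (use 1 fourier_Lsq[OF L] in auto)
  then show "inv_fourier h \<in> form_domain b" using L form_domain_Hdom by auto
qed

text \<open>The sesquilinear form of \<open>W\<close> with the potential \<open>M\<close>, acting on Fourier transforms.\<close>

definition qform :: "real \<Rightarrow> real measure \<Rightarrow> (real \<Rightarrow> complex) \<Rightarrow> (real \<Rightarrow> complex) \<Rightarrow> complex" where
  "qform b M g h = sesq b g h - ip M (iFT g) (iFT h)"

lemma qform_cong_AE:
  assumes ae: "AE k in lborel. g k = g' k" "AE k in lborel. h k = h' k"
    and mem: "g \<in> Hdom b" "g' \<in> Hdom b" "h \<in> Hdom b" "h' \<in> Hdom b"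
  shows "qform b M g h = qform b M g' h'"
  unfolding qform_def iFT_cong_AE[OF ae(1) mem(1,2)[THEN Hdom_Lsq]] iFT_cong_AE[OF ae(2) mem(3,4)[THEN Hdom_Lsq]]
    sesq_cong_AE[OF ae mem[THEN Hdom_Lsq]] ..

lemma W_form_measure:
  assumes b: "b > 0" and phi: "\<phi> \<in> form_domain b" and psi: "\<psi> \<in> form_domain b"
  shows "W_form b (measure_form M) \<phi> \<psi> = qform b M (fourier \<phi>) (fourier \<psi>)"
  using phi psi fourier_parseval[of \<phi> \<psi>]
  by (simp add: W_form_def measure_form_def qform_def form_domain_Hdom L2_inner_ip sesq_ip(2) 
      continuous_rep_iFT[OF b] ip_def[of M])

text \<open>The Fourier transform maps the form domain onto \<open>Hdom b\<close> up to null functions, so \<open>Hdom b\<close> may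
  serve as the space of test functions.\<close>

lemma W_op_measure_iff:
  assumes b: "b > 0"
  shows "(\<psi>, \<eta>) \<in> W_op b (measure_form M) \<longleftrightarrow> \<psi> \<in> form_domain b \<and> \<eta> \<in> Lsq lborel \<and>
     (\<forall>g\<in>Hdom b. qform b M g (fourier \<psi>) = ip lborel g (fourier \<eta>))"
proof -
  have "(\<forall>\<phi>\<in>form_domain b. W_form b (measure_form M) \<phi> \<psi> = L2_inner \<phi> \<eta>) \<longleftrightarrow>
     (\<forall>g\<in>Hdom b. qform b M g (fourier \<psi>) = ip lborel g (fourier \<eta>))" (is "?A \<longleftrightarrow> ?B")
    if psi: "\<psi> \<in> form_domain b" and eta: "\<eta> \<in> Lsq lborel"
  proof
    assume A: ?A
    show ?B
    proof
      fix g assume g: "g \<in> Hdom b"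
      let ?\<phi> = "inv_fourier g"
      note phi = inv_fourier_form_domain[OF g]
      have L: "?\<phi> \<in> Lsq lborel" and H: "fourier ?\<phi> \<in> Hdom b" using phi form_domain_Hdom by blast+
      have Hpsi: "fourier \<psi> \<in> Hdom b" using psi form_domain_Hdom by blast
      have "qform b M g (fourier \<psi>) = qform b M (fourier ?\<phi>) (fourier \<psi>)"
        using qform_cong_AE[OF phi(2) _ H g Hpsi Hpsi] by simp
      also have "\<dots> = ip lborel ?\<phi> \<eta>" using A[rule_format, OF phi(1)] W_form_measure[OF b phi(1) psi, of M] by (simp add: L2_inner_ip)
      also have "\<dots> = ip lborel (fourier ?\<phi>) (fourier \<eta>)" by (rule fourier_parseval[OF L eta, symmetric])
      also have "\<dots> = ip lborel g (fourier \<eta>)"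
        by (rule ip_cong_AE[OF phi(2)]) (use fourier_Lsq[OF L] fourier_Lsq[OF eta] Hdom_Lsq[OF g] in auto)
      finally show "qform b M g (fourier \<psi>) = ip lborel g (fourier \<eta>)" .
    qed
  next
    assume B: ?B
    show ?A
    proof
      fix \<phi> assume phi: "\<phi> \<in> form_domain b"
      then have "\<phi> \<in> Lsq lborel" "fourier \<phi> \<in> Hdom b" using form_domain_Hdom by auto
      then show "W_form b (measure_form M) \<phi> \<psi> = L2_inner \<phi> \<eta>"
        using B W_form_measure[OF b phi psi] fourier_parseval[of \<phi> \<eta>] eta by (simp add: L2_inner_ip)
    qed
  qed
  then show ?thesis unfolding W_op_def L2_Lsq by blast
qed

lemma W_bounded_below_measure_iff:
  assumes b: "b > 0"
  shows "W_bounded_below b (measure_form M) c \<longleftrightarrow> (\<forall>h\<in>Hdom b. Re (qform b M h h) \<ge> c * (nrm lborel h)\<^sup>2)"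
proof
  assume A: "W_bounded_below b (measure_form M) c"
  show "\<forall>h\<in>Hdom b. Re (qform b M h h) \<ge> c * (nrm lborel h)\<^sup>2"
  proof
    fix h assume h: "h \<in> Hdom b"
    let ?\<phi> = "inv_fourier h"
    note phi = inv_fourier_form_domain[OF h]
    have H: "fourier ?\<phi> \<in> Hdom b" using phi form_domain_Hdom by blast
    have "qform b M h h = qform b M (fourier ?\<phi>) (fourier ?\<phi>)"
      by (rule qform_cong_AE[OF phi(2) phi(2) H h H h, symmetric])
    moreover have "nrm lborel h = nrm lborel ?\<phi>" by (rule nrm_inv_fourier[OF Hdom_Lsq[OF h], symmetric])
    ultimately show "Re (qform b M h h) \<ge> c * (nrm lborel h)\<^sup>2"
      using A phi(1) W_form_measure[OF b phi(1) phi(1)] unfolding W_bounded_below_def L2_norm_nrm by metis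
  qed
next
  assume B: "\<forall>h\<in>Hdom b. Re (qform b M h h) \<ge> c * (nrm lborel h)\<^sup>2"
  show "W_bounded_below b (measure_form M) c"
    unfolding W_bounded_below_def L2_norm_nrm
  proof
    fix \<psi> assume psi: "\<psi> \<in> form_domain b"
    then show "c * (nrm lborel \<psi>)\<^sup>2 \<le> Re (W_form b (measure_form M) \<psi> \<psi>)"
      using B form_domain_Hdom[of \<psi> b] W_form_measure[OF b psi psi] fourier_plancherel[of \<psi>] by metis
  qed
qed

text \<open>A function in the form domain agrees with its continuous representative almost everywhere, and
  a measure with a density does not see the exceptional null set.\<close>

lemma potential_form_measure_form:
  assumes b: "b > 0" and V: "integrable lborel V" "AE x in lborel. V x \<ge> 0"
    and phi: "\<phi> \<in> form_domain b" and psi: "\<psi> \<in> form_domain b"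
  shows "potential_form V \<phi> \<psi> = measure_form (density lborel (\<lambda>x. ennreal (V x))) \<phi> \<psi>"
proof -
  have ae: "AE x in lborel. continuous_rep \<theta> x = \<theta> x" and m: "continuous_rep \<theta> \<in> borel_measurable borel" "\<theta> \<in> borel_measurable borel"
    if chi: "\<theta> \<in> form_domain b" for \<theta>
  proof -
    have L: "\<theta> \<in> Lsq lborel" and H: "fourier \<theta> \<in> Hdom b" using chi form_domain_Hdom by auto
    note i = Hdom_L1[OF b H]
    show "AE x in lborel. continuous_rep \<theta> x = \<theta> x"
      unfolding continuous_rep_iFT[OF b chi]
      using fourier_inversion[OF L] inv_fourier_L1[OF i Hdom_Lsq[OF H]] by eventually_elim (simp add: iFT_def)
    show "continuous_rep \<theta> \<in> borel_measurable borel" unfolding continuous_rep_iFT[OF b chi] by (rule iFT_measurable[OF i])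
    show "\<theta> \<in> borel_measurable borel" using L by auto
  qed
  note [measurable] = m[OF phi] m[OF psi] borel_measurable_integrable[OF V(1)]
  have "measure_form (density lborel (\<lambda>x. ennreal (V x))) \<phi> \<psi> = (LINT x|lborel. V x *\<^sub>R (cnj (continuous_rep \<phi> x) * continuous_rep \<psi> x))"
    unfolding measure_form_def by (rule integral_density) (use V in auto)
  also have "\<dots> = potential_form V \<phi> \<psi>"
    unfolding potential_form_def by (rule integral_cong_AE) (use ae[OF phi] ae[OF psi] in \<open>auto simp: scaleR_conv_of_real\<close>)
  finally show ?thesis by simp
qed

lemma W_potential_measure:
  assumes b: "b > 0" and V: "integrable lborel V" "AE x in lborel. V x \<ge> 0"
  shows "W_op b (potential_form V) = W_op b (measure_form (density lborel (\<lambda>x. ennreal (V x))))"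
    "W_bounded_below b (potential_form V) c = W_bounded_below b (measure_form (density lborel (\<lambda>x. ennreal (V x)))) c"
proof -
  note eq = potential_form_measure_form[OF b V]
  show "W_op b (potential_form V) = W_op b (measure_form (density lborel (\<lambda>x. ennreal (V x))))"
    unfolding W_op_def W_form_def using eq by auto
  show "W_bounded_below b (potential_form V) c = W_bounded_below b (measure_form (density lborel (\<lambda>x. ennreal (V x)))) c"
    unfolding W_bounded_below_def W_form_def using eq by auto
qed

section \<open>The Fourier transform of the resolvent kernel\<close>

text \<open>The denominator \<open>cosh z + cos \<omega>\<close> vanishes exactly at \<open>\<plusminus> i(\<pi> - \<omega>) + 2\<pi>i n\<close>. The bounds on
  \<open>Im z\<close> describe the largest open strip around \<open>0 \<le> Im z \<le> 2\<pi>\<close> that contains only two of these points.\<close>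

lemma strip_denominator_zero:
  assumes w: "0 < \<omega>" "\<omega> < pi" and z: "cos (\<i> * z) + of_real (cos \<omega>) = 0" and im: "- (pi - \<omega>) < Im z" "Im z < 2 * pi + (pi - \<omega>)"
  shows "z = \<i> * of_real (pi - \<omega>) \<or> z = \<i> * of_real (2 * pi - (pi - \<omega>))"
proof -
  define \<alpha> where "\<alpha> = pi - \<omega>"
  have a: "0 < \<alpha>" "\<alpha> < pi" using w by (auto simp: \<alpha>_def)
  have "cos (\<i> * z) = of_real (- cos \<omega>)" using z by (simp add: add_eq_0_iff2)
  also have "- cos \<omega> = cos \<alpha>" by (simp add: \<alpha>_def)
  finally have "cos (\<i> * z) = cos (of_real \<alpha>)" by (simp add: cos_of_real)
  then obtain n where "n \<in> \<int>" and n: "\<i> * z = of_real \<alpha> + of_real (2 * n * pi) \<or> \<i> * z = - of_real \<alpha> + of_real (2 * n * pi)"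
    unfolding complex_cos_eq by blast
  then obtain m :: int where m: "n = of_int m" by (auto elim: Ints_cases)
  have z_eq: "z = - \<i> * (\<i> * z)" by (simp add: algebra_simps)
  from n show ?thesis
  proof
    assume *: "\<i> * z = of_real \<alpha> + of_real (2 * n * pi)"
    have ze: "z = - \<i> * of_real (\<alpha> + 2 * n * pi)" by (subst z_eq) (simp add: *)
    then have "Im z = - \<alpha> - 2 * n * pi" by simp
    then have "2 * n * pi < 0" "0 < 2 * n * pi + 2 * \<alpha> + 2 * pi" using im unfolding \<alpha>_def[symmetric] by linarith+
    then have "n * pi < 0 * pi" "(- 2) * pi < n * pi" using a by linarith+
    then have "n < 0" "- 2 < n" using mult_less_cancel_right_pos[OF pi_gt_zero] by blast+
    then have "m < 0" "m + 2 > 0" unfolding m by linarith+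
    then have "m = -1" by linarith
    then show ?thesis unfolding \<alpha>_def[symmetric] using ze m by (simp add: algebra_simps)
  next
    assume *: "\<i> * z = - of_real \<alpha> + of_real (2 * n * pi)"
    have ze: "z = - \<i> * of_real (- \<alpha> + 2 * n * pi)" by (subst z_eq) (simp add: *)
    then have "Im z = \<alpha> - 2 * n * pi" by simp
    then have "2 * n * pi < 2 * \<alpha>" "0 < 2 * n * pi + 2 * pi" using im unfolding \<alpha>_def[symmetric] by linarith+
    then have "n * pi < 1 * pi" "(- 1) * pi < n * pi" using a by linarith+
    then have "n < 1" "- 1 < n" using mult_less_cancel_right_pos[OF pi_gt_zero] by blast+
    then have "m < 1" "m > -1" unfolding m by linarith+
    then have "m = 0" by linarith
    then show ?thesis unfolding \<alpha>_def[symmetric] using ze m by simp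
  qed
qed

text \<open>Both poles inside the rectangle are simple; the residues are the numerator divided by the
  derivative \<open>sinh z\<close> of the denominator. Writing \<open>cosh z\<close> as \<open>cos (iz)\<close> gives access to the
  description of the zeros.\<close>

lemma strip_residues:
  fixes \<omega> \<xi> R :: real
  assumes w: "0 < \<omega>" "\<omega> < pi" and R: "R > 0"
  defines "f \<equiv> \<lambda>z. exp (\<i> * of_real \<xi> * z) / (cos (\<i> * z) + of_real (cos \<omega>))"
  shows "contour_integral (rectpath (Complex (- R) 0) (Complex R (2 * pi))) f
      = of_real (2 * pi / sin \<omega> * (exp (- \<xi> * (pi - \<omega>)) - exp (- \<xi> * (pi + \<omega>))))"
    and "f holomorphic_on {z. - (pi - \<omega>) < Im z \<and> Im z < 2 * pi + (pi - \<omega>)} - {\<i> * of_real (pi - \<omega>), \<i> * of_real (2 * pi - (pi - \<omega>))}"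
proof -
  define \<alpha> where "\<alpha> = pi - \<omega>"
  have a: "0 < \<alpha>" "\<alpha> < pi" using w by (auto simp: \<alpha>_def)
  define S where "S = {z. - \<alpha> < Im z \<and> Im z < 2 * pi + \<alpha>}"
  define p1 where "p1 = \<i> * of_real \<alpha>"
  define p2 where "p2 = \<i> * of_real (2 * pi - \<alpha>)"
  let ?g = "\<lambda>z. cos (\<i> * z) + complex_of_real (cos \<omega>)"
  let ?e = "\<lambda>z. exp (\<i> * complex_of_real \<xi> * z)"
  have S_eq: "S = {z. - \<alpha> < Im z} \<inter> {z. Im z < 2 * pi + \<alpha>}" by (auto simp: S_def)
  have S: "open S" "convex S"
    unfolding S_eq by (intro open_Int open_halfspace_Im_gt open_halfspace_Im_lt convex_Int convex_halfspace_Im_gt convex_halfspace_Im_lt)+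
  have nz: "?g z \<noteq> 0" if "z \<in> S - {p1, p2}" for z
    using strip_denominator_zero[OF w, of z] that unfolding S_def p1_def p2_def \<alpha>_def by auto
  have holo: "f holomorphic_on S - {p1, p2}"
    unfolding f_def using nz by (intro holomorphic_intros) auto
  then show "f holomorphic_on {z. - (pi - \<omega>) < Im z \<and> Im z < 2 * pi + (pi - \<omega>)} - {\<i> * of_real (pi - \<omega>), \<i> * of_real (2 * pi - (pi - \<omega>))}"
    unfolding S_def p1_def p2_def \<alpha>_def .
  let ?p = "rectpath (Complex (- R) 0) (Complex R (2 * pi))"
  have img: "path_image ?p \<subseteq> S - {p1, p2}"
  proof -
    have "path_image ?p \<subseteq> cbox (Complex (- R) 0) (Complex R (2 * pi)) - box (Complex (- R) 0) (Complex R (2 * pi))"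
      using R by (subst path_image_rectpath_cbox_minus_box) auto
    also have "\<dots> \<subseteq> S - {p1, p2}"
      using a R by (auto simp: S_def p1_def p2_def in_cbox_complex_iff in_box_complex_iff)
    finally show ?thesis .
  qed
  have out: "\<forall>z. z \<notin> S \<longrightarrow> winding_number ?p z = 0"
    using R a by (auto intro!: winding_number_rectpath_outside simp: S_def in_cbox_complex_iff)
  have sw: "complex_of_real (sin \<omega>) \<noteq> 0" using sin_gt_zero[OF w] by simp
  have "contour_integral ?p f = 2 * pi * \<i> * (\<Sum>p\<in>{p1, p2}. winding_number ?p p * residue f p)"
    by (rule Residue_theorem[OF S(1) convex_connected[OF S(2)] _ holo _ _ img out]) auto
  also have "(\<Sum>p\<in>{p1, p2}. winding_number ?p p * residue f p) = residue f p1 + residue f p2"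
  proof -
    have "winding_number ?p p1 = 1" "winding_number ?p p2 = 1"
      using R a by (auto intro!: winding_number_rectpath simp: p1_def p2_def in_box_complex_iff)
    moreover have "p1 \<noteq> p2" using a unfolding p1_def p2_def by (auto simp: complex_eq_iff)
    ultimately show ?thesis by simp
  qed
  also have "residue f p1 = of_real (exp (- \<xi> * \<alpha>)) / (\<i> * of_real (sin \<omega>))"
  proof -
    have ip: "\<i> * p1 = - of_real \<alpha>" by (simp add: p1_def mult.assoc[symmetric])
    have sa: "sin \<alpha> = sin \<omega>" by (simp add: \<alpha>_def)
    have "residue (\<lambda>z. ?e z / ?g z) p1 = ?e p1 / (- sin (\<i> * p1) * \<i>)"
    proof (rule residue_simple_pole_deriv[where s=UNIV])
      have "cos \<alpha> = - cos \<omega>" by (simp add: \<alpha>_def)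
      then show "?g p1 = 0" unfolding ip by (simp add: cos_of_real)
      show "(?g has_field_derivative - sin (\<i> * p1) * \<i>) (at p1)" by (auto intro!: derivative_eq_intros)
      show "- sin (\<i> * p1) * \<i> \<noteq> 0" unfolding ip using sin_gt_zero[OF a] by (simp add: sin_of_real)
    qed (auto intro!: holomorphic_intros)
    moreover have "?e p1 = of_real (exp (- \<xi> * \<alpha>))" by (simp add: p1_def mult.assoc[symmetric] exp_of_real[symmetric] mult.commute mult.left_commute)
    moreover have "- sin (\<i> * p1) * \<i> = \<i> * of_real (sin \<omega>)" unfolding ip sa[symmetric] by (simp add: sin_of_real)
    ultimately show ?thesis unfolding f_def by (simp only: divide_minus_right minus_divide_left[symmetric])
  qed
  also have "residue f p2 = - of_real (exp (- \<xi> * (2 * pi - \<alpha>))) / (\<i> * of_real (sin \<omega>))"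
  proof -
    have ip: "\<i> * p2 = of_real (\<alpha> - 2 * pi)" by (simp add: p2_def mult.assoc[symmetric])
    have cs: "cos (\<alpha> - 2 * pi) = cos \<alpha>" "sin (\<alpha> - 2 * pi) = sin \<alpha>" by (simp_all add: cos_diff sin_diff)
    have "residue (\<lambda>z. ?e z / ?g z) p2 = ?e p2 / (- sin (\<i> * p2) * \<i>)"
    proof (rule residue_simple_pole_deriv[where s=UNIV])
      show "?g p2 = 0" unfolding ip cos_of_real cs by (simp add: \<alpha>_def)
      show "(?g has_field_derivative - sin (\<i> * p2) * \<i>) (at p2)" by (auto intro!: derivative_eq_intros)
      show "- sin (\<i> * p2) * \<i> \<noteq> 0" unfolding ip sin_of_real cs using sin_gt_zero[OF a] by simp
    qed (auto intro!: holomorphic_intros)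
    moreover have "?e p2 = of_real (exp (- \<xi> * (2 * pi - \<alpha>)))" by (simp add: p2_def mult.assoc[symmetric] exp_of_real[symmetric] mult.commute mult.left_commute)
    moreover have "- sin (\<i> * p2) * \<i> = - (\<i> * of_real (sin \<omega>))" unfolding ip sin_of_real cs by (simp add: \<alpha>_def)
    ultimately show ?thesis unfolding f_def by (simp only: divide_minus_right minus_divide_left[symmetric])
  qed
  also have "2 * pi * \<i> * (of_real (exp (- \<xi> * \<alpha>)) / (\<i> * of_real (sin \<omega>)) + - of_real (exp (- \<xi> * (2 * pi - \<alpha>))) / (\<i> * of_real (sin \<omega>)))
     = complex_of_real (2 * pi / sin \<omega> * (exp (- \<xi> * \<alpha>) - exp (- \<xi> * (2 * pi - \<alpha>))))"
    using sw by (simp add: field_simps)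
  also have "2 * pi - \<alpha> = pi + \<omega>" by (simp add: \<alpha>_def)
  finally show "contour_integral ?p f = of_real (2 * pi / sin \<omega> * (exp (- \<xi> * (pi - \<omega>)) - exp (- \<xi> * (pi + \<omega>))))"
    unfolding \<alpha>_def .
qed

text \<open>The quotient of \<open>s + 2 cos \<omega>\<close> and \<open>s + 2\<close> increases with \<open>s\<close>, so on \<open>s \<ge> 2\<close> it is smallest at
  \<open>s = 2\<close>.\<close>

lemma symb_lower_bound:
  assumes "0 \<le> \<omega>" "\<omega> < pi"
  shows "1 + cos \<omega> > 0" "symb b k + 2 * cos \<omega> \<ge> (1 + cos \<omega>) / 2 * (symb b k + 2)"
proof -
  show c: "1 + cos \<omega> > 0" using cos_monotone_0_pi[of \<omega> pi] assms by simp
  \<comment> \<open>The difference of the two sides is half of this product.\<close>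
  have "(1 - cos \<omega>) * (symb b k - 2) \<ge> 0" using symb_ge_2[of b k] by (intro mult_nonneg_nonneg) auto
  then show "symb b k + 2 * cos \<omega> \<ge> (1 + cos \<omega>) / 2 * (symb b k + 2)" by (simp add: field_simps)
qed

lemma symb_plus_cos_pos:
  assumes "0 \<le> \<omega>" "\<omega> < pi" shows "symb b k + 2 * cos \<omega> > 0"
proof -
  have "(1 + cos \<omega>) / 2 * (symb b k + 2) > 0" using symb_lower_bound(1)[OF assms] symb_ge_2[of b k] by (intro mult_pos_pos) auto
  then show ?thesis using symb_lower_bound(2)[OF assms, of b k] by linarith
qed

lemma symb_integrable:
  assumes b: "b > 0" and w: "0 \<le> \<omega>" "\<omega> < pi"
  shows "integrable lborel (\<lambda>k. 1 / (symb b k + 2 * cos \<omega>))"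
proof (rule Bochner_Integration.integrable_bound)
  let ?c = "(1 + cos \<omega>) / 2"
  show "integrable lborel (\<lambda>k. 1 / ?c * (1 / (symb b k + 2)))" by (intro integrable_mult_right symb_integral[OF b])
  note pos = symb_plus_cos_pos[OF w, of b]
  show "AE k in lborel. norm (1 / (symb b k + 2 * cos \<omega>)) \<le> norm (1 / ?c * (1 / (symb b k + 2)))"
  proof (rule AE_I2)
    fix k
    have "1 / (symb b k + 2 * cos \<omega>) \<le> 1 / (?c * (symb b k + 2))"
      using symb_lower_bound(1)[OF w] symb_lower_bound(2)[OF w, of b k] symb_ge_2[of b k] pos[of k]
      by (intro divide_left_mono mult_pos_pos) auto
    also have "\<dots> = 1 / ?c * (1 / (symb b k + 2))" by simp
    also have "\<dots> \<le> norm (1 / ?c * (1 / (symb b k + 2)))" unfolding real_norm_def by (rule abs_ge_self)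
    finally have "1 / (symb b k + 2 * cos \<omega>) \<le> norm (1 / ?c * (1 / (symb b k + 2)))" .
    moreover have "norm (1 / (symb b k + 2 * cos \<omega>)) = 1 / (symb b k + 2 * cos \<omega>)" using pos[of k] by simp
    ultimately show "norm (1 / (symb b k + 2 * cos \<omega>)) \<le> norm (1 / ?c * (1 / (symb b k + 2)))" by (simp only:)
  qed
qed measurable

text \<open>Lower bound for the denominator on the vertical sides of the contour, as \<open>cosh z = cos (iz)\<close>.\<close>

lemma norm_cos_imaginary_ge: "norm (cos (\<i> * z)) \<ge> \<bar>sinh (Re z)\<bar>"
proof (rule power2_le_imp_le)
  have "(norm (cos (\<i> * z)))\<^sup>2 = (cos (Im z))\<^sup>2 + (sinh (Re z))\<^sup>2"
    unfolding norm_cos_squared by (simp add: sinh_field_def exp_minus power_divide)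
  then show "\<bar>sinh (Re z)\<bar>\<^sup>2 \<le> (norm (cos (\<i> * z)))\<^sup>2" by simp
qed simp

lemma cosh_symb: "symb (1 / (2 * pi)) t = 2 * cosh t"
  by (simp add: symb_def)

lemma cosh_kernel_integrable:
  assumes w: "0 \<le> \<omega>" "\<omega> < pi"
  shows "integrable lborel (\<lambda>t. 1 / (cosh t + cos \<omega>))" "cosh t + cos \<omega> > 0"
proof -
  have "1 / (cosh t + cos \<omega>) = 2 * (1 / (symb (1 / (2 * pi)) t + 2 * cos \<omega>))" for t
    unfolding cosh_symb by (simp add: distrib_left[symmetric] del: distrib_left_numeral)
  then show "integrable lborel (\<lambda>t. 1 / (cosh t + cos \<omega>))"
    using symb_integrable[OF _ w, of "1 / (2 * pi)"] by (simp only:) (intro integrable_mult_right, simp)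
  show "cosh t + cos \<omega> > 0" using symb_plus_cos_pos[OF w, of "1 / (2 * pi)" t] unfolding cosh_symb by linarith
qed

text \<open>The integrand is multiplied by \<open>exp(- 2\<pi>\<xi>)\<close> under \<open>z \<mapsto> z + 2\<pi>i\<close>, so the two horizontal sides of the
  rectangle with vertices \<open>\<plusminus> R\<close> and \<open>\<plusminus> R + 2\<pi>i\<close> combine. The right-hand side bounds the two vertical
  sides.\<close>

lemma rectangle_contour:
  fixes \<omega> \<xi> R :: real
  assumes w: "0 < \<omega>" "\<omega> < pi" and xi: "\<xi> > 0" and R: "R > 0" "sinh R > 1"
  shows "norm (of_real (1 - exp (- 2 * pi * \<xi>)) * integral {- R..R} (\<lambda>t. cis (\<xi> * t) / of_real (cosh t + cos \<omega>))
     - of_real (2 * pi / sin \<omega> * (exp (- \<xi> * (pi - \<omega>)) - exp (- \<xi> * (pi + \<omega>))))) \<le> 4 * pi / (sinh R - 1)"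
proof -
  define f where "f z = exp (\<i> * of_real \<xi> * z) / (cos (\<i> * z) + of_real (cos \<omega>))" for z
  let ?a1 = "Complex (- R) 0" and ?a2 = "Complex R 0" and ?a3 = "Complex R (2 * pi)" and ?a4 = "Complex (- R) (2 * pi)"
  define P where "P = {z. - (pi - \<omega>) < Im z \<and> Im z < 2 * pi + (pi - \<omega>)} - {\<i> * of_real (pi - \<omega>), \<i> * of_real (2 * pi - (pi - \<omega>))}"
  note res = strip_residues[OF w R(1), of \<xi>, folded f_def[abs_def]]
  have cont: "continuous_on P f" using res(2) unfolding P_def by (rule holomorphic_on_imp_continuous_on)
  have seg: "closed_segment ?a1 ?a2 \<subseteq> P" "closed_segment ?a2 ?a3 \<subseteq> P" "closed_segment ?a3 ?a4 \<subseteq> P" "closed_segment ?a4 ?a1 \<subseteq> P"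
    using w R by (auto simp: P_def closed_segment_same_Im closed_segment_same_Re closed_segment_eq_real_ivl)
  have int: "f contour_integrable_on linepath a c" if "closed_segment a c \<subseteq> P" for a c
    by (rule contour_integrable_continuous_linepath[OF continuous_on_subset[OF cont that]])
  note ints = seg[THEN int]
  let ?I = "\<lambda>a c. contour_integral (linepath a c) f"
  have sum: "contour_integral (rectpath ?a1 ?a3) f = ?I ?a1 ?a2 + (?I ?a2 ?a3 + (?I ?a3 ?a4 + ?I ?a4 ?a1))"
    unfolding rectpath_def Let_def by (simp add: ints contour_integrable_join)
  have period: "f (z + of_real (2 * pi) * \<i>) = of_real (exp (- 2 * pi * \<xi>)) * f z" for z
  proof -
    have "cos (\<i> * (z + of_real (2 * pi) * \<i>)) = cos (\<i> * z - of_real (2 * pi))" by (simp add: algebra_simps)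
    also have "\<dots> = cos (\<i> * z)" unfolding cos_diff by (simp only: cos_of_real sin_of_real) simp
    finally have 1: "cos (\<i> * (z + of_real (2 * pi) * \<i>)) = cos (\<i> * z)" .
    have "exp (\<i> * of_real \<xi> * (z + of_real (2 * pi) * \<i>)) = exp (of_real (- 2 * pi * \<xi>) + \<i> * of_real \<xi> * z)"
      by (simp add: algebra_simps)
    also have "\<dots> = of_real (exp (- 2 * pi * \<xi>)) * exp (\<i> * of_real \<xi> * z)"
      by (simp only: exp_add exp_of_real)
    finally show ?thesis unfolding f_def 1 by simp
  qed
  have top: "?I ?a3 ?a4 = - of_real (exp (- 2 * pi * \<xi>)) * ?I ?a1 ?a2"
  proof -
    \<comment> \<open>The top side, traversed backwards, is the bottom side shifted by \<open>2\<pi>i\<close>.\<close>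
    have "(f has_contour_integral ?I ?a1 ?a2) (linepath ?a1 ?a2)" using ints(1) by (rule has_contour_integral_integral)
    then have "((\<lambda>x. f (linepath ?a1 ?a2 x) * (?a2 - ?a1)) has_integral ?I ?a1 ?a2) {0..1}"
      unfolding has_contour_integral_linepath .
    then have "((\<lambda>x. of_real (exp (- 2 * pi * \<xi>)) * (f (linepath ?a1 ?a2 x) * (?a2 - ?a1))) has_integral of_real (exp (- 2 * pi * \<xi>)) * ?I ?a1 ?a2) {0..1}"
      by (rule has_integral_mult_right)
    moreover have "of_real (exp (- 2 * pi * \<xi>)) * (f (linepath ?a1 ?a2 x) * (?a2 - ?a1)) = f (linepath ?a4 ?a3 x) * (?a3 - ?a4)" for x
    proof -
      have "linepath ?a4 ?a3 x = linepath ?a1 ?a2 x + of_real (2 * pi) * \<i>"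
        by (simp add: linepath_def complex_eq_iff algebra_simps)
      moreover have "?a3 - ?a4 = ?a2 - ?a1" by (simp add: complex_eq_iff)
      ultimately show ?thesis by (simp only: period mult.assoc)
    qed
    ultimately have "(f has_contour_integral (of_real (exp (- 2 * pi * \<xi>)) * ?I ?a1 ?a2)) (linepath ?a4 ?a3)"
      unfolding has_contour_integral_linepath by simp
    then have "?I ?a4 ?a3 = of_real (exp (- 2 * pi * \<xi>)) * ?I ?a1 ?a2" by (rule contour_integral_unique)
    moreover have "?I ?a3 ?a4 = - ?I ?a4 ?a3"
      using contour_integral_reverse_linepath[of ?a4 ?a3 f] contour_integral_reverse_linepath[of ?a3 ?a4 f] continuous_on_subset[OF cont seg(3)] by (simp add: closed_segment_commute)
    ultimately show ?thesis by (simp only: mult_minus_left)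
  qed
  have bottom: "?I ?a1 ?a2 = integral {- R..R} (\<lambda>t. cis (\<xi> * t) / of_real (cosh t + cos \<omega>))"
  proof -
    have "?I ?a1 ?a2 = integral {Re ?a1..Re ?a2} (\<lambda>x. f (of_real x))"
      by (rule contour_integral_linepath_Reals_eq) (use R in \<open>auto simp: complex_is_Real_iff\<close>)
    moreover have "cosh (complex_of_real t) = of_real (cosh t)" for t by (simp add: cosh_field_def exp_of_real[symmetric])
    then have "f (of_real t) = cis (\<xi> * t) / of_real (cosh t + cos \<omega>)" for t
      unfolding f_def cosh_conv_cos[symmetric] by (simp add: cis_conv_exp mult_ac)
    ultimately show ?thesis by simp
  qed
  have side: "norm (f z) \<le> 1 / (sinh R - 1)" if "\<bar>Re z\<bar> = R" "Im z \<ge> 0" for z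
  proof -
    have "norm (exp (\<i> * of_real \<xi> * z)) \<le> 1" using xi that by simp
    moreover have "norm (cos (\<i> * z) + of_real (cos \<omega>)) \<ge> sinh R - 1"
    proof -
      have "\<bar>sinh (Re z)\<bar> = sinh R" using that(1) R by (auto simp: abs_if split: if_splits)
      then have "norm (cos (\<i> * z)) \<ge> sinh R" using norm_cos_imaginary_ge[of z] by simp
      moreover have "norm (complex_of_real (cos \<omega>)) \<le> 1" by simp
      moreover have "norm (cos (\<i> * z)) \<le> norm (cos (\<i> * z) + of_real (cos \<omega>)) + norm (complex_of_real (cos \<omega>))"
        using norm_triangle_ineq4[of "cos (\<i> * z) + of_real (cos \<omega>)" "of_real (cos \<omega>)"] by simp
      ultimately show ?thesis by linarith
    qed
    ultimately show ?thesis unfolding f_def norm_divide using R by (intro frac_le) auto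
  qed
  have s2: "norm (?I ?a2 ?a3) \<le> 1 / (sinh R - 1) * norm (?a3 - ?a2)"
  proof (rule contour_integral_bound_linepath[OF ints(2)])
    show "norm (f z) \<le> 1 / (sinh R - 1)" if "z \<in> closed_segment ?a2 ?a3" for z
      using that R pi_gt_zero by (intro side) (auto simp: closed_segment_same_Re closed_segment_eq_real_ivl split: if_splits)
  qed (use R in simp)
  have s4: "norm (?I ?a4 ?a1) \<le> 1 / (sinh R - 1) * norm (?a1 - ?a4)"
  proof (rule contour_integral_bound_linepath[OF ints(4)])
    show "norm (f z) \<le> 1 / (sinh R - 1)" if "z \<in> closed_segment ?a4 ?a1" for z
      using that R pi_gt_zero by (intro side) (auto simp: closed_segment_same_Re closed_segment_eq_real_ivl split: if_splits)
  qed (use R in simp)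
  have "?a3 - ?a2 = \<i> * of_real (2 * pi)" "?a1 - ?a4 = - (\<i> * of_real (2 * pi))" by (simp_all add: complex_eq_iff)
  then have len: "norm (?a3 - ?a2) = 2 * pi" "norm (?a1 - ?a4) = 2 * pi"
    by (simp_all only: norm_minus_cancel norm_mult norm_ii norm_of_real) simp_all
  let ?J = "integral {- R..R} (\<lambda>t. cis (\<xi> * t) / of_real (cosh t + cos \<omega>))"
  have "of_real (1 - exp (- 2 * pi * \<xi>)) * ?J - of_real (2 * pi / sin \<omega> * (exp (- \<xi> * (pi - \<omega>)) - exp (- \<xi> * (pi + \<omega>))))
      = - (?I ?a2 ?a3 + ?I ?a4 ?a1)"
    unfolding res(1)[symmetric] sum top unfolding bottom by (simp add: algebra_simps)
  then have "norm (of_real (1 - exp (- 2 * pi * \<xi>)) * ?J - of_real (2 * pi / sin \<omega> * (exp (- \<xi> * (pi - \<omega>)) - exp (- \<xi> * (pi + \<omega>)))))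
     \<le> norm (?I ?a2 ?a3) + norm (?I ?a4 ?a1)"
    by (simp only: norm_minus_cancel norm_triangle_ineq)
  also have "\<dots> \<le> 1 / (sinh R - 1) * (2 * pi) + 1 / (sinh R - 1) * (2 * pi)"
    using s2 s4 unfolding len by (rule add_mono)
  finally show ?thesis by simp
qed

text \<open>Let the rectangle grow: the vertical sides contribute nothing in the limit.\<close>

lemma strip_kernel_fourier:
  fixes \<omega> \<xi> :: real
  assumes w: "0 < \<omega>" "\<omega> < pi" and xi: "\<xi> > 0"
  shows "(LINT t|lborel. cis (\<xi> * t) / of_real (cosh t + cos \<omega>)) = of_real (2 * pi * sinh (\<xi> * \<omega>) / (sin \<omega> * sinh (pi * \<xi>)))"
proof -
  let ?h = "\<lambda>t. cis (\<xi> * t) / complex_of_real (cosh t + cos \<omega>)"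
  note k = cosh_kernel_integrable[OF less_imp_le[OF w(1)] w(2)]
  have h: "integrable lborel ?h"
    by (rule Bochner_Integration.integrable_bound[OF k(1)]) (auto simp: norm_divide simp del: of_real_add)
  let ?I = "LINT t|lborel. ?h t"
  have J: "integral {- real n..real n} ?h = (LINT t|lborel. indicator {- real n..real n} t *\<^sub>R ?h t)" for n
  proof -
    have "set_integrable lborel {- real n..real n} ?h" unfolding set_integrable_def by (rule integrable_mult_indicator[OF _ h]) auto
    from set_borel_integral_eq_integral(2)[OF this] show ?thesis unfolding set_lebesgue_integral_def by simp
  qed
  have lim: "(\<lambda>n. integral {- real n..real n} ?h) \<longlonglongrightarrow> ?I"
    unfolding J
  proof (rule integral_dominated_convergence[where w="\<lambda>t. norm (?h t)"])
    show "AE t in lborel. (\<lambda>n. indicator {- real n..real n} t *\<^sub>R ?h t) \<longlonglongrightarrow> ?h t"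
    proof (rule AE_I2)
      fix t :: real
      obtain N :: nat where N: "\<bar>t\<bar> < real N" using reals_Archimedean2 by blast
      show "(\<lambda>n. indicator {- real n..real n} t *\<^sub>R ?h t) \<longlonglongrightarrow> ?h t"
        by (rule tendsto_eventually, rule eventually_sequentiallyI[of N]) (use N in \<open>auto simp: indicator_def\<close>)
    qed
  qed (use h in \<open>auto simp: indicator_def\<close>)
  let ?C = "of_real (2 * pi / sin \<omega> * (exp (- \<xi> * (pi - \<omega>)) - exp (- \<xi> * (pi + \<omega>)))) :: complex"
  have "(\<lambda>n. of_real (1 - exp (- 2 * pi * \<xi>)) * integral {- real n..real n} ?h - ?C) \<longlonglongrightarrow> 0"
  proof (rule Lim_null_comparison)
    have sinh_top: "filterlim (\<lambda>n. sinh (real n)) at_top sequentially"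
      by (rule filterlim_compose[OF sinh_real_at_top filterlim_real_sequentially])
    show "\<forall>\<^sub>F n in sequentially. norm (of_real (1 - exp (- 2 * pi * \<xi>)) * integral {- real n..real n} ?h - ?C) \<le> 4 * pi / (sinh (real n) - 1)"
      using filterlim_at_top_dense[THEN iffD1, OF sinh_top, rule_format, of 1] eventually_gt_at_top[of 0]
      by eventually_elim (intro rectangle_contour w xi, auto)
    show "(\<lambda>n. 4 * pi / (sinh (real n) - 1)) \<longlonglongrightarrow> 0"
      by (rule tendsto_divide_0[OF tendsto_const], rule filterlim_at_top_imp_at_infinity)
        (use filterlim_tendsto_add_at_top[OF tendsto_const[of "-1"] sinh_top] in simp)
  qed
  moreover have "(\<lambda>n. of_real (1 - exp (- 2 * pi * \<xi>)) * integral {- real n..real n} ?h - ?C) \<longlonglongrightarrow> of_real (1 - exp (- 2 * pi * \<xi>)) * ?I - ?C"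
    by (intro tendsto_intros lim)
  ultimately have eq: "of_real (1 - exp (- 2 * pi * \<xi>)) * ?I = ?C"
    using LIMSEQ_unique by fastforce
  \<comment> \<open>A common factor \<open>2 exp (- \<pi>\<xi>)\<close> cancels.\<close>
  have e: "1 - exp (- 2 * pi * \<xi>) = 2 * exp (- pi * \<xi>) * sinh (pi * \<xi>)"
    unfolding sinh_field_def by (simp add: algebra_simps exp_add[symmetric])
  have e2: "exp (- \<xi> * (pi - \<omega>)) - exp (- \<xi> * (pi + \<omega>)) = 2 * exp (- pi * \<xi>) * sinh (\<xi> * \<omega>)"
    unfolding sinh_field_def by (simp add: algebra_simps exp_add[symmetric])
  have pos: "sinh (pi * \<xi>) > 0" "sin \<omega> > 0" using xi w by (auto intro: sin_gt_zero)
  have ne: "complex_of_real (2 * exp (- pi * \<xi>) * sinh (pi * \<xi>)) \<noteq> 0" using xi by simp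
  have "of_real (2 * exp (- pi * \<xi>) * sinh (pi * \<xi>)) * ?I = of_real (2 * exp (- pi * \<xi>) * sinh (pi * \<xi>)) * of_real (2 * pi * sinh (\<xi> * \<omega>) / (sin \<omega> * sinh (pi * \<xi>)))"
    unfolding eq[unfolded e e2] of_real_mult[symmetric] of_real_eq_iff using pos xi by simp
  then show ?thesis using ne mult_left_cancel by blast
qed

definition sinhc :: "real \<Rightarrow> real" where
  "sinhc x = (if x = 0 then 1 else sinh x / x)"

lemma sinhc_minus [simp]: "sinhc (- x) = sinhc x"
  by (simp add: sinhc_def)

lemma sinhc_pos: "sinhc x > 0"
  by (cases x "0::real" rule: linorder_cases) (auto simp: sinhc_def zero_less_divide_iff)

lemma isCont_sinhc: "isCont sinhc x"
proof (cases "x = 0")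
  case True
  have "(sinh has_field_derivative cosh 0) (at (0::real))" by (auto intro!: derivative_eq_intros)
  then have "((\<lambda>h. sinh h / h) \<longlongrightarrow> (1::real)) (at 0)" by (simp add: DERIV_def)
  moreover have "\<forall>\<^sub>F h in at (0::real). sinhc h = sinh h / h" by (simp add: eventually_at_filter sinhc_def)
  ultimately have "(sinhc \<longlongrightarrow> 1) (at 0)" by (simp add: tendsto_cong)
  then show ?thesis unfolding True isCont_def by (simp add: sinhc_def)
next
  case False
  have "isCont (\<lambda>x. sinh x / x) x" using False by (intro continuous_intros) auto
  moreover have "\<forall>\<^sub>F h in nhds x. sinh h / h = sinhc h"
    using t1_space_nhds[OF False] by eventually_elim (simp add: sinhc_def)
  ultimately show ?thesis by (subst isCont_cong[symmetric])
qed

text \<open>Up to constants, the Poisson kernel of a strip.\<close>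

definition strip_kernel :: "real \<Rightarrow> real \<Rightarrow> real" where
  "strip_kernel \<omega> t = sinc \<omega> / (cosh t + cos \<omega>)"

lemma strip_kernel_integrable:
  assumes w: "0 \<le> \<omega>" "\<omega> < pi" shows "integrable lborel (strip_kernel \<omega>)"
  using integrable_mult_right[OF cosh_kernel_integrable(1)[OF w], of "sinc \<omega>"]
  by (simp add: strip_kernel_def[abs_def])

lemma fourier_strip_kernel_pos:
  assumes w: "0 < \<omega>" "\<omega> < pi" and xi: "\<xi> > 0"
  shows "(LINT t|lborel. cis (\<xi> * t) * of_real (strip_kernel \<omega> t)) = of_real (2 * sinhc (\<xi> * \<omega>) / sinhc (pi * \<xi>))"
proof -
  have "(LINT t|lborel. cis (\<xi> * t) * of_real (strip_kernel \<omega> t)) = (LINT t|lborel. of_real (sinc \<omega>) * (cis (\<xi> * t) / of_real (cosh t + cos \<omega>)))"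
    by (intro Bochner_Integration.integral_cong refl) (simp add: strip_kernel_def mult_ac)
  also have "\<dots> = of_real (sinc \<omega>) * of_real (2 * pi * sinh (\<xi> * \<omega>) / (sin \<omega> * sinh (pi * \<xi>)))"
    unfolding integral_mult_right_zero strip_kernel_fourier[OF assms] ..
  also have "\<dots> = of_real (2 * sinhc (\<xi> * \<omega>) / sinhc (pi * \<xi>))"
    using assms sin_gt_zero[OF w] unfolding of_real_mult[symmetric] of_real_eq_iff by (simp add: sinhc_def field_simps)
  finally show ?thesis .
qed

text \<open>Both sides are continuous in \<open>\<xi>\<close>, which settles \<open>\<xi> = 0\<close>.\<close>

lemma fourier_strip_kernel_nonneg:
  assumes w: "0 < \<omega>" "\<omega> < pi" and xi: "\<xi> \<ge> 0"
  shows "(LINT t|lborel. cis (\<xi> * t) * of_real (strip_kernel \<omega> t)) = of_real (2 * sinhc (\<xi> * \<omega>) / sinhc (pi * \<xi>))"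
proof (cases "\<xi> = 0")
  case True
  let ?F = "\<lambda>\<xi>. LINT t|lborel. cis (\<xi> * t) * of_real (strip_kernel \<omega> t)"
  define s where "s n = 1 / real (Suc n)" for n
  have s: "s \<longlonglongrightarrow> 0" unfolding s_def by (rule LIMSEQ_Suc[OF lim_1_over_n])
  have i: "integrable lborel (\<lambda>t. complex_of_real (strip_kernel \<omega> t))" using strip_kernel_integrable[of \<omega>] w by simp
  have F: "?F = (\<lambda>\<xi>. FT lborel (\<lambda>t. complex_of_real (strip_kernel \<omega> t)) (- \<xi> / (2 * pi)))" by (simp add: FT_def fun_eq_iff)
  have "continuous_on UNIV ?F" unfolding F
    by (rule continuous_on_compose2[OF FT_continuous[OF _ i]]) (auto intro!: continuous_intros)
  then have c: "isCont ?F 0" using continuous_on_eq_continuous_at[OF open_UNIV] by blast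
  have A: "(\<lambda>n. ?F (s n)) \<longlonglongrightarrow> ?F 0" by (rule isCont_tendsto_compose[OF c s])
  have e: "?F (s n) = of_real (2 * sinhc (s n * \<omega>) / sinhc (pi * s n))" for n
    by (rule fourier_strip_kernel_pos[OF w]) (simp add: s_def)
  have B: "(\<lambda>n. complex_of_real (2 * sinhc (s n * \<omega>) / sinhc (pi * s n))) \<longlonglongrightarrow> of_real (2 * sinhc (0 * \<omega>) / sinhc (pi * 0))"
    using sinhc_pos[of 0] by (intro tendsto_intros isCont_tendsto_compose[OF isCont_sinhc] s) auto
  show ?thesis unfolding True by (rule LIMSEQ_unique[OF A[unfolded e] B])
qed (use fourier_strip_kernel_pos[OF w] xi in simp)

lemma fourier_strip_kernel_interior:
  assumes w: "0 < \<omega>" "\<omega> < pi"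
  shows "(LINT t|lborel. cis (\<xi> * t) * of_real (strip_kernel \<omega> t)) = of_real (2 * sinhc (\<xi> * \<omega>) / sinhc (pi * \<xi>))"
proof (cases "\<xi> \<ge> 0")
  case False
  have "(LINT t|lborel. cis (\<xi> * t) * of_real (strip_kernel \<omega> t)) = (LINT t|lborel. cis (- \<xi> * t) * of_real (strip_kernel \<omega> t))"
    by (subst lborel_integral_real_affine[of "-1" _ 0]) (auto simp: strip_kernel_def)
  also have "\<dots> = of_real (2 * sinhc (- \<xi> * \<omega>) / sinhc (pi * - \<xi>))"
    by (rule fourier_strip_kernel_nonneg[OF w]) (use False in simp)
  finally show ?thesis by simp
qed (rule fourier_strip_kernel_nonneg[OF w])

text \<open>The residue computation divides by \<open>sin \<omega>\<close>; the case \<open>\<omega> = 0\<close>, which belongs to the eigenvalue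
  \<open>- 2\<close>, is the limit \<open>\<omega> \<rightarrow> 0\<close>.\<close>

lemma fourier_strip_kernel:
  assumes w: "0 \<le> \<omega>" "\<omega> < pi"
  shows "(LINT t|lborel. cis (\<xi> * t) * of_real (strip_kernel \<omega> t)) = of_real (2 * sinhc (\<xi> * \<omega>) / sinhc (pi * \<xi>))"
proof (cases "\<omega> = 0")
  case True
  define s where "s n = 1 / real (Suc n)" for n
  have s: "s \<longlonglongrightarrow> 0" unfolding s_def by (rule LIMSEQ_Suc[OF lim_1_over_n])
  have s01: "0 < s n" "s n \<le> 1" for n by (auto simp: s_def)
  have spi: "s n < pi" "s n \<le> pi / 2" for n using s01(2)[of n] pi_gt3 by linarith+
  have [measurable]: "strip_kernel \<theta> \<in> borel_measurable borel" for \<theta>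
    unfolding strip_kernel_def[abs_def] by measurable
  have A: "(\<lambda>n. LINT t|lborel. cis (\<xi> * t) * complex_of_real (strip_kernel (s n) t)) \<longlonglongrightarrow> (LINT t|lborel. cis (\<xi> * t) * of_real (strip_kernel 0 t))"
  proof (rule integral_dominated_convergence[where w="\<lambda>t. 2 * (1 / (cosh t + cos 0))"])
    show "integrable lborel (\<lambda>t::real. 2 * (1 / (cosh t + cos 0)))"
      by (intro integrable_mult_right cosh_kernel_integrable) auto
    show "AE t in lborel. (\<lambda>n. cis (\<xi> * t) * complex_of_real (strip_kernel (s n) t)) \<longlonglongrightarrow> cis (\<xi> * t) * of_real (strip_kernel 0 t)"
    proof (rule AE_I2)
      fix t :: real
      have "cosh t + cos 0 \<noteq> 0" using cosh_real_ge_1[of t] by simp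
      then show "(\<lambda>n. cis (\<xi> * t) * complex_of_real (strip_kernel (s n) t)) \<longlonglongrightarrow> cis (\<xi> * t) * of_real (strip_kernel 0 t)"
        unfolding strip_kernel_def by (intro tendsto_intros isCont_tendsto_compose[OF isCont_sinc s] s)
    qed
    show "AE t in lborel. norm (cis (\<xi> * t) * complex_of_real (strip_kernel (s n) t)) \<le> 2 * (1 / (cosh t + cos 0))" for n
    proof (rule AE_I2)
      fix t :: real
      have c: "cos (s n) \<ge> 0" using s01[of n] spi[of n] by (intro cos_ge_zero) auto
      have "sin (s n) \<le> s n" using s01[of n] by (intro sin_x_le_x) auto
      moreover have "sin (s n) \<ge> 0" using s01[of n] spi[of n] by (intro sin_ge_zero) auto
      ultimately have "0 \<le> sinc (s n)" "sinc (s n) \<le> 1" using s01[of n] by auto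
      moreover have den1: "0 < (cosh t + 1) / 2" using cosh_real_ge_1[of t] by simp
      moreover have den2: "(cosh t + 1) / 2 \<le> cosh t + cos (s n)" using c cosh_real_ge_1[of t] by (simp add: field_simps)
      ultimately have "strip_kernel (s n) t \<le> 1 / ((cosh t + 1) / 2)"
        unfolding strip_kernel_def by (intro frac_le) (assumption | simp only: zero_le_one)+
      moreover have "strip_kernel (s n) t \<ge> 0"
        unfolding strip_kernel_def using \<open>0 \<le> sinc (s n)\<close> den1 den2 by (intro divide_nonneg_nonneg) auto
      ultimately have "strip_kernel (s n) t \<le> 1 / ((cosh t + 1) / 2)" "strip_kernel (s n) t \<ge> 0" by auto
      then show "norm (cis (\<xi> * t) * complex_of_real (strip_kernel (s n) t)) \<le> 2 * (1 / (cosh t + cos 0))"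
        by (simp add: norm_mult)
    qed
  qed measurable
  have e: "(LINT t|lborel. cis (\<xi> * t) * complex_of_real (strip_kernel (s n) t)) = of_real (2 * sinhc (\<xi> * s n) / sinhc (pi * \<xi>))" for n
    by (rule fourier_strip_kernel_interior[OF s01(1) spi(1)])
  have B: "(\<lambda>n. complex_of_real (2 * sinhc (\<xi> * s n) / sinhc (pi * \<xi>))) \<longlonglongrightarrow> of_real (2 * sinhc (\<xi> * 0) / sinhc (pi * \<xi>))"
    using sinhc_pos[of "pi * \<xi>"] by (intro tendsto_intros isCont_tendsto_compose[OF isCont_sinhc] s) auto
  show ?thesis unfolding True by (rule LIMSEQ_unique[OF A[unfolded e] B])
qed (use fourier_strip_kernel_interior w in simp)

text \<open>The resolvent \<open>(W\<^sub>0(b) - \<lambda>)^(-1)\<close> at \<open>\<lambda> = - 2 cos \<omega>\<close> in Fourier space, times the weight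
  \<open>sin \<omega> / \<omega>\<close> of this eigenvalue.\<close>

definition rho :: "real \<Rightarrow> real \<Rightarrow> real \<Rightarrow> real" where
  "rho b \<omega> k = sinc \<omega> / (symb b k + 2 * cos \<omega>)"

lemma sinc_nonneg: "0 \<le> \<omega> \<Longrightarrow> \<omega> \<le> pi \<Longrightarrow> sinc \<omega> \<ge> 0"
  by (auto intro!: divide_nonneg_nonneg sin_ge_zero)

text \<open>The substitution \<open>t = 2\<pi>bk\<close> reduces the transform to the kernel of the strip. At \<open>x = 0\<close> it
  equals \<open>1 / (2\<pi>b)\<close> for every \<open>\<omega>\<close>: the weight \<open>sin \<omega> / \<omega>\<close> is the one that makes the mass of the
  kernel independent of \<open>\<omega>\<close>, and this mass is the constant in the final inequality.\<close>

lemma rho_props: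
  assumes b: "b > 0" and w: "0 \<le> \<omega>" "\<omega> < pi"
  shows rho_nonneg: "rho b \<omega> k \<ge> 0" and rho_integrable: "integrable lborel (rho b \<omega>)"
    and FT_rho: "FT lborel (\<lambda>k. of_real (rho b \<omega> k)) x = of_real (1 / (2 * pi * b) * (sinhc (\<omega> * x / b) / sinhc (pi * x / b)))"
    and rho_integral: "(LINT k|lborel. rho b \<omega> k) = 1 / (2 * pi * b)"
proof -
  show "rho b \<omega> k \<ge> 0" unfolding rho_def
    using sinc_nonneg[OF w(1)] w(2) symb_plus_cos_pos[OF w, of b k] by (intro divide_nonneg_nonneg) auto
  show int: "integrable lborel (rho b \<omega>)"
    using integrable_mult_right[OF symb_integrable[OF b w], of "sinc \<omega>"] by (simp add: rho_def[abs_def])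
  define c where "c = 2 * pi * b"
  have c: "c > 0" using b by (simp add: c_def)
  have rho_eq: "rho b \<omega> k = strip_kernel \<omega> (0 + c * k) / 2" for k
  proof -
    have "symb b k + 2 * cos \<omega> = 2 * (cosh (0 + c * k) + cos \<omega>)" by (simp add: symb_def c_def)
    then show ?thesis unfolding rho_def strip_kernel_def by simp
  qed
  show FT: "FT lborel (\<lambda>k. of_real (rho b \<omega> k)) x = of_real (1 / (2 * pi * b) * (sinhc (\<omega> * x / b) / sinhc (pi * x / b)))" for x
  proof -
    have "of_real (2 * sinhc (- (x / b) * \<omega>) / sinhc (pi * - (x / b))) = (LINT t|lborel. cis (- (x / b) * t) * complex_of_real (strip_kernel \<omega> t))"
      by (rule fourier_strip_kernel[OF w, symmetric])
    also have "\<dots> = c *\<^sub>R (LINT k|lborel. cis (- (x / b) * (0 + c * k)) * complex_of_real (strip_kernel \<omega> (0 + c * k)))"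
      using c by (subst lborel_integral_real_affine[of c _ 0]) auto
    also have "\<dots> = c *\<^sub>R (LINT k|lborel. 2 * (cis (- (2 * pi * x * k)) * complex_of_real (rho b \<omega> k)))"
      unfolding rho_eq using b by (simp add: c_def mult_ac)
    also have "\<dots> = c *\<^sub>R (2 * FT lborel (\<lambda>k. of_real (rho b \<omega> k)) x)"
      unfolding FT_def integral_mult_right_zero ..
    finally have "complex_of_real (2 * sinhc (- (x / b) * \<omega>) / sinhc (pi * - (x / b))) = of_real (2 * c) * FT lborel (\<lambda>k. of_real (rho b \<omega> k)) x"
      by (simp add: scaleR_conv_of_real)
    then have "of_real (2 * sinhc (- (x / b) * \<omega>) / sinhc (pi * - (x / b))) / complex_of_real (2 * c) = FT lborel (\<lambda>k. of_real (rho b \<omega> k)) x"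
      using c by simp
    then have "FT lborel (\<lambda>k. of_real (rho b \<omega> k)) x = of_real (2 * sinhc (- (x / b) * \<omega>) / sinhc (pi * - (x / b)) / (2 * c))"
      by (simp only: of_real_divide)
    moreover have "sinhc (- (x / b) * \<omega>) = sinhc (\<omega> * x / b)" "sinhc (pi * - (x / b)) = sinhc (pi * x / b)"
      using sinhc_minus[of "x / b * \<omega>"] by (simp_all add: mult.commute)
    ultimately show ?thesis by (simp add: c_def)
  qed
  have "complex_of_real (LINT k|lborel. rho b \<omega> k) = FT lborel (\<lambda>k. of_real (rho b \<omega> k)) 0"
    unfolding FT_def by simp
  also have "\<dots> = of_real (1 / (2 * pi * b))" unfolding FT by (simp add: sinhc_def)
  finally show "(LINT k|lborel. rho b \<omega> k) = 1 / (2 * pi * b)" unfolding of_real_eq_iff .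
qed

section \<open>The weighted Birman--Schwinger form\<close>

lemma finite_borel_sigma_finite: "finite_measure M \<Longrightarrow> sigma_finite_measure M"
  by (simp add: finite_measure.axioms(1) finite_measure_def)

lemma Lsq_finite_bounded:
  assumes M: "finite_measure M" and [measurable]: "f \<in> borel_measurable M" and bd: "\<And>x. norm (f x) \<le> B"
  shows "f \<in> Lsq M"
proof (rule LsqI)
  show "integrable M (\<lambda>x. (norm (f x))\<^sup>2)"
    using bd by (intro finite_measure.integrable_const_bound[OF M, of _ "B\<^sup>2"]) (auto intro!: AE_I2 power_mono)
qed measurable

lemma Lsq_finite_L1:
  assumes M: "finite_measure M" and f: "f \<in> Lsq M" shows "integrable M f"
proof -
  have "(\<lambda>_. 1) \<in> Lsq M" by (rule Lsq_finite_bounded[OF M, of _ 1]) auto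
  from integrable_mult[OF this f] show ?thesis by simp
qed

lemma iFT_Lsq:
  assumes M: "finite_measure M" and sM: "sets M = sets borel" and h: "integrable lborel h"
  shows "iFT h \<in> Lsq M"
proof (rule Lsq_finite_bounded[OF M _ norm_iFT_le])
  show "iFT h \<in> borel_measurable M" using iFT_measurable[OF h] sM by (simp cong: measurable_cong_sets)
qed

text \<open>The inverse Fourier integral from \<open>L\<^sup>2(\<real>)\<close> into \<open>L\<^sup>2(M)\<close> and the transform \<open>u \<mapsto> (u M)^\<close> are
  adjoint to each other.\<close>

lemma iFT_pairing:
  assumes M: "finite_measure M" and sM: "sets M = sets borel" and h: "integrable lborel h" and u: "integrable M u"
  shows "ip M (iFT h) u = ip lborel h (FT M u)"
proof -
  note sf = finite_borel_sigma_finite[OF M]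
  interpret M: sigma_finite_measure M by fact
  interpret pair_sigma_finite M lborel ..
  note sM[measurable_cong]
  have [measurable]: "u \<in> borel_measurable borel" using u sM by (simp add: borel_measurable_integrable cong: measurable_cong_sets)
  have int: "integrable (M \<Otimes>\<^sub>M lborel) (\<lambda>(x, k). cis (- (2 * pi * snd (x, k) * fst (x, k))) * (u x * cnj (h k)))"
    by (rule integrable_pair_bounded_mult[OF sf lborel.sigma_finite_measure_axioms u, where B=1 and u="\<lambda>p. cis (- (2 * pi * snd p * fst p))"])
      (use h in auto)
  have "ip M (iFT h) u = (LINT x|M. LINT k|lborel. cis (- (2 * pi * k * x)) * (u x * cnj (h k)))"
  proof -
    have "cnj (iFT h x) * u x = (LINT k|lborel. cis (- (2 * pi * k * x)) * (u x * cnj (h k)))" for x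
    proof -
      have "cnj (iFT h x) = (LINT k|lborel. cis (- (2 * pi * k * x)) * cnj (h k))"
        unfolding iFT_def FT_def by (subst Bochner_Integration.integral_cnj[symmetric]) (simp add: cis_cnj mult_ac)
      then show ?thesis by (simp add: integral_mult_left_zero[symmetric] mult_ac del: integral_mult_left_zero)
    qed
    then show ?thesis unfolding ip_def by simp
  qed
  also have "\<dots> = (LINT k|lborel. LINT x|M. cis (- (2 * pi * k * x)) * (u x * cnj (h k)))"
    using Fubini_integral[OF int] by simp
  also have "\<dots> = ip lborel h (FT M u)"
    unfolding ip_def FT_def integral_mult_right_zero[symmetric] by (simp only: mult_ac)
  finally show ?thesis .
qed

text \<open>The quadratic form of the weighted Birman--Schwinger operator on \<open>L\<^sup>2(M)\<close>.\<close>

definition qrho :: "real \<Rightarrow> real measure \<Rightarrow> real \<Rightarrow> (real \<Rightarrow> complex) \<Rightarrow> real" where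
  "qrho b M \<omega> u = (LINT k|lborel. rho b \<omega> k * (norm (FT M u k))\<^sup>2)"

lemma FT_measurable_finite:
  assumes M: "finite_measure M" and sM: "sets M = sets borel" and u: "integrable M u"
  shows "FT M u \<in> borel_measurable borel"
  using FT_measurable[OF finite_borel_sigma_finite[OF M] sM, of u] u sM
  by (simp add: borel_measurable_integrable cong: measurable_cong_sets)

lemma qrho_integrable:
  assumes b: "b > 0" and w: "0 \<le> \<omega>" "\<omega> < pi" and M: "finite_measure M" and sM: "sets M = sets borel" and u: "integrable M u"
  shows "integrable lborel (\<lambda>k. rho b \<omega> k * (norm (FT M u k))\<^sup>2)"
    "qrho b M \<omega> u \<le> (LINT x|M. norm (u x))\<^sup>2 / (2 * pi * b)" "qrho b M \<omega> u \<ge> 0"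
proof -
  note [measurable] = FT_measurable_finite[OF M sM u] borel_measurable_integrable[OF rho_integrable[OF b w]]
  let ?B = "(LINT x|M. norm (u x))\<^sup>2"
  have le: "rho b \<omega> k * (norm (FT M u k))\<^sup>2 \<le> rho b \<omega> k * ?B" for k
    by (intro mult_left_mono power_mono norm_FT_le sM rho_nonneg b w) auto
  have i: "integrable lborel (\<lambda>k. rho b \<omega> k * ?B)" using rho_integrable[OF b w] by simp
  show 1: "integrable lborel (\<lambda>k. rho b \<omega> k * (norm (FT M u k))\<^sup>2)"
    by (rule Bochner_Integration.integrable_bound[OF i]) (use le rho_nonneg[OF b w] in auto)
  have "qrho b M \<omega> u \<le> (LINT k|lborel. rho b \<omega> k * ?B)"
    unfolding qrho_def by (rule integral_mono[OF 1 i]) (rule le)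
  also have "\<dots> = ?B / (2 * pi * b)" using rho_integral[OF b w] by simp
  finally show "qrho b M \<omega> u \<le> ?B / (2 * pi * b)" .
  show "qrho b M \<omega> u \<ge> 0" unfolding qrho_def using rho_nonneg[OF b w] by (intro integral_nonneg_AE) auto
qed

lemma qrho_double_integral:
  assumes b: "b > 0" and w: "0 \<le> \<omega>" "\<omega> < pi" and M: "finite_measure M" and sM: "sets M = sets borel" and u: "integrable M u"
  shows "of_real (qrho b M \<omega> u) = (LINT x|M. LINT y|M. FT lborel (\<lambda>k. of_real (rho b \<omega> k)) (x - y) * (u x * cnj (u y)))"
proof -
  have i: "integrable lborel (\<lambda>k. complex_of_real (rho b \<omega> k))" using rho_integrable[OF b w] by simp
  have "complex_of_real (qrho b M \<omega> u) = (LINT k|lborel. of_real (rho b \<omega> k) * (cnj (FT M u k) * FT M u k))"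
    unfolding qrho_def integral_complex_of_real[symmetric] 
    by (simp add: complex_norm_square mult.commute del: of_real_power)
  then show ?thesis unfolding FT_weighted_form[OF finite_borel_sigma_finite[OF M] sM u u i] .
qed

text \<open>Pointwise in \<open>k\<close>, the transforms of the \<open>f\<^sub>i\<close> are their inner products with the character
  \<open>exp(2\<pi>ikx)\<close>, whose squared norm in \<open>L\<^sup>2(M)\<close> is the mass of \<open>M\<close>; so Bessel's inequality bounds the sum of
  their squares.\<close>

lemma qrho_trace_bound:
  fixes n :: nat
  assumes b: "b > 0" and w: "0 \<le> \<omega>" "\<omega> < pi" and M: "finite_measure M" and sM: "sets M = sets borel"
    and f: "\<And>i. i < n \<Longrightarrow> f i \<in> Lsq M" and orth: "\<And>i j. i < n \<Longrightarrow> j < n \<Longrightarrow> ip M (f i) (f j) = (if i = j then 1 else 0)"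
  shows "(\<Sum>i<n. qrho b M \<omega> (f i)) \<le> measure M UNIV / (2 * pi * b)"
proof -
  have sp: "space M = UNIV" using sets_eq_imp_space_eq[OF sM] by simp
  note sM[measurable_cong]
  have bes: "(\<Sum>i<n. (norm (FT M (f i) k))\<^sup>2) \<le> measure M UNIV" for k
  proof -
    define e where "e x = cis (2 * pi * k * x)" for x
    have e: "e \<in> Lsq M" unfolding e_def by (rule Lsq_finite_bounded[OF M, of _ 1]) auto
    have "norm (FT M (f i) k) = norm (ip M (f i) e)" for i
    proof -
      have "FT M (f i) k = ip M e (f i)" by (simp add: FT_def ip_def e_def cis_cnj)
      then show ?thesis by (subst ip_commute) simp
    qed
    then have "(\<Sum>i<n. (norm (FT M (f i) k))\<^sup>2) \<le> (nrm M e)\<^sup>2"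
      using bessel_inequality[OF f e orth] by simp
    also have "\<dots> = measure M UNIV" unfolding nrm_sq e_def by (simp add: sp)
    finally show ?thesis .
  qed
  note i = qrho_integrable(1)[OF b w M sM Lsq_finite_L1[OF M f]]
  have "(\<Sum>i<n. qrho b M \<omega> (f i)) = (LINT k|lborel. (\<Sum>i<n. rho b \<omega> k * (norm (FT M (f i) k))\<^sup>2))"
    unfolding qrho_def by (rule Bochner_Integration.integral_sum[symmetric]) (use i in auto)
  also have "\<dots> \<le> (LINT k|lborel. rho b \<omega> k * measure M UNIV)"
  proof (rule integral_mono)
    show "integrable lborel (\<lambda>k. \<Sum>i<n. rho b \<omega> k * (norm (FT M (f i) k))\<^sup>2)" by (intro Bochner_Integration.integrable_sum) (use i in auto)
    show "integrable lborel (\<lambda>k. rho b \<omega> k * measure M UNIV)" using rho_integrable[OF b w] by simp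
    show "(\<Sum>i<n. rho b \<omega> k * (norm (FT M (f i) k))\<^sup>2) \<le> rho b \<omega> k * measure M UNIV" for k
      unfolding sum_distrib_left[symmetric] by (intro mult_left_mono bes rho_nonneg b w)
  qed
  also have "\<dots> = measure M UNIV / (2 * pi * b)" using rho_integral[OF b w] by simp
  finally show ?thesis .
qed

text \<open>The quotient of the transforms at \<open>\<omega>\<close> and at \<open>\<omega>'\<close> is
  \<open>(sinh(\<omega>x/b) / \<omega>) / (sinh(\<omega>'x/b) / \<omega>')\<close>, the transform of a probability density \<open>p\<close>. Hence the
  sum at \<open>\<omega>\<close> is the average, with respect to \<open>p\<close>, of the sums at \<open>\<omega>'\<close> for the modulated functions, and
  some modulation reaches the average.\<close>

lemma sum_qrho_monotone:
  fixes n :: nat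
  assumes b: "b > 0" and w: "0 \<le> \<omega>" "\<omega> < \<omega>'" "\<omega>' < pi" and M: "finite_measure M" and sM: "sets M = sets borel"
    and f: "\<And>i. i < n \<Longrightarrow> f i \<in> Lsq M"
  shows "\<exists>\<kappa>. (\<Sum>i<n. qrho b M \<omega> (f i)) \<le> (\<Sum>i<n. qrho b M \<omega>' (\<lambda>x. cis (- (2 * pi * \<kappa> * x)) * f i x))"
proof -
  note sM[measurable_cong]
  \<comment> \<open>The density \<open>p\<close> is the kernel of the strip of width \<open>\<omega>'\<close>, rescaled to width \<open>\<pi>\<close>.\<close>
  define b' where "b' = b * pi / \<omega>'"
  define \<theta> where "\<theta> = \<omega> * pi / \<omega>'"
  have w': "0 < \<omega>'" "0 \<le> \<omega>'" "\<omega> < pi" using w by auto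
  have b': "b' > 0" using b w' by (simp add: b'_def)
  have th: "0 \<le> \<theta>" "\<theta> < pi" using w w' by (auto simp: \<theta>_def field_simps)
  define p where "p k = 2 * pi * b' * rho b' \<theta> k" for k
  have p: "integrable lborel p" "\<And>k. p k \<ge> 0" "(LINT k|lborel. p k) = 1"
    using rho_integrable[OF b' th] rho_nonneg[OF b' th] rho_integral[OF b' th] b' by (auto simp: p_def[abs_def])
  have pc: "integrable lborel (\<lambda>k. complex_of_real (p k))" using p by simp
  let ?r = "\<lambda>\<omega> k. complex_of_real (rho b \<omega> k)"
  have r: "integrable lborel (?r \<omega>')" using rho_integrable[OF b w'(2) w(3)] by simp
  have FTp: "FT lborel (\<lambda>k. of_real (p k)) x * FT lborel (?r \<omega>') x = FT lborel (?r \<omega>) x" for x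
  proof -
    have "FT lborel (\<lambda>k. of_real (p k)) x = of_real (2 * pi * b') * FT lborel (\<lambda>k. of_real (rho b' \<theta> k)) x"
      unfolding p_def of_real_mult FT_cmult[symmetric] by (simp add: mult.assoc)
    also have "\<dots> = of_real (sinhc (\<theta> * x / b') / sinhc (pi * x / b'))"
      unfolding FT_rho[OF b' th] of_real_mult[symmetric] using b' by simp
    also have "\<theta> * x / b' = \<omega> * x / b" using w' b by (simp add: \<theta>_def b'_def)
    also have "pi * x / b' = \<omega>' * x / b" using w' b by (simp add: b'_def)
    finally show ?thesis unfolding FT_rho[OF b w'(2) w(3)] FT_rho[OF b w(1) w'(3)] of_real_mult[symmetric] of_real_eq_iff
      using sinhc_pos[of "\<omega>' * x / b"] by simp
  qed
  define m where "m \<kappa> i x = cis (- (2 * pi * \<kappa> * x)) * f i x" for \<kappa> i x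
  have fi: "integrable M (f i)" if "i < n" for i using Lsq_finite_L1[OF M f[OF that]] .
  have mi: "integrable M (m \<kappa> i)" if "i < n" for i \<kappa>
    unfolding m_def using integrable_unimodular(2)[OF sM fi[OF that], of "2 * pi * \<kappa>"] .
  have nm: "(LINT x|M. norm (m \<kappa> i x)) = (LINT x|M. norm (f i x))" for \<kappa> i by (simp add: m_def norm_mult)
  have avg: "(LINT \<kappa>|lborel. p \<kappa> * qrho b M \<omega>' (m \<kappa> i)) = qrho b M \<omega> (f i)" 
    and int: "integrable lborel (\<lambda>\<kappa>. p \<kappa> * qrho b M \<omega>' (m \<kappa> i))" if i: "i < n" for i
  proof -
    have "complex_of_real (LINT \<kappa>|lborel. p \<kappa> * qrho b M \<omega>' (m \<kappa> i)) = (LINT \<kappa>|lborel. of_real (p \<kappa>) * of_real (qrho b M \<omega>' (m \<kappa> i)))"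
      unfolding integral_complex_of_real[symmetric] of_real_mult ..
    also have "\<dots> = (LINT \<kappa>|lborel. of_real (p \<kappa>) * (LINT x|M. LINT y|M. FT lborel (?r \<omega>') (x - y) * ((cis (- (2 * pi * \<kappa> * x)) * f i x) * cnj (cis (- (2 * pi * \<kappa> * y)) * f i y))))"
      unfolding qrho_double_integral[OF b w'(2) w(3) M sM mi[OF i]] m_def ..
    also have "\<dots> = (LINT x|M. LINT y|M. FT lborel (\<lambda>k. of_real (p k)) (x - y) * FT lborel (?r \<omega>') (x - y) * (f i x * cnj (f i y)))"
    proof (rule FT_difference_average[OF finite_borel_sigma_finite[OF M] sM fi[OF i] fi[OF i] pc])
      show "FT lborel (?r \<omega>') \<in> borel_measurable borel" by (intro borel_measurable_continuous_onI FT_continuous r) simp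
      show "norm (FT lborel (?r \<omega>') x) \<le> (LINT x|lborel. norm (?r \<omega>' x))" for x by (rule norm_FT_le) simp
    qed
    also have "\<dots> = of_real (qrho b M \<omega> (f i))"
      unfolding FTp qrho_double_integral[OF b w(1) w'(3) M sM fi[OF i]] ..
    finally show "(LINT \<kappa>|lborel. p \<kappa> * qrho b M \<omega>' (m \<kappa> i)) = qrho b M \<omega> (f i)" using of_real_eq_iff by blast
    have shift: "FT M (m \<kappa> i) k = FT M (f i) (k + \<kappa>)" for \<kappa> k
      unfolding FT_def m_def by (intro Bochner_Integration.integral_cong refl) (simp only: mult.assoc[symmetric] cis_mult, simp add: distrib_left distrib_right mult.assoc)
    note [measurable] = FT_measurable_finite[OF M sM fi[OF i]] borel_measurable_integrable[OF p(1)] borel_measurable_integrable[OF rho_integrable[OF b w'(2) w(3)]]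
    show "integrable lborel (\<lambda>\<kappa>. p \<kappa> * qrho b M \<omega>' (m \<kappa> i))"
    proof (rule Bochner_Integration.integrable_bound)
      show "integrable lborel (\<lambda>\<kappa>. p \<kappa> * ((LINT x|M. norm (f i x))\<^sup>2 / (2 * pi * b)))" using p(1) by simp
      show "(\<lambda>\<kappa>. p \<kappa> * qrho b M \<omega>' (m \<kappa> i)) \<in> borel_measurable lborel"
        unfolding qrho_def shift by measurable
      have "norm (p \<kappa> * qrho b M \<omega>' (m \<kappa> i)) \<le> norm (p \<kappa> * ((LINT x|M. norm (f i x))\<^sup>2 / (2 * pi * b)))" for \<kappa>
      proof -
        have q: "qrho b M \<omega>' (m \<kappa> i) \<le> (LINT x|M. norm (f i x))\<^sup>2 / (2 * pi * b)" "qrho b M \<omega>' (m \<kappa> i) \<ge> 0"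
          using qrho_integrable(2,3)[OF b w'(2) w(3) M sM mi[OF i], of \<kappa>] unfolding nm by auto
        show ?thesis unfolding norm_mult by (intro mult_left_mono) (use q in \<open>auto simp only: real_norm_def abs_of_nonneg abs_ge_zero\<close>)
      qed
      then show "AE \<kappa> in lborel. norm (p \<kappa> * qrho b M \<omega>' (m \<kappa> i)) \<le> norm (p \<kappa> * ((LINT x|M. norm (f i x))\<^sup>2 / (2 * pi * b)))"
        by (intro AE_I2)
    qed
  qed
  define A where "A = (\<Sum>i<n. qrho b M \<omega> (f i))"
  define Q where "Q \<kappa> = (\<Sum>i<n. qrho b M \<omega>' (m \<kappa> i))" for \<kappa>
  have intQ: "integrable lborel (\<lambda>\<kappa>. p \<kappa> * Q \<kappa>)" 
    unfolding Q_def sum_distrib_left by (intro Bochner_Integration.integrable_sum) (use int in auto)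
  have avgQ: "(LINT \<kappa>|lborel. p \<kappa> * Q \<kappa>) = A"
    unfolding Q_def sum_distrib_left A_def by (subst Bochner_Integration.integral_sum) (use int avg in auto)
  have "\<exists>\<kappa>. A \<le> Q \<kappa>"
  proof (rule ccontr)
    assume "\<not> ?thesis"
    then have lt: "Q \<kappa> < A" for \<kappa> by (meson not_le)
    have i2: "integrable lborel (\<lambda>\<kappa>. p \<kappa> * A - p \<kappa> * Q \<kappa>)" using intQ p(1) by simp
    have "(LINT \<kappa>|lborel. p \<kappa> * A - p \<kappa> * Q \<kappa>) = 0"
      using intQ p(1) by (subst Bochner_Integration.integral_diff) (auto simp: avgQ p(3))
    moreover have nn: "0 \<le> p \<kappa> * A - p \<kappa> * Q \<kappa>" for \<kappa>
      using p(2)[of \<kappa>] lt[of \<kappa>] by (simp add: mult_left_mono)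
    ultimately have "AE \<kappa> in lborel. p \<kappa> * A - p \<kappa> * Q \<kappa> = 0"
      using integral_nonneg_eq_0_iff_AE[OF i2] by simp
    then have "AE \<kappa> in lborel. p \<kappa> = 0" by eventually_elim (use lt in \<open>auto simp: less_le\<close>)
    then have "(LINT \<kappa>|lborel. p \<kappa>) = 0" by (rule integral_eq_zero_AE)
    then show False using p(3) by simp
  qed
  then show ?thesis unfolding A_def Q_def m_def .
qed

section \<open>Moments of the eigenvalues\<close>

lemma sesq_add_right:
  assumes "f \<in> Hdom b" "g \<in> Hdom b" "h \<in> Hdom b"
  shows "sesq b f (\<lambda>k. g k + h k) = sesq b f g + sesq b f h"
  unfolding sesq_def using sesq_ip(1)[OF assms(1,2)] sesq_ip(1)[OF assms(1,3)] by (simp add: distrib_left)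

lemma sesq_cmult_right: "sesq b f (\<lambda>k. c * h k) = c * sesq b f h"
  unfolding sesq_def by (simp add: mult.left_commute[of _ c])

lemma sesq_commute: "sesq b h g = cnj (sesq b g h)"
  unfolding sesq_def by (subst Bochner_Integration.integral_cnj[symmetric]) (simp add: mult.commute)

text \<open>\<open>h\<close> is the Fourier transform of an eigenfunction for \<open>\<mu>\<close>, or zero.\<close>

definition eigenpair :: "real \<Rightarrow> real measure \<Rightarrow> real \<Rightarrow> (real \<Rightarrow> complex) \<Rightarrow> bool" where
  "eigenpair b M \<mu> h \<longleftrightarrow> h \<in> Hdom b \<and> (\<forall>g\<in>Hdom b. qform b M g h = of_real \<mu> * ip lborel g h)"

definition ae_independent :: "'p set \<Rightarrow> ('p \<Rightarrow> real \<Rightarrow> complex) \<Rightarrow> bool" where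
  "ae_independent I h \<longleftrightarrow> (\<forall>c. (AE k in lborel. (\<Sum>p\<in>I. c p * h p k) = 0) \<longrightarrow> (\<forall>p\<in>I. c p = 0))"

lemma ae_independent_subset:
  assumes "ae_independent J h" "I \<subseteq> J" "finite J" shows "ae_independent I h"
  unfolding ae_independent_def
proof (intro allI impI)
  fix c assume ae: "AE k in lborel. (\<Sum>p\<in>I. c p * h p k) = 0"
  let ?c = "\<lambda>p. if p \<in> I then c p else 0"
  have "(\<Sum>p\<in>J. ?c p * h p k) = (\<Sum>p\<in>I. c p * h p k)" for k
    using assms(2,3) by (intro sum.mono_neutral_cong_right) auto
  then have "AE k in lborel. (\<Sum>p\<in>J. ?c p * h p k) = 0" using ae by simp
  then have "\<forall>p\<in>J. ?c p = 0" using assms(1) unfolding ae_independent_def by (elim allE[of _ ?c]) simp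
  then show "\<forall>p\<in>I. c p = 0" using assms(2) by (metis (mono_tags, lifting) subsetD)
qed

lemma arccos_eigenvalue:
  assumes "- 2 \<le> \<mu>" "\<mu> < 2"
  shows "0 \<le> arccos (- \<mu> / 2)" "arccos (- \<mu> / 2) < pi" "- 2 * cos (arccos (- \<mu> / 2)) = \<mu>"
proof -
  show "0 \<le> arccos (- \<mu> / 2)" using assms by (intro arccos_lbound) auto
  show *: "- 2 * cos (arccos (- \<mu> / 2)) = \<mu>" using assms by (subst cos_arccos) auto
  have "arccos (- \<mu> / 2) \<le> pi" using assms by (intro arccos_ubound) auto
  moreover have "arccos (- \<mu> / 2) \<noteq> pi" using * assms(2) by auto
  ultimately show "arccos (- \<mu> / 2) < pi" by simp
qed

context
  fixes b :: real and M :: "real measure"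
  assumes b: "b > 0" and M: "finite_measure M" and sM: "sets M = sets borel"
begin

lemma iFT_Hdom_Lsq: "h \<in> Hdom b \<Longrightarrow> iFT h \<in> Lsq M"
  by (rule iFT_Lsq[OF M sM Hdom_L1[OF b]])

lemma qform_add_right:
  assumes "f \<in> Hdom b" "g \<in> Hdom b" "h \<in> Hdom b"
  shows "qform b M f (\<lambda>k. g k + h k) = qform b M f g + qform b M f h"
proof -
  have "iFT (\<lambda>k. g k + h k) = (\<lambda>x. iFT g x + iFT h x)"
    using assms Hdom_L1[OF b] by (intro ext iFT_add) auto
  then show ?thesis unfolding qform_def sesq_add_right[OF assms] 
    using ip_add_right[OF iFT_Hdom_Lsq iFT_Hdom_Lsq iFT_Hdom_Lsq, OF assms] by simp
qed

lemma qform_cmult_right: "qform b M f (\<lambda>k. c * h k) = c * qform b M f h"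
proof -
  have "iFT (\<lambda>k. c * h k) = (\<lambda>x. c * iFT h x)" by (intro ext iFT_cmult)
  then show ?thesis unfolding qform_def by (simp add: sesq_cmult_right ip_cmult_right right_diff_distrib)
qed

lemma qform_commute: "qform b M h g = cnj (qform b M g h)"
  unfolding qform_def using sesq_commute[of b h g] ip_commute[of M "iFT h" "iFT g"] by simp

lemma qform_sum_right: 
  assumes "f \<in> Hdom b" "finite I" "\<And>i. i \<in> I \<Longrightarrow> h i \<in> Hdom b"
  shows "qform b M f (\<lambda>k. \<Sum>i\<in>I. c i * h i k) = (\<Sum>i\<in>I. c i * qform b M f (h i))"
  using assms(2,3)
proof (induction I)
  case empty
  show ?case using qform_cmult_right[of f 0 "\<lambda>k. 0"] by simp
next
  case (insert i I)
  then show ?case using assms(1) by (simp add: qform_add_right Hdom_sum Hdom_cmult qform_cmult_right)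
qed

text \<open>The form is Hermitian.\<close>

lemma eigenpair_orthogonal:
  assumes h: "eigenpair b M \<mu> h" and g: "eigenpair b M \<nu> g" and ne: "\<mu> \<noteq> \<nu>"
  shows "ip lborel h g = 0"
proof -
  have 1: "qform b M h g = of_real \<nu> * ip lborel h g" and "qform b M g h = of_real \<mu> * ip lborel g h"
    using h g unfolding eigenpair_def by auto
  then have "qform b M h g = of_real \<mu> * ip lborel h g"
    using qform_commute[of h g] ip_commute[of lborel h g] by simp
  with 1 have "(of_real \<mu> - of_real \<nu>) * ip lborel h g = 0" by (simp add: left_diff_distrib)
  then show ?thesis using ne by simp
qed

text \<open>Since eigenfunctions for distinct eigenvalues are orthogonal, the difference of the two sides is
  the squared norm of \<open>\<Sum> c\<^sub>p sqrt(\<Lambda> - \<lambda>\<^sub>p) h\<^sub>p\<close>. For two eigenfunctions with the same eigenvalue the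
  square roots agree, and their product is the coefficient in the form.\<close>

lemma eigenpair_span_energy:
  fixes c :: "'p \<Rightarrow> complex"
  assumes I: "finite I" and h: "\<And>p. p \<in> I \<Longrightarrow> eigenpair b M (ev p) (h p)" and le: "\<And>p. p \<in> I \<Longrightarrow> ev p \<le> \<Lambda>"
  defines "g \<equiv> \<lambda>k. \<Sum>p\<in>I. c p * h p k"
  shows "Re (qform b M g g) \<le> \<Lambda> * (nrm lborel g)\<^sup>2"
proof -
  have hH: "h p \<in> Hdom b" if "p \<in> I" for p using h[OF that] by (simp add: eigenpair_def)
  have hL: "h p \<in> Lsq lborel" if "p \<in> I" for p using hH[OF that] by auto
  have g: "g \<in> Hdom b" unfolding g_def by (intro Hdom_sum Hdom_cmult hH)
  \<comment> \<open>Orthogonality leaves only terms with \<open>ev p = ev q\<close>, where \<open>s p * s q\<close> is \<open>\<Lambda> - ev p\<close>.\<close>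
  define s where "s p = complex_of_real (sqrt (\<Lambda> - ev p))" for p
  have s: "s p * s p = of_real (\<Lambda> - ev p)" "cnj (s p) = s p" if "p \<in> I" for p
    unfolding s_def of_real_mult[symmetric] using le[OF that] by auto
  define v where "v k = (\<Sum>p\<in>I. (c p * s p) * h p k)" for k
  have "of_real \<Lambda> * ip lborel g g - qform b M g g = (\<Sum>p\<in>I. c p * of_real (\<Lambda> - ev p) * ip lborel g (h p))"
  proof -
    have "qform b M g g = (\<Sum>p\<in>I. c p * qform b M g (h p))"
      using qform_sum_right[OF g I hH, where c=c] unfolding g_def by auto
    also have "\<dots> = (\<Sum>p\<in>I. c p * (of_real (ev p) * ip lborel g (h p)))"
      using h g by (intro sum.cong) (auto simp: eigenpair_def)
    finally have 1: "qform b M g g = \<dots>" .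
    have "ip lborel g g = (\<Sum>p\<in>I. c p * ip lborel g (h p))"
      using ip_sum_right[OF Hdom_Lsq[OF g] hL, where c=c] unfolding g_def by auto
    then show ?thesis unfolding 1 by (simp add: sum_distrib_left sum_subtractf[symmetric] algebra_simps)
  qed
  also have "\<dots> = (\<Sum>p\<in>I. \<Sum>q\<in>I. c p * of_real (\<Lambda> - ev p) * (cnj (c q) * ip lborel (h q) (h p)))"
  proof (intro sum.cong refl)
    fix p assume p: "p \<in> I"
    have "ip lborel g (h p) = (\<Sum>q\<in>I. cnj (c q) * ip lborel (h q) (h p))"
      unfolding g_def by (rule ip_sum_left) (use hL p in auto)
    then show "c p * of_real (\<Lambda> - ev p) * ip lborel g (h p) = (\<Sum>q\<in>I. c p * of_real (\<Lambda> - ev p) * (cnj (c q) * ip lborel (h q) (h p)))"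
      by (simp add: sum_distrib_left)
  qed
  also have "\<dots> = (\<Sum>p\<in>I. \<Sum>q\<in>I. c p * s p * (cnj (c q * s q) * ip lborel (h q) (h p)))"
  proof (intro sum.cong refl)
    fix p q assume p: "p \<in> I" and q: "q \<in> I"
    show "c p * of_real (\<Lambda> - ev p) * (cnj (c q) * ip lborel (h q) (h p)) = c p * s p * (cnj (c q * s q) * ip lborel (h q) (h p))"
    proof (cases "ev p = ev q")
      case True
      then have "s q = s p" by (simp add: s_def)
      then show ?thesis using s[OF p] by (simp add: mult_ac s(1)[OF p, symmetric])
    next
      case False
      then have "ip lborel (h q) (h p) = 0" using eigenpair_orthogonal[OF h[OF q] h[OF p]] by auto
      then show ?thesis by simp
    qed
  qed
  also have "\<dots> = ip lborel v v"
  proof -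
    have v: "v \<in> Lsq lborel" unfolding v_def by (intro Lsq_sum Lsq_cmult hL)
    have "ip lborel v v = (\<Sum>p\<in>I. (c p * s p) * ip lborel v (h p))"
      using ip_sum_right[OF v hL, where c="\<lambda>p. c p * s p"] unfolding v_def by auto
    also have "\<dots> = (\<Sum>p\<in>I. \<Sum>q\<in>I. c p * s p * (cnj (c q * s q) * ip lborel (h q) (h p)))"
    proof (intro sum.cong refl)
      fix p assume p: "p \<in> I"
      have "ip lborel v (h p) = (\<Sum>q\<in>I. cnj (c q * s q) * ip lborel (h q) (h p))"
        unfolding v_def by (rule ip_sum_left) (use hL p in auto)
      then show "c p * s p * ip lborel v (h p) = (\<Sum>q\<in>I. c p * s p * (cnj (c q * s q) * ip lborel (h q) (h p)))"
        by (simp add: sum_distrib_left)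
    qed
    finally show ?thesis by simp
  qed
  finally have "of_real \<Lambda> * ip lborel g g - qform b M g g = of_real ((nrm lborel v)\<^sup>2)" unfolding ip_self .
  then have "Re (of_real \<Lambda> * ip lborel g g - qform b M g g) = (nrm lborel v)\<^sup>2" by simp
  then have "\<Lambda> * (nrm lborel g)\<^sup>2 - Re (qform b M g g) = (nrm lborel v)\<^sup>2"
    unfolding ip_self by simp
  then show ?thesis by (metis diff_ge_0_iff_ge zero_le_power2)
qed

text \<open>Put \<open>u = iFT g\<close>, \<open>W(k) = 2 cosh(2\<pi>bk) + 2 cos \<omega>\<close>, \<open>U = \<parallel>u\<parallel>\<^sup>2\<close> in \<open>L\<^sup>2(M)\<close>, \<open>D = \<integral> W |g|\<^sup>2\<close> and
  \<open>E = \<integral> |(u M)^|\<^sup>2 / W\<close>. The energy assumption reads \<open>D \<le> U\<close>. By duality \<open>U\<close> is the inner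
  product of \<open>g\<close> and \<open>(u M)^\<close>, so \<open>U\<^sup>2 \<le> D E \<le> U E\<close> and therefore \<open>U \<le> E\<close>. As
  \<open>W\<close> is bounded below by a positive constant, \<open>D\<close> and hence \<open>U\<close> are positive.\<close>

lemma birman_schwinger_bound:
  assumes g: "g \<in> Hdom b" and g0: "nrm lborel g > 0" and w: "0 \<le> \<omega>" "\<omega> < pi"
    and en: "Re (qform b M g g) \<le> - 2 * cos \<omega> * (nrm lborel g)\<^sup>2"
  shows "nrm M (iFT g) > 0" "qrho b M \<omega> (iFT g) \<ge> sinc \<omega> * (nrm M (iFT g))\<^sup>2"
proof -
  define u where "u = iFT g"
  define W where "W k = symb b k + 2 * cos \<omega>" for k
  have W: "W k > 0" for k unfolding W_def by (rule symb_plus_cos_pos[OF w])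
  have [measurable]: "W \<in> borel_measurable borel" unfolding W_def by measurable
  have [measurable]: "g \<in> borel_measurable borel" using Hdom_Lsq[OF g] by auto
  have u: "u \<in> Lsq M" unfolding u_def by (rule iFT_Hdom_Lsq[OF g])
  note u1 = Lsq_finite_L1[OF M u]
  have [measurable]: "FT M u \<in> borel_measurable borel" by (rule FT_measurable_finite[OF M sM u1])
  define D where "D = (LINT k|lborel. W k * (norm (g k))\<^sup>2)"
  define E where "E = (LINT k|lborel. 1 / W k * (norm (FT M u k))\<^sup>2)"
  define U where "U = (nrm M u)\<^sup>2"
  have D_int: "integrable lborel (\<lambda>k. W k * (norm (g k))\<^sup>2)" and D_eq: "D = Re (sesq b g g) + 2 * cos \<omega> * (nrm lborel g)\<^sup>2"
    using Hdom_weighted(1,2)[OF g, of "2 * cos \<omega>"] by (auto simp: W_def D_def)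
  have "Re (qform b M g g) = Re (sesq b g g) - U"
    unfolding qform_def u_def[symmetric] ip_self U_def by simp
  then have DU: "D \<le> U" using en unfolding D_eq by simp
  have Dpos: "D > 0"
  proof -
    have "(LINT k|lborel. (2 + 2 * cos \<omega>) * (norm (g k))\<^sup>2) \<le> D"
      unfolding D_def
    proof (rule integral_mono)
      show "(2 + 2 * cos \<omega>) * (norm (g k))\<^sup>2 \<le> W k * (norm (g k))\<^sup>2" for k
        unfolding W_def using symb_ge_2[of b k] by (intro mult_right_mono) auto
    qed (use D_int Hdom_Lsq[OF g] in auto)
    then have "(2 + 2 * cos \<omega>) * (nrm lborel g)\<^sup>2 \<le> D" by (simp add: nrm_sq)
    moreover have "(2 + 2 * cos \<omega>) * (nrm lborel g)\<^sup>2 > 0"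
      using g0 symb_lower_bound(1)[OF w] by (intro mult_pos_pos) auto
    ultimately show ?thesis by linarith
  qed
  have Upos: "U > 0" using DU Dpos by linarith
  then show "nrm M (iFT g) > 0" unfolding U_def u_def by (simp add: less_le)
  have i1: "integrable lborel (\<lambda>k. 1 / W k)" unfolding W_def by (rule symb_integrable[OF b w])
  have E_int: "integrable lborel (\<lambda>k. 1 / W k * (norm (FT M u k))\<^sup>2)"
  proof (rule Bochner_Integration.integrable_bound)
    show "integrable lborel (\<lambda>k. 1 / W k * (LINT x|M. norm (u x))\<^sup>2)" using i1 by (rule integrable_mult_left)
    show "AE k in lborel. norm (1 / W k * (norm (FT M u k))\<^sup>2) \<le> norm (1 / W k * (LINT x|M. norm (u x))\<^sup>2)"
      unfolding norm_mult by (intro AE_I2 mult_left_mono) (auto intro!: power_mono norm_FT_le sM)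
  qed measurable
  let ?a = "\<lambda>k. of_real (sqrt (W k)) * g k" and ?c = "\<lambda>k. of_real (1 / sqrt (W k)) * FT M u k"
  have a2: "(norm (?a k))\<^sup>2 = W k * (norm (g k))\<^sup>2" for k
    using less_imp_le[OF W[of k]] by (simp add: norm_mult power_mult_distrib)
  have c2: "(norm (?c k))\<^sup>2 = 1 / W k * (norm (FT M u k))\<^sup>2" for k
    using less_imp_le[OF W[of k]] by (simp add: norm_mult norm_divide power_mult_distrib power_divide)
  have a: "?a \<in> Lsq lborel" by (rule LsqI, measurable) (simp only: a2 D_int)
  have c: "?c \<in> Lsq lborel" by (rule LsqI, measurable) (simp only: c2 E_int)
  have aD: "(nrm lborel ?a)\<^sup>2 = D" unfolding nrm_sq a2 D_def ..
  have cE: "(nrm lborel ?c)\<^sup>2 = E" unfolding nrm_sq c2 E_def ..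
  have "of_real U = ip M (iFT g) u" unfolding u_def[symmetric] ip_self U_def ..
  also have "\<dots> = ip lborel g (FT M u)" by (rule iFT_pairing[OF M sM Hdom_L1[OF b g] u1])
  also have "\<dots> = ip lborel ?a ?c"
    unfolding ip_def
  proof (intro Bochner_Integration.integral_cong refl)
    fix k
    have "complex_of_real (sqrt (W k)) \<noteq> 0" using W[of k] by simp
    then show "cnj (g k) * FT M u k = cnj (?a k) * ?c k" by (simp add: field_simps)
  qed
  finally have "norm (complex_of_real U) \<le> nrm lborel ?a * nrm lborel ?c" using norm_ip_le[OF a c] by simp
  then have "U \<le> nrm lborel ?a * nrm lborel ?c" using Upos by simp
  then have "U\<^sup>2 \<le> D * E" unfolding aD[symmetric] cE[symmetric] power_mult_distrib[symmetric]
    using Upos by (intro power_mono) auto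
  also have "\<dots> \<le> U * E"
  proof (rule mult_right_mono[OF DU])
    show "0 \<le> E" unfolding E_def using less_imp_le[OF W] by (intro integral_nonneg_AE) auto
  qed
  finally have "U \<le> E" using Upos by (simp add: power2_eq_square)
  have "qrho b M \<omega> u = sinc \<omega> * E"
    unfolding qrho_def E_def rho_def W_def[symmetric] integral_mult_right_zero[symmetric] by simp
  moreover have "sinc \<omega> * U \<le> sinc \<omega> * E"
    using \<open>U \<le> E\<close> sinc_nonneg[OF w(1)] w(2) by (intro mult_left_mono) auto
  ultimately show "qrho b M \<omega> (iFT g) \<ge> sinc \<omega> * (nrm M (iFT g))\<^sup>2" unfolding U_def u_def by simp
qed

definition orthonormal_below :: "nat \<Rightarrow> (nat \<Rightarrow> real \<Rightarrow> complex) \<Rightarrow> bool" where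
  "orthonormal_below n f \<longleftrightarrow> (\<forall>i<n. f i \<in> Lsq M) \<and> (\<forall>i<n. \<forall>j<n. ip M (f i) (f j) = (if i = j then 1 else 0))"

text \<open>More than \<open>n\<close> independent eigenfunctions have a nontrivial combination orthogonal in \<open>L\<^sup>2(M)\<close> to
  \<open>n\<close> given vectors; its normalisation is the next vector.\<close>

lemma extend_orthonormal:
  assumes I: "finite I" "card I > n" and h: "\<And>p. p \<in> I \<Longrightarrow> eigenpair b M (ev p) (h p)" and w: "0 \<le> \<omega>" "\<omega> < pi"
    and le: "\<And>p. p \<in> I \<Longrightarrow> ev p \<le> - 2 * cos \<omega>" and ind: "ae_independent I h" and f: "orthonormal_below n f"
  shows "\<exists>v. orthonormal_below (Suc n) (f(n := v)) \<and> qrho b M \<omega> v \<ge> sinc \<omega>"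
proof -
  have hH: "h p \<in> Hdom b" if "p \<in> I" for p using h[OF that] by (simp add: eigenpair_def)
  from underdetermined_system[OF I, of "\<lambda>i p. ip M (f i) (iFT (h p))"]
  obtain c where c: "\<exists>p\<in>I. c p \<noteq> 0" and orth: "\<And>i. i < n \<Longrightarrow> (\<Sum>p\<in>I. ip M (f i) (iFT (h p)) * c p) = 0" by blast
  define g where "g = (\<lambda>k. \<Sum>p\<in>I. c p * h p k)"
  have g: "g \<in> Hdom b" unfolding g_def by (intro Hdom_sum Hdom_cmult hH)
  have g0: "nrm lborel g > 0"
  proof -
    have "\<not> (AE k in lborel. g k = 0)" using ind c unfolding ae_independent_def g_def by blast
    then show ?thesis using nrm_eq_0_iff[OF Hdom_Lsq[OF g]] by (simp add: less_le)
  qed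
  have en: "Re (qform b M g g) \<le> - 2 * cos \<omega> * (nrm lborel g)\<^sup>2"
    unfolding g_def by (rule eigenpair_span_energy[OF I(1) h le])
  note bs = birman_schwinger_bound[OF g g0 w en]
  define u where "u = iFT g"
  have u: "u \<in> Lsq M" unfolding u_def by (rule iFT_Hdom_Lsq[OF g])
  define t where "t = 1 / nrm M u"
  define v where "v x = of_real t * u x" for x
  have t: "t > 0" using bs(1) unfolding t_def u_def by simp
  have v: "v \<in> Lsq M" unfolding v_def by (rule Lsq_cmult[OF u])
  have fu: "ip M (f i) u = 0" if "i < n" for i
  proof -
    have fi: "f i \<in> Lsq M" using f that by (auto simp: orthonormal_below_def)
    have "u = (\<lambda>x. \<Sum>p\<in>I. c p * iFT (h p) x)"
      unfolding u_def g_def by (intro ext iFT_sum Hdom_L1[OF b hH])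
    then have "ip M (f i) u = (\<Sum>p\<in>I. c p * ip M (f i) (iFT (h p)))"
      using ip_sum_right[OF fi iFT_Hdom_Lsq[OF hH], where c=c] by simp
    then show ?thesis using orth[OF that] by (simp add: mult.commute)
  qed
  have fv: "ip M (f i) v = 0" "ip M v (f i) = 0" if "i < n" for i
    using fu[OF that] ip_commute[of M v "f i"] unfolding v_def by (auto simp: ip_cmult_right)
  have vv: "ip M v v = 1"
  proof -
    have "ip M v v = of_real (t * t * (nrm M u)\<^sup>2)" unfolding v_def ip_cmult_right ip_cmult_left unfolding ip_self by simp
    also have "t * t * (nrm M u)\<^sup>2 = 1" using bs(1) unfolding t_def u_def by (simp add: power2_eq_square)
    finally show ?thesis by simp
  qed
  have "orthonormal_below (Suc n) (f(n := v))"
    using f v fv vv unfolding orthonormal_below_def by (auto simp: less_Suc_eq)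
  moreover have "qrho b M \<omega> v \<ge> sinc \<omega>"
  proof -
    have "qrho b M \<omega> v = t\<^sup>2 * qrho b M \<omega> u"
    proof -
      have "rho b \<omega> k * (norm (FT M v k))\<^sup>2 = t\<^sup>2 * (rho b \<omega> k * (norm (FT M u k))\<^sup>2)" for k
        unfolding v_def FT_cmult by (simp add: norm_mult power_mult_distrib)
      then show ?thesis unfolding qrho_def by (simp only: integral_mult_right_zero)
    qed
    also have "\<dots> \<ge> t\<^sup>2 * (sinc \<omega> * (nrm M u)\<^sup>2)" using bs(2) unfolding u_def by (intro mult_left_mono) auto
    also have "t\<^sup>2 * (sinc \<omega> * (nrm M u)\<^sup>2) = sinc \<omega>" using bs(1) unfolding t_def u_def by (simp add: power_divide)
    finally show ?thesis .
  qed
  ultimately show ?thesis by blast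
qed

text \<open>Induction that inserts the eigenvalues in increasing order. The hypothesis is used at the
  parameter \<open>\<theta>\<close> of the new, largest eigenvalue: there the system is extended by one vector, and
  afterwards it is carried from \<open>\<theta>\<close> to \<open>\<omega>\<close> by the monotonicity. The statement therefore has to range over
  all parameters \<open>\<omega>\<close> above the eigenvalues.\<close>

lemma eigenvalue_moments_orthonormal:
  assumes "finite I"
    and "\<And>p. p \<in> I \<Longrightarrow> eigenpair b M (ev p) (h p)" "\<And>p. p \<in> I \<Longrightarrow> - 2 \<le> ev p \<and> ev p < 2" "ae_independent I h"
    and "0 \<le> \<omega>" "\<omega> < pi" "\<And>p. p \<in> I \<Longrightarrow> ev p \<le> - 2 * cos \<omega>"
  shows "\<exists>f. orthonormal_below (card I) f \<and> (\<Sum>p\<in>I. sinc (arccos (- ev p / 2))) \<le> (\<Sum>i<card I. qrho b M \<omega> (f i))"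
  using assms
proof (induction I arbitrary: \<omega> rule: finite_ranking_induct[where f=ev])
  case empty
  then show ?case by (simp add: orthonormal_below_def)
next
  case (insert x S)
  show ?case
  proof (cases "x \<in> S")
    case True
    then show ?thesis using insert.IH insert.prems by (simp add: insert_absorb)
  next
    case False
    define \<theta> where "\<theta> = arccos (- ev x / 2)"
    have rng: "- 2 \<le> ev x" "ev x < 2" using insert.prems(2)[of x] by auto
    note th = arccos_eigenvalue[OF rng, folded \<theta>_def]
    have indS: "ae_independent S h" by (rule ae_independent_subset[OF insert.prems(3)]) (use insert.hyps in auto)
    have "\<exists>f. orthonormal_below (card S) f \<and> (\<Sum>p\<in>S. sinc (arccos (- ev p / 2))) \<le> (\<Sum>i<card S. qrho b M \<theta> (f i))"
      by (rule insert.IH) (use insert.prems(1,2) insert.hyps(2) th indS in auto)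
    then obtain f where f: "orthonormal_below (card S) f" "(\<Sum>p\<in>S. sinc (arccos (- ev p / 2))) \<le> (\<Sum>i<card S. qrho b M \<theta> (f i))" by blast
    have card: "card (insert x S) = Suc (card S)" using False insert.hyps by simp
    have "\<exists>v. orthonormal_below (Suc (card S)) (f(card S := v)) \<and> qrho b M \<theta> v \<ge> sinc \<theta>"
      by (rule extend_orthonormal[OF _ _ insert.prems(1) th(1,2) _ insert.prems(3) f(1)])
        (use insert.hyps th(3) card in auto)
    then obtain v where v: "orthonormal_below (Suc (card S)) (f(card S := v))" "qrho b M \<theta> v \<ge> sinc \<theta>" by blast
    define f' where "f' = f(card S := v)"
    have sum: "(\<Sum>p\<in>insert x S. sinc (arccos (- ev p / 2))) \<le> (\<Sum>i<card (insert x S). qrho b M \<theta> (f' i))"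
    proof -
      have "(\<Sum>i<card (insert x S). qrho b M \<theta> (f' i)) = (\<Sum>i<card S. qrho b M \<theta> (f i)) + qrho b M \<theta> v"
        unfolding card by (simp add: f'_def)
      moreover have "(\<Sum>p\<in>insert x S. sinc (arccos (- ev p / 2))) = sinc \<theta> + (\<Sum>p\<in>S. sinc (arccos (- ev p / 2)))"
        using False insert.hyps unfolding \<theta>_def by (subst sum.insert) auto
      ultimately show ?thesis using f(2) v(2) by linarith
    qed
    have ge: "\<theta> \<le> \<omega>"
    proof (rule ccontr)
      assume "\<not> \<theta> \<le> \<omega>"
      then have "cos \<theta> < cos \<omega>" using th insert.prems(4) by (intro cos_monotone_0_pi) auto
      then show False using th(3) insert.prems(6)[of x] by simp
    qed
    show ?thesis
    proof (cases "\<theta> = \<omega>")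
      case True
      then show ?thesis using v(1) sum unfolding card f'_def by blast
    next
      case False
      with ge have lt: "\<theta> < \<omega>" by simp
      have fL: "f' i \<in> Lsq M" if "i < card (insert x S)" for i
        using v(1) that unfolding card f'_def orthonormal_below_def by auto
      from sum_qrho_monotone[OF b th(1) lt insert.prems(5) M sM fL, of "card (insert x S)" "\<lambda>i. i"]
      obtain \<kappa> where k: "(\<Sum>i<card (insert x S). qrho b M \<theta> (f' i)) \<le> (\<Sum>i<card (insert x S). qrho b M \<omega> (\<lambda>x. cis (- (2 * pi * \<kappa> * x)) * f' i x))" by auto
      have "orthonormal_below (card (insert x S)) (\<lambda>i x. cis (- (2 * pi * \<kappa> * x)) * f' i x)"
        unfolding orthonormal_below_def
      proof (intro conjI allI impI)
        fix i assume i: "i < card (insert x S)"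
        note sM[measurable_cong]
        have [measurable]: "f' i \<in> borel_measurable borel" using fL[OF i] sM by (auto dest!: LsqD1 cong: measurable_cong_sets)
        show "(\<lambda>x. cis (- (2 * pi * \<kappa> * x)) * f' i x) \<in> Lsq M"
          by (rule Lsq_bounded[OF fL[OF i], where C=1]) (measurable, simp add: norm_mult)
      next
        fix i j assume ij: "i < card (insert x S)" "j < card (insert x S)"
        have "ip M (\<lambda>x. cis (- (2 * pi * \<kappa> * x)) * f' i x) (\<lambda>x. cis (- (2 * pi * \<kappa> * x)) * f' j x) = ip M (f' i) (f' j)"
          unfolding ip_def
        proof (intro Bochner_Integration.integral_cong refl)
          fix x
          let ?e = "cis (- (2 * pi * \<kappa> * x))"
          have 1: "cnj ?e * ?e = 1" by (simp add: cis_cnj cis_mult)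
          have "cnj (?e * f' i x) * (?e * f' j x) = (cnj ?e * ?e) * (cnj (f' i x) * f' j x)"
            unfolding complex_cnj_mult by (simp only: mult_ac)
          then show "cnj (?e * f' i x) * (?e * f' j x) = cnj (f' i x) * f' j x" unfolding 1 mult_1 .
        qed
        then show "ip M (\<lambda>x. cis (- (2 * pi * \<kappa> * x)) * f' i x) (\<lambda>x. cis (- (2 * pi * \<kappa> * x)) * f' j x) = (if i = j then 1 else 0)"
          using v(1) ij unfolding card f'_def orthonormal_below_def by auto
      qed
      then show ?thesis using order_trans[OF sum k] by blast
    qed
  qed
qed

lemma sharp_moment_bound:
  assumes I: "finite I" and h: "\<And>p. p \<in> I \<Longrightarrow> eigenpair b M (ev p) (h p)" 
    and rng: "\<And>p. p \<in> I \<Longrightarrow> - 2 \<le> ev p \<and> ev p < 2" and ind: "ae_independent I h"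
  shows "(\<Sum>p\<in>I. sinc (arccos (- ev p / 2))) \<le> measure M UNIV / (2 * pi * b)"
proof (cases "I = {}")
  case True
  then show ?thesis using b by simp
next
  case False
  define \<Lambda> where "\<Lambda> = Max (ev ` I)"
  have "\<Lambda> \<in> ev ` I" unfolding \<Lambda>_def using I False by (intro Max_in) auto
  then have r: "- 2 \<le> \<Lambda>" "\<Lambda> < 2" using rng by auto
  note w = arccos_eigenvalue[OF r]
  have le: "ev p \<le> - 2 * cos (arccos (- \<Lambda> / 2))" if "p \<in> I" for p
    unfolding w(3) unfolding \<Lambda>_def using I that by (intro Max_ge) auto
  from eigenvalue_moments_orthonormal[OF I h rng ind w(1,2) le]
  obtain f where f: "orthonormal_below (card I) f" 
    and le: "(\<Sum>p\<in>I. sinc (arccos (- ev p / 2))) \<le> (\<Sum>i<card I. qrho b M (arccos (- \<Lambda> / 2)) (f i))" by blast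
  have "(\<Sum>i<card I. qrho b M (arccos (- \<Lambda> / 2)) (f i)) \<le> measure M UNIV / (2 * pi * b)"
    by (rule qrho_trace_bound[OF b w(1,2) M sM]) (use f in \<open>auto simp: orthonormal_below_def\<close>)
  with le show ?thesis by linarith
qed

end

section \<open>The spectrum of the operator\<close>

lemma fourier_cmult:
  assumes "f \<in> Lsq lborel" shows "AE k in lborel. fourier (\<lambda>x. a * f x) k = a * fourier f k"
  using fourier_lincomb[OF assms assms, of a 0] by simp

lemma fourier_sum:
  assumes "finite I" "\<And>i. i \<in> I \<Longrightarrow> f i \<in> Lsq lborel"
  shows "AE k in lborel. fourier (\<lambda>x. \<Sum>i\<in>I. c i * f i x) k = (\<Sum>i\<in>I. c i * fourier (f i) k)"
  using assms
proof (induction I)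
  case empty
  then show ?case using fourier_cmult[OF Lsq_0, of 0] by simp
next
  case (insert i I)
  have "AE k in lborel. fourier (\<lambda>x. c i * f i x + 1 * (\<Sum>i\<in>I. c i * f i x)) k = c i * fourier (f i) k + 1 * fourier (\<lambda>x. \<Sum>i\<in>I. c i * f i x) k"
    using insert.prems by (intro fourier_lincomb Lsq_sum Lsq_cmult) auto
  moreover have "AE k in lborel. fourier (\<lambda>x. \<Sum>i\<in>I. c i * f i x) k = (\<Sum>i\<in>I. c i * fourier (f i) k)"
    using insert by auto
  ultimately show ?case by eventually_elim (use insert.hyps in simp)
qed

lemma fourier_AE_zero:
  assumes "f \<in> Lsq lborel" "AE k in lborel. fourier f k = 0" shows "AE x in lborel. f x = 0"
  using nrm_eq_0_iff[OF fourier_Lsq[OF assms(1)]] nrm_eq_0_iff[OF assms(1)] fourier_plancherel[OF assms(1)] assms(2) by simp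

text \<open>Express the \<open>\<phi>\<^sub>j\<close> by the \<open>\<psi>\<^sub>i\<close>; more columns than rows make the \<open>\<phi>\<^sub>j\<close> dependent.\<close>

lemma ae_basis_le:
  assumes P: "ae_basis n \<psi> S" and Q: "ae_basis m \<phi> S"
  shows "m \<le> n"
proof (rule ccontr)
  assume "\<not> m \<le> n"
  then have mn: "card {..<m} > n" by simp
  have "\<exists>c. AE x in lborel. \<phi> j x = (\<Sum>i<n. c i * \<psi> i x)" if "j < m" for j
    using P Q that unfolding ae_basis_def by blast
  then obtain A where A: "\<And>j. j < m \<Longrightarrow> AE x in lborel. \<phi> j x = (\<Sum>i<n. A j i * \<psi> i x)" by metis
  from underdetermined_system[OF _ mn, of "\<lambda>i j. A j i"] obtain c where c: "\<exists>j\<in>{..<m}. c j \<noteq> 0"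
    and z: "\<And>i. i < n \<Longrightarrow> (\<Sum>j<m. A j i * c j) = 0" by auto
  have "AE x in lborel. \<forall>j\<in>{..<m}. \<phi> j x = (\<Sum>i<n. A j i * \<psi> i x)"
    using A by (intro AE_finite_allI) auto
  then have "AE x in lborel. (\<Sum>j<m. c j * \<phi> j x) = 0"
  proof eventually_elim
    case (elim x)
    have "(\<Sum>j<m. c j * \<phi> j x) = (\<Sum>j<m. \<Sum>i<n. c j * (A j i * \<psi> i x))"
      using elim by (simp add: sum_distrib_left)
    also have "\<dots> = (\<Sum>i<n. (\<Sum>j<m. A j i * c j) * \<psi> i x)"
      by (subst sum.swap) (simp add: sum_distrib_right sum_distrib_left mult_ac)
    also have "\<dots> = 0" using z by simp
    finally show ?case .
  qed
  then have "\<forall>j<m. c j = 0" using Q unfolding ae_basis_def by blast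
  then show False using c by auto
qed

lemma multiplicity_eq:
  assumes "ae_basis n \<psi> (eigenspace T \<mu>)" shows "multiplicity T \<mu> = n"
  unfolding multiplicity_def
proof (rule the_equality)
  show "\<exists>\<psi>. ae_basis n \<psi> (eigenspace T \<mu>)" using assms by blast
  show "m = n" if "\<exists>\<psi>. ae_basis m \<psi> (eigenspace T \<mu>)" for m
    using that assms ae_basis_le by (metis le_antisym)
qed

text \<open>Potentials are infinitesimally form bounded: by dominated convergence the integral of
  \<open>1 / (2 cosh(2\<pi>bk) + a)\<close> becomes arbitrarily small for large \<open>a\<close>.\<close>

lemma Hdom_L1_small:
  assumes b: "b > 0"
  shows "\<exists>a\<ge>0. \<forall>h\<in>Hdom b. m * (LINT k|lborel. norm (h k))\<^sup>2 \<le> (Re (sesq b h h) + a * (nrm lborel h)\<^sup>2) / 2"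
proof -
  define J where "J n = (LINT k|lborel. 1 / (symb b k + 2 + real n))" for n
  have pos: "symb b k + 2 + real n > 0" for k n using symb_ge_2[of b k] by linarith
  have le: "1 / (symb b k + 2 + real n) \<le> 1 / (symb b k + 2)" for k n
    using symb_ge_2[of b k] by (intro divide_left_mono mult_pos_pos) auto
  have int: "integrable lborel (\<lambda>k. 1 / (symb b k + 2 + real n))" for n
  proof (rule Bochner_Integration.integrable_bound[OF symb_integral(1)[OF b]])
    have "norm (1 / (symb b k + 2 + real n)) \<le> norm (1 / (symb b k + 2))" for k
      using le[of k n] pos[of k n] pos[of k 0] by simp
    then show "AE k in lborel. norm (1 / (symb b k + 2 + real n)) \<le> norm (1 / (symb b k + 2))" by simp
  qed measurable
  have "J \<longlonglongrightarrow> (LINT k::real|lborel. 0)"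
    unfolding J_def
  proof (rule integral_dominated_convergence[where w="\<lambda>k. 1 / (symb b k + 2)"])
    show "AE k in lborel. (\<lambda>n. 1 / (symb b k + 2 + real n)) \<longlonglongrightarrow> 0"
      by (intro AE_I2 tendsto_divide_0[OF tendsto_const] filterlim_at_top_imp_at_infinity
          filterlim_tendsto_add_at_top[OF tendsto_const] filterlim_real_sequentially)
    show "AE k in lborel. norm (1 / (symb b k + 2 + real n)) \<le> 1 / (symb b k + 2)" for n
      using le pos[of _ n] by (auto simp: less_imp_le)
  qed (use symb_integral(1)[OF b] in auto)
  then have "(\<lambda>n. \<bar>m\<bar> * J n) \<longlonglongrightarrow> \<bar>m\<bar> * 0" by (intro tendsto_intros) simp
  then have "\<forall>\<^sub>F n in sequentially. \<bar>m\<bar> * J n < 1 / 2" by (intro order_tendstoD) auto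
  then obtain n where n: "\<bar>m\<bar> * J n < 1 / 2" by (auto simp: eventually_sequentially)
  have "m * (LINT k|lborel. norm (h k))\<^sup>2 \<le> (Re (sesq b h h) + (2 + real n) * (nrm lborel h)\<^sup>2) / 2" if h: "h \<in> Hdom b" for h
  proof -
    let ?E = "Re (sesq b h h) + (2 + real n) * (nrm lborel h)\<^sup>2"
    have [measurable]: "h \<in> borel_measurable borel" using Hdom_Lsq[OF h] by auto
    note w = Hdom_weighted(1,2)[OF h, of "2 + real n", unfolded add.assoc[symmetric]]
    have l1: "(LINT k|lborel. norm (h k))\<^sup>2 \<le> J n * ?E"
      using weighted_L1_bound(2)[of "\<lambda>k. symb b k + 2 + real n" h, OF _ _ pos int w(1)] unfolding J_def w(2) by simp
    have E0: "?E \<ge> 0" unfolding w(2)[symmetric] using pos[of _ n] by (intro integral_nonneg_AE) (auto simp: less_imp_le)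
    have "m * (LINT k|lborel. norm (h k))\<^sup>2 \<le> \<bar>m\<bar> * (LINT k|lborel. norm (h k))\<^sup>2" by (intro mult_right_mono) auto
    also have "\<dots> \<le> \<bar>m\<bar> * (J n * ?E)" by (intro mult_left_mono l1) auto
    also have "\<dots> \<le> (1 / 2) * ?E" unfolding mult.assoc[symmetric] using n E0 by (intro mult_right_mono) auto
    finally show ?thesis by simp
  qed
  then show ?thesis by (intro exI[of _ "2 + real n"]) auto
qed

context
  fixes b :: real and M :: "real measure"
  assumes b: "b > 0" and M: "finite_measure M" and sM: "sets M = sets borel"
begin

lemma eigenspace_eigenpair:
  "\<psi> \<in> eigenspace (W_op b (measure_form M)) \<mu> \<longleftrightarrow> \<psi> \<in> Lsq lborel \<and> eigenpair b M \<mu> (fourier \<psi>)"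
proof
  assume "\<psi> \<in> eigenspace (W_op b (measure_form M)) \<mu>"
  then obtain \<eta> where op: "(\<psi>, \<eta>) \<in> W_op b (measure_form M)" and ae: "AE x in lborel. \<eta> x = of_real \<mu> * \<psi> x"
    unfolding eigenspace_def by blast
  have psi: "\<psi> \<in> Lsq lborel" "fourier \<psi> \<in> Hdom b" and eta: "\<eta> \<in> Lsq lborel"
    and q: "\<And>g. g \<in> Hdom b \<Longrightarrow> qform b M g (fourier \<psi>) = ip lborel g (fourier \<eta>)"
    using op unfolding W_op_measure_iff[OF b] form_domain_Hdom by auto
  have "fourier \<eta> = fourier (\<lambda>x. of_real \<mu> * \<psi> x)"
    by (rule fourier_cong_Lsq[OF ae eta Lsq_cmult[OF psi(1)]])
  then have "AE k in lborel. fourier \<eta> k = of_real \<mu> * fourier \<psi> k" using fourier_cmult[OF psi(1)] by simp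
  then have "ip lborel g (fourier \<eta>) = ip lborel g (\<lambda>k. of_real \<mu> * fourier \<psi> k)" if "g \<in> Hdom b" for g
    by (intro ip_cong_Lsq Hdom_Lsq[OF that] fourier_Lsq[OF eta] Lsq_cmult[OF fourier_Lsq[OF psi(1)]])
  then show "\<psi> \<in> Lsq lborel \<and> eigenpair b M \<mu> (fourier \<psi>)"
    unfolding eigenpair_def using psi q by (simp add: ip_cmult_right)
next
  assume *: "\<psi> \<in> Lsq lborel \<and> eigenpair b M \<mu> (fourier \<psi>)"
  then have psi: "\<psi> \<in> Lsq lborel" and H: "fourier \<psi> \<in> Hdom b" 
    and q: "\<And>g. g \<in> Hdom b \<Longrightarrow> qform b M g (fourier \<psi>) = of_real \<mu> * ip lborel g (fourier \<psi>)" by (auto simp: eigenpair_def)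
  let ?\<eta> = "\<lambda>x. of_real \<mu> * \<psi> x"
  have eta: "?\<eta> \<in> Lsq lborel" by (rule Lsq_cmult[OF psi])
  have "ip lborel g (fourier ?\<eta>) = ip lborel g (\<lambda>k. of_real \<mu> * fourier \<psi> k)" if "g \<in> Hdom b" for g
    by (intro ip_cong_Lsq fourier_cmult[OF psi] Hdom_Lsq[OF that] fourier_Lsq[OF eta] Lsq_cmult[OF fourier_Lsq[OF psi]])
  then have "(\<psi>, ?\<eta>) \<in> W_op b (measure_form M)"
    unfolding W_op_measure_iff[OF b] form_domain_Hdom using psi H eta q by (simp add: ip_cmult_right)
  then show "\<psi> \<in> eigenspace (W_op b (measure_form M)) \<mu>" unfolding eigenspace_def by auto
qed

text \<open>Test the form with the eigenfunction.\<close>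

lemma eigenvalue_ge:
  assumes bd: "W_bounded_below b (measure_form M) c" and psi: "\<psi> \<in> eigenspace (W_op b (measure_form M)) \<mu>" 
    and ne: "\<not> (AE x in lborel. \<psi> x = 0)"
  shows "\<mu> \<ge> c"
proof -
  have L: "\<psi> \<in> Lsq lborel" and e: "eigenpair b M \<mu> (fourier \<psi>)" using psi eigenspace_eigenpair by auto
  let ?h = "fourier \<psi>"
  have h: "?h \<in> Hdom b" using e by (simp add: eigenpair_def)
  have pos: "(nrm lborel ?h)\<^sup>2 > 0" using ne nrm_eq_0_iff[OF L] fourier_plancherel[OF L] by simp
  have "qform b M ?h ?h = of_real (\<mu> * (nrm lborel ?h)\<^sup>2)" using e h unfolding eigenpair_def by (simp add: ip_self)
  then have "c * (nrm lborel ?h)\<^sup>2 \<le> \<mu> * (nrm lborel ?h)\<^sup>2"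
    using bd h unfolding W_bounded_below_measure_iff[OF b] by fastforce
  then show ?thesis using pos by simp
qed

lemma norm_ip_iFT_le:
  assumes "g \<in> Hdom b" "h \<in> Hdom b"
  shows "norm (ip M (iFT g) (iFT h)) \<le> measure M UNIV * ((LINT k|lborel. norm (g k)) * (LINT k|lborel. norm (h k)))"
proof -
  have sp: "space M = UNIV" using sets_eq_imp_space_eq[OF sM] by simp
  have "norm (ip M (iFT g) (iFT h)) \<le> (LINT x|M. (LINT k|lborel. norm (g k)) * (LINT k|lborel. norm (h k)))"
    unfolding ip_def
  proof (rule Bochner_Integration.integral_norm_bound_integral)
    show "integrable M (\<lambda>x. cnj (iFT g x) * iFT h x)"
      by (intro integrable_ip iFT_Hdom_Lsq[OF b M sM] assms)
    show "norm (cnj (iFT g x) * iFT h x) \<le> (LINT k|lborel. norm (g k)) * (LINT k|lborel. norm (h k))" for x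
      unfolding norm_mult complex_mod_cnj by (intro mult_mono norm_iFT_le) auto
  qed (use M in \<open>simp add: finite_measure.integrable_const\<close>)
  then show ?thesis by (simp add: sp)
qed

text \<open>The functions \<open>g\<close> below, normalised and concentrated near a frequency \<open>k\<^sub>0\<close> with
  \<open>2 cosh(2\<pi>bk\<^sub>0) = \<mu>\<close>, are approximate eigenfunctions of \<open>W\<^sub>0(b)\<close>, and they spread out in
  position space, so that the potential hardly acts on them. A bounded resolvent at \<open>\<mu>\<close> would give
  solutions \<open>h\<close> of \<open>(W - \<mu>) h = g\<close> with bounded norm, and by the relative form bound also with
  bounded \<open>L\<^sup>1\<close> norm. Pairing the equation with \<open>g\<close> then shows that \<open>1\<close> is at most a null
  sequence.\<close>

lemma essential_spectrum:
  assumes l: "\<mu> \<ge> 2"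
  shows "complex_of_real \<mu> \<in> spectrum (W_op b (measure_form M))"
proof (rule ccontr)
  assume "\<not> ?thesis"
  then have "complex_of_real \<mu> \<in> resolvent_set (W_op b (measure_form M))" by (simp add: spectrum_def)
  then obtain C where C: "\<And>f. f \<in> L2 \<Longrightarrow> \<exists>(\<psi>, \<eta>)\<in>W_op b (measure_form M). (AE x in lborel. \<eta> x - of_real \<mu> * \<psi> x = f x) \<and> L2_norm \<psi> \<le> C * L2_norm f"
    unfolding resolvent_set_def by blast
  define k0 where "k0 = arcosh (\<mu> / 2) / (2 * pi * b)"
  have k0: "k0 \<ge> 0" "symb b k0 = \<mu>" 
    using l b by (auto simp: k0_def symb_def cosh_arcosh_real arcosh_nonneg_real)
  have symb_mono: "symb b k \<le> symb b k'" if "0 \<le> k" "k \<le> k'" for k k'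
    unfolding symb_def using that b by (subst mult_le_cancel_left_pos) (auto simp: cosh_real_nonneg_le_iff)
  define m where "m = measure M UNIV"
  have m: "m \<ge> 0" by (simp add: m_def)
  from Hdom_L1_small[OF b, of "m + 1"] obtain a where a: "a \<ge> 0" 
    "\<And>h. h \<in> Hdom b \<Longrightarrow> (m + 1) * (LINT k|lborel. norm (h k))\<^sup>2 \<le> (Re (sesq b h h) + a * (nrm lborel h)\<^sup>2) / 2" by blast
  \<comment> \<open>\<open>C\<close> bounds the norm of the solutions and \<open>B\<close> the square of their \<open>L\<^sup>1\<close> norm.\<close>
  define B where "B = (a + \<mu>) * C\<^sup>2 + C"
  define \<delta> where "\<delta> N = symb b (k0 + 1 / real (Suc N)) - \<mu>" for N
  have main: "1 \<le> \<delta> N * C + m * (1 / sqrt (real (Suc N)) * sqrt B)" for N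
  proof -
    let ?N = "real (Suc N)"
    let ?S = "{k0..k0 + 1 / ?N}"
    \<comment> \<open>Norm one in \<open>L\<^sup>2\<close>, but \<open>L\<^sup>1\<close> norm \<open>1 / sqrt N\<close>.\<close>
    define g where "g k = of_real (sqrt ?N) * (indicator ?S k :: complex)" for k
    have g2: "(norm (g k))\<^sup>2 = ?N * indicator ?S k" for k by (simp add: g_def norm_mult power_mult_distrib indicator_def)
    have gn: "norm (g k) = sqrt ?N * indicator ?S k" for k by (simp add: g_def norm_mult indicator_def)
    have [measurable]: "g \<in> borel_measurable borel" unfolding g_def by measurable
    have mS: "measure lborel ?S = 1 / ?N" by simp
    have gL: "g \<in> Lsq lborel" by (rule LsqI, measurable) (simp add: g2)
    have gnrm: "nrm lborel g = 1" unfolding nrm_def g2 by simp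
    have gL1: "(LINT k|lborel. norm (g k)) = 1 / sqrt ?N" unfolding gn by (simp add: real_div_sqrt field_simps)
    have gH: "g \<in> Hdom b"
      unfolding Hdom_def
    proof (intro CollectI conjI gL Lsq_bounded[OF gL])
      show "(\<lambda>k. complex_of_real (2 * cosh (pi * b * k)) * g k) \<in> borel_measurable lborel" by measurable
      show "norm (complex_of_real (2 * cosh (pi * b * k)) * g k) \<le> (2 * cosh (pi * b * (k0 + 1 / ?N))) * norm (g k)" for k
      proof (cases "k \<in> ?S")
        case True
        then have "cosh (pi * b * k) \<le> cosh (pi * b * (k0 + 1 / ?N))"
          using k0(1) b by (subst cosh_real_nonneg_le_iff) auto
        then show ?thesis unfolding norm_mult norm_of_real by (intro mult_right_mono) auto
      qed (simp add: g_def)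
    qed
    let ?f = "inv_fourier g"
    have f: "?f \<in> Lsq lborel" "AE k in lborel. fourier ?f k = g k" 
      using inv_fourier_form_domain[OF gH] form_domain_Hdom by auto
    have fnrm: "nrm lborel ?f = 1" unfolding nrm_inv_fourier[OF gL] by (rule gnrm)
    from C[of ?f] f(1) obtain \<psi> \<eta> where op: "(\<psi>, \<eta>) \<in> W_op b (measure_form M)"
      and res: "AE x in lborel. \<eta> x - of_real \<mu> * \<psi> x = ?f x" and nC: "nrm lborel \<psi> \<le> C"
      unfolding L2_Lsq L2_norm_nrm fnrm by force
    have psi: "\<psi> \<in> Lsq lborel" "fourier \<psi> \<in> Hdom b" and eta: "\<eta> \<in> Lsq lborel"
      and q: "\<And>g. g \<in> Hdom b \<Longrightarrow> qform b M g (fourier \<psi>) = ip lborel g (fourier \<eta>)"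
      using op unfolding W_op_measure_iff[OF b] form_domain_Hdom by auto
    define h where "h = fourier \<psi>"
    have h: "h \<in> Hdom b" and hL: "h \<in> Lsq lborel" using psi by (auto simp: h_def)
    have hC: "nrm lborel h \<le> C" using nC fourier_plancherel[OF psi(1)] by (simp add: h_def)
    have C0: "C \<ge> 0" using hC nrm_nonneg[of lborel h] by linarith
    have feta: "AE k in lborel. fourier \<eta> k = of_real \<mu> * h k + g k"
    proof -
      have e: "AE x in lborel. \<eta> x = of_real \<mu> * \<psi> x + 1 * ?f x" using res by eventually_elim (simp add: algebra_simps)
      have "fourier \<eta> = fourier (\<lambda>x. of_real \<mu> * \<psi> x + 1 * ?f x)"
        by (rule fourier_cong_Lsq[OF e eta Lsq_add[OF Lsq_cmult[OF psi(1)] Lsq_cmult[OF f(1)]]])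
      then have "AE k in lborel. fourier \<eta> k = of_real \<mu> * fourier \<psi> k + 1 * fourier ?f k"
        using fourier_lincomb[OF psi(1) f(1), of "of_real \<mu>" 1] by (simp only:)
      then show ?thesis using f(2) by eventually_elim (simp add: h_def)
    qed
    have eq: "qform b M u h = of_real \<mu> * ip lborel u h + ip lborel u g" if u: "u \<in> Hdom b" for u
    proof -
      have "qform b M u h = ip lborel u (\<lambda>k. of_real \<mu> * h k + g k)"
        unfolding h_def[symmetric] q[OF u, folded h_def]
        by (rule ip_cong_Lsq[OF feta Hdom_Lsq[OF u] fourier_Lsq[OF eta] Lsq_add[OF Lsq_cmult[OF hL] gL]])
      then show ?thesis using ip_add_right[OF Hdom_Lsq[OF u] Lsq_cmult[OF hL] gL] by (simp add: ip_cmult_right)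
    qed
    let ?X = "Re (sesq b h h)" and ?H = "LINT k|lborel. norm (h k)"
    have ipgh: "norm (ip lborel h g) \<le> C" using norm_ip_le[OF hL gL] hC gnrm by simp
    have XH: "?X \<le> m * ?H\<^sup>2 + \<mu> * C\<^sup>2 + C"
    proof -
      have "sesq b h h = ip M (iFT h) (iFT h) + of_real (\<mu> * (nrm lborel h)\<^sup>2) + ip lborel h g"
        using eq[OF h] unfolding qform_def ip_self[of lborel] by (simp add: algebra_simps)
      then have "?X = Re (ip M (iFT h) (iFT h)) + \<mu> * (nrm lborel h)\<^sup>2 + Re (ip lborel h g)" by simp
      moreover have "Re (ip M (iFT h) (iFT h)) \<le> m * ?H\<^sup>2"
        using complex_Re_le_cmod[of "ip M (iFT h) (iFT h)"] norm_ip_iFT_le[OF h h] unfolding m_def power2_eq_square by linarith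
      moreover have "\<mu> * (nrm lborel h)\<^sup>2 \<le> \<mu> * C\<^sup>2" using l hC by (intro mult_left_mono power_mono) auto
      moreover have "Re (ip lborel h g) \<le> C" using complex_Re_le_cmod[of "ip lborel h g"] ipgh by linarith
      ultimately show ?thesis by linarith
    qed
    have "a * (nrm lborel h)\<^sup>2 \<le> a * C\<^sup>2" using a(1) hC by (intro mult_left_mono power_mono) auto
    then have H1: "(m + 1) * ?H\<^sup>2 \<le> (?X + a * C\<^sup>2) / 2" using a(2)[OF h] by simp
    have mH: "m * ?H\<^sup>2 \<ge> 0" using m by simp
    have "2 * (m * ?H\<^sup>2) + 2 * ?H\<^sup>2 \<le> ?X + a * C\<^sup>2" using H1 by (simp add: field_simps)
    then have "?H\<^sup>2 \<le> B" using XH mH unfolding B_def distrib_right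
      using zero_le_power2[of ?H] by linarith
    then have HB: "?H \<le> sqrt B" by (rule real_le_rsqrt)
    have one: "1 = (sesq b g h - of_real \<mu> * ip lborel g h) - ip M (iFT g) (iFT h)"
      using eq[OF gH] unfolding qform_def ip_self[of lborel g] gnrm by (simp add: algebra_simps)
    have n1: "norm (sesq b g h - of_real \<mu> * ip lborel g h) \<le> \<delta> N * C"
    proof -
      have "sesq b g h - of_real \<mu> * ip lborel g h = (LINT k|lborel. of_real (symb b k - \<mu>) * (cnj (g k) * h k))"
      proof -
        have "(LINT k|lborel. of_real (symb b k - \<mu>) * (cnj (g k) * h k)) = (LINT k|lborel. of_real (symb b k) * (cnj (g k) * h k) - of_real \<mu> * (cnj (g k) * h k))"
          by (simp add: left_diff_distrib)
        also have "\<dots> = sesq b g h - (LINT k|lborel. of_real \<mu> * (cnj (g k) * h k))"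
          unfolding sesq_def by (rule Bochner_Integration.integral_diff[OF sesq_ip(1)[OF gH h]]) (use integrable_ip[OF gL hL] in simp)
        finally show ?thesis unfolding ip_def by simp
      qed
      also have "norm \<dots> \<le> (LINT k|lborel. \<delta> N * (norm (g k) * norm (h k)))"
      proof (rule Bochner_Integration.integral_norm_bound_integral)
        show "integrable lborel (\<lambda>k. \<delta> N * (norm (g k) * norm (h k)))" using integrable_norm_mult[OF gL hL] by simp
        have "integrable lborel (\<lambda>k. of_real (symb b k) * (cnj (g k) * h k) - of_real \<mu> * (cnj (g k) * h k))"
          by (intro Bochner_Integration.integrable_diff sesq_ip(1)[OF gH h] integrable_mult_right integrable_ip[OF gL hL])
        then show "integrable lborel (\<lambda>k. of_real (symb b k - \<mu>) * (cnj (g k) * h k))"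
          by (simp add: left_diff_distrib)
        show "norm (of_real (symb b k - \<mu>) * (cnj (g k) * h k)) \<le> \<delta> N * (norm (g k) * norm (h k))" for k
          proof (cases "k \<in> ?S")
            case True
            then have "\<bar>symb b k - \<mu>\<bar> \<le> \<delta> N"
              using symb_mono[of k0 k] symb_mono[of k "k0 + 1 / ?N"] k0 unfolding \<delta>_def by auto
            then show ?thesis unfolding norm_mult norm_of_real complex_mod_cnj by (intro mult_right_mono) auto
          qed (simp add: g_def)
      qed
      also have "\<dots> = \<delta> N * (LINT k|lborel. norm (g k) * norm (h k))" by simp
      also have "\<dots> \<le> \<delta> N * (1 * C)"
      proof (rule mult_left_mono)
        show "(LINT k|lborel. norm (g k) * norm (h k)) \<le> 1 * C" using Lsq_Cauchy_Schwarz[OF gL hL] hC gnrm by simp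
        show "0 \<le> \<delta> N" unfolding \<delta>_def using symb_mono[of k0 "k0 + 1 / ?N"] k0 by simp
      qed
      finally show ?thesis by simp
    qed
    have n2: "norm (ip M (iFT g) (iFT h)) \<le> m * (1 / sqrt ?N * sqrt B)"
    proof -
      have "norm (ip M (iFT g) (iFT h)) \<le> m * (1 / sqrt ?N * ?H)" using norm_ip_iFT_le[OF gH h] unfolding gL1 m_def .
      also have "\<dots> \<le> m * (1 / sqrt ?N * sqrt B)" by (intro mult_left_mono HB m) auto
      finally show ?thesis .
    qed
    have "1 = norm ((sesq b g h - of_real \<mu> * ip lborel g h) - ip M (iFT g) (iFT h))" unfolding one[symmetric] by simp
    also have "\<dots> \<le> norm (sesq b g h - of_real \<mu> * ip lborel g h) + norm (ip M (iFT g) (iFT h))" by (rule norm_triangle_ineq4)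
    finally show ?thesis using n1 n2 by linarith
  qed
  have s: "(\<lambda>N. 1 / real (Suc N)) \<longlonglongrightarrow> 0" by (rule LIMSEQ_Suc[OF lim_1_over_n])
  have d: "\<delta> \<longlonglongrightarrow> 0"
  proof -
    have "isCont (symb b) (k0 + 0)" unfolding symb_def[abs_def] by (intro continuous_intros)
    then have "(\<lambda>N. symb b (k0 + 1 / real (Suc N))) \<longlonglongrightarrow> symb b (k0 + 0)"
      by (rule isCont_tendsto_compose) (intro tendsto_intros s)
    from tendsto_diff[OF this tendsto_const[of \<mu>]] show ?thesis unfolding \<delta>_def[abs_def] by (simp add: k0(2))
  qed
  have "(\<lambda>N. \<delta> N * C + m * (sqrt (1 / real (Suc N)) * sqrt B)) \<longlonglongrightarrow> 0 * C + m * (sqrt 0 * sqrt B)"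
    by (intro tendsto_intros d s)
  then have "(\<lambda>N. \<delta> N * C + m * (1 / sqrt (real (Suc N)) * sqrt B)) \<longlonglongrightarrow> 0" by (simp add: real_sqrt_divide)
  then have "1 \<le> (0::real)" by (rule LIMSEQ_le_const) (use main in blast)
  then show False by simp
qed

text \<open>Points of \<open>[2, \<infinity>)\<close> are not isolated in the spectrum.\<close>

lemma discrete_eigenvalues_range:
  assumes bd: "W_bounded_below b (measure_form M) (- 2)"
  shows "discrete_eigenvalues (W_op b (measure_form M)) \<subseteq> {- 2..<2}"
proof
  fix \<mu> assume mu: "\<mu> \<in> discrete_eigenvalues (W_op b (measure_form M))"
  let ?S = "spectrum (W_op b (measure_form M))"
  have ge: "\<mu> \<ge> - 2" using mu eigenvalue_ge[OF bd] unfolding discrete_eigenvalues_def by blast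
  have "\<mu> < 2"
  proof (rule ccontr)
    assume "\<not> \<mu> < 2"
    then have mu2: "\<mu> \<ge> 2" by simp
    from mu have "complex_of_real \<mu> isolated_in ?S" unfolding discrete_eigenvalues_def by blast
    then obtain T where T: "open T" "T \<inter> ?S = {complex_of_real \<mu>}" unfolding isolated_in_def by blast
    then have "complex_of_real \<mu> \<in> T" by blast
    then obtain e where e: "e > 0" "ball (complex_of_real \<mu>) e \<subseteq> T" using T(1) openE by blast
    have "complex_of_real (\<mu> + e / 2) \<in> T" 
      using e by (intro subsetD[OF e(2)]) (simp add: dist_norm)
    moreover have "complex_of_real (\<mu> + e / 2) \<in> ?S" using mu2 e(1) by (intro essential_spectrum) simp
    ultimately have "complex_of_real (\<mu> + e / 2) = complex_of_real \<mu>" using T(2) by blast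
    then show False using e(1) unfolding of_real_eq_iff by simp
  qed
  then show "\<mu> \<in> {- 2..<2}" using ge by simp
qed

text \<open>The sum over all discrete eigenvalues is the supremum of its finite partial sums. For finitely
  many eigenvalues, the bases of their eigenspaces together form an independent family, because
  different eigenspaces are orthogonal.\<close>

lemma sinc_sum_le:
  assumes bd: "W_bounded_below b (measure_form M) (- 2)"
  shows "sinc_sum (W_op b (measure_form M)) \<le> ennreal (1 / (2 * pi * b) * measure M UNIV)"
proof -
  let ?T = "W_op b (measure_form M)"
  let ?s = "\<lambda>\<mu>::real. sinc (arccos (- \<mu> / 2))"
  have s0: "?s \<mu> \<ge> 0" if "\<mu> \<in> discrete_eigenvalues ?T" for \<mu>
  proof -
    have "- 2 \<le> \<mu>" "\<mu> < 2" using discrete_eigenvalues_range[OF bd] that by auto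
    from arccos_eigenvalue[OF this] show ?thesis by (intro sinc_nonneg) auto
  qed
  have fin: "(\<Sum>\<mu>\<in>F. of_nat (multiplicity ?T \<mu>) * ennreal (?s \<mu>)) \<le> ennreal (1 / (2 * pi * b) * measure M UNIV)"
    if F: "finite F" "F \<subseteq> discrete_eigenvalues ?T" for F
  proof -
    have "\<exists>n \<psi>. ae_basis n \<psi> (eigenspace ?T \<mu>)" if "\<mu> \<in> F" for \<mu> 
      using F(2) that unfolding discrete_eigenvalues_def by blast
    then obtain d \<Psi> where basis: "\<And>\<mu>. \<mu> \<in> F \<Longrightarrow> ae_basis (d \<mu>) (\<Psi> \<mu>) (eigenspace ?T \<mu>)" by metis
    define I where "I = Sigma F (\<lambda>\<mu>. {..<d \<mu>})"
    define h where "h p = fourier (\<Psi> (fst p) (snd p))" for p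
    have I: "finite I" unfolding I_def using F(1) by auto
    have Psi: "\<Psi> \<mu> i \<in> Lsq lborel" "eigenpair b M \<mu> (h (\<mu>, i))" if "\<mu> \<in> F" "i < d \<mu>" for \<mu> i
      using basis[OF that(1)] that(2) eigenspace_eigenpair unfolding ae_basis_def h_def by auto
    have ep: "eigenpair b M (fst p) (h p)" if "p \<in> I" for p using that Psi(2) by (auto simp: I_def)
    have rng: "- 2 \<le> fst p \<and> fst p < 2" if "p \<in> I" for p
      using that F(2) discrete_eigenvalues_range[OF bd] by (auto simp: I_def)
    have hL: "h p \<in> Lsq lborel" if "p \<in> I" for p using ep[OF that] by (auto simp: eigenpair_def)
    have ind: "ae_independent I h"
      unfolding ae_independent_def
    proof (intro allI impI ballI)
      fix c p assume ae: "AE k in lborel. (\<Sum>p\<in>I. c p * h p k) = 0" and p: "p \<in> I"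
      obtain \<nu> i where pi: "p = (\<nu>, i)" "\<nu> \<in> F" "i < d \<nu>" using p by (auto simp: I_def)
      define g where "g k = (\<Sum>j<d \<nu>. c (\<nu>, j) * h (\<nu>, j) k)" for k
      have hL': "h (\<nu>, j) \<in> Lsq lborel" if "j < d \<nu>" for j using hL[of "(\<nu>, j)"] pi(2) that by (auto simp: I_def)
      have gL: "g \<in> Lsq lborel" unfolding g_def using hL' by (intro Lsq_sum Lsq_cmult) auto
      have orth: "ip lborel g (h (\<mu>, j)) = 0" if "\<mu> \<in> F" "j < d \<mu>" "\<mu> \<noteq> \<nu>" for \<mu> j
      proof -
        have "ip lborel g (h (\<mu>, j)) = (\<Sum>i<d \<nu>. cnj (c (\<nu>, i)) * ip lborel (h (\<nu>, i)) (h (\<mu>, j)))"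
          unfolding g_def by (rule ip_sum_left) (use hL' hL that in \<open>auto simp: I_def\<close>)
        also have "\<dots> = 0"
          using eigenpair_orthogonal[OF b M sM Psi(2)[OF pi(2)] Psi(2)[OF that(1,2)]] that(3) by (intro sum.neutral) auto
        finally show ?thesis .
      qed
      have "0 = ip lborel g (\<lambda>k. \<Sum>p\<in>I. c p * h p k)"
      proof -
        have "ip lborel g (\<lambda>k. \<Sum>p\<in>I. c p * h p k) = ip lborel g (\<lambda>k. 0)"
          by (intro ip_cong_Lsq[OF ae gL] Lsq_sum Lsq_cmult hL Lsq_0)
        then show ?thesis by (simp add: ip_def)
      qed
      also have "\<dots> = (\<Sum>p\<in>I. c p * ip lborel g (h p))" by (rule ip_sum_right[OF gL hL])
      also have "\<dots> = (\<Sum>\<mu>\<in>F. \<Sum>j<d \<mu>. c (\<mu>, j) * ip lborel g (h (\<mu>, j)))"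
        unfolding I_def by (subst sum.Sigma) (use F(1) in \<open>auto simp: case_prod_beta'\<close>)
      also have "\<dots> = (\<Sum>\<mu>\<in>F. if \<mu> = \<nu> then ip lborel g g else 0)"
      proof (intro sum.cong refl)
        fix \<mu> assume mu: "\<mu> \<in> F"
        show "(\<Sum>j<d \<mu>. c (\<mu>, j) * ip lborel g (h (\<mu>, j))) = (if \<mu> = \<nu> then ip lborel g g else 0)"
        proof (cases "\<mu> = \<nu>")
          case True
          have "ip lborel g g = (\<Sum>j<d \<nu>. c (\<nu>, j) * ip lborel g (h (\<nu>, j)))"
            using ip_sum_right[OF gL, of "{..<d \<nu>}" "\<lambda>j. h (\<nu>, j)" "\<lambda>j. c (\<nu>, j)"] hL'
            unfolding g_def[abs_def] by auto
          then show ?thesis using True by simp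
        next
          case False
          then show ?thesis using orth[OF mu] by simp
        qed
      qed
      also have "\<dots> = ip lborel g g" using F(1) pi(2) by simp
      finally have "nrm lborel g = 0" unfolding ip_self by simp
      then have g0: "AE k in lborel. g k = 0" using nrm_eq_0_iff[OF gL] by simp
      let ?\<psi> = "\<lambda>x. \<Sum>j<d \<nu>. c (\<nu>, j) * \<Psi> \<nu> j x"
      have PL: "\<Psi> \<nu> j \<in> Lsq lborel" if "j \<in> {..<d \<nu>}" for j using Psi(1)[OF pi(2)] that by simp
      have "AE x in lborel. ?\<psi> x = 0"
      proof (rule fourier_AE_zero)
        show "?\<psi> \<in> Lsq lborel" using PL by (intro Lsq_sum Lsq_cmult)
        have "AE k in lborel. fourier ?\<psi> k = g k"
          using fourier_sum[of "{..<d \<nu>}" "\<Psi> \<nu>" "\<lambda>j. c (\<nu>, j)", OF finite_lessThan PL] unfolding g_def h_def by simp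
        then show "AE k in lborel. fourier ?\<psi> k = 0" using g0 by eventually_elim simp
      qed
      then have "\<forall>j<d \<nu>. c (\<nu>, j) = 0" using basis[OF pi(2)] unfolding ae_basis_def
        by (elim conjE allE[of _ "\<lambda>j. c (\<nu>, j)"]) blast
      then show "c p = 0" using pi by simp
    qed
    have "(\<Sum>\<mu>\<in>F. of_nat (multiplicity ?T \<mu>) * ennreal (?s \<mu>)) = (\<Sum>\<mu>\<in>F. ennreal (real (d \<mu>) * ?s \<mu>))"
    proof (intro sum.cong refl)
      fix \<mu> assume mu: "\<mu> \<in> F"
      show "of_nat (multiplicity ?T \<mu>) * ennreal (?s \<mu>) = ennreal (real (d \<mu>) * ?s \<mu>)"
        unfolding multiplicity_eq[OF basis[OF mu]] ennreal_of_nat_eq_real_of_nat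
        by (rule ennreal_mult''[symmetric], rule s0) (use mu F(2) in blast)
    qed
    also have "\<dots> = ennreal (\<Sum>\<mu>\<in>F. real (d \<mu>) * ?s \<mu>)" 
      by (rule sum_ennreal, rule mult_nonneg_nonneg, simp, rule s0) (use F(2) in blast)
    also have "(\<Sum>\<mu>\<in>F. real (d \<mu>) * ?s \<mu>) = (\<Sum>p\<in>I. ?s (fst p))"
    proof -
      have "(\<Sum>p\<in>I. ?s (fst p)) = (\<Sum>\<mu>\<in>F. \<Sum>j<d \<mu>. ?s \<mu>)"
        unfolding I_def by (subst sum.Sigma) (use F(1) in \<open>auto simp: case_prod_beta'\<close>)
      then show ?thesis by simp
    qed
    also have "ennreal \<dots> \<le> ennreal (1 / (2 * pi * b) * measure M UNIV)"
      using sharp_moment_bound[OF b M sM I ep rng ind] by (intro ennreal_leI) simp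
    finally show ?thesis .
  qed
  show ?thesis unfolding sinc_sum_def
    by (subst nonneg_infsum_complete, simp, rule SUP_least, rule fin) blast+
qed

end

section \<open>A point mass attaining equality\<close>

lemma not_AE_False: "\<not> (AE k in (lborel :: real measure). False)"
  by (simp add: eventually_False ae_filter_eq_bot_iff)

lemma Hdom_bounded:
  assumes h: "h \<in> Hdom b" and g: "g \<in> borel_measurable borel" and bd: "\<And>k. norm (g k) \<le> C * norm (h k)"
  shows "g \<in> Hdom b"
proof -
  note g[measurable]
  have "g \<in> Lsq lborel" by (rule Lsq_bounded[OF Hdom_Lsq[OF h] _ bd]) simp
  moreover have "(\<lambda>k. complex_of_real (2 * cosh (pi * b * k)) * g k) \<in> Lsq lborel"
  proof (rule Lsq_bounded[OF Hdom_cosh[OF h]])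
    show "norm (complex_of_real (2 * cosh (pi * b * k)) * g k) \<le> C * norm (complex_of_real (2 * cosh (pi * b * k)) * h k)" for k
      using mult_left_mono[OF bd[of k], of "norm (complex_of_real (2 * cosh (pi * b * k)))"]
      unfolding norm_mult by (simp only: mult.left_commute norm_ge_zero)
  qed measurable
  ultimately show ?thesis by (simp add: Hdom_def)
qed

text \<open>The resolvent of \<open>W\<^sub>0(b)\<close> at \<open>z\<close> in Fourier space, applied to a point mass at the origin.\<close>

definition res_fun :: "real \<Rightarrow> complex \<Rightarrow> real \<Rightarrow> complex" where
  "res_fun b z k = 1 / (of_real (symb b k) - z)"

lemma res_fun_measurable [measurable]: "res_fun b z \<in> borel_measurable borel"
  unfolding res_fun_def[abs_def] by measurable

lemma res_fun_bounds:
  assumes z: "Re z \<le> - 1"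
  shows "of_real (symb b k) - z \<noteq> 0" "norm (res_fun b z k) \<le> 1 / (symb b k + 1)"
proof -
  have le: "symb b k + 1 \<le> norm (of_real (symb b k) - z)"
    using complex_Re_le_cmod[of "of_real (symb b k) - z"] z by simp
  then show "of_real (symb b k) - z \<noteq> 0" using symb_ge_2[of b k] by auto
  show "norm (res_fun b z k) \<le> 1 / (symb b k + 1)"
    unfolding res_fun_def norm_divide norm_one using le symb_ge_2[of b k] by (intro divide_left_mono mult_pos_pos) auto
qed

lemma res_fun_minus_2: "res_fun b (- 2) k = of_real (1 / (symb b k + 2))"
  by (simp add: res_fun_def)

context
  fixes b :: real
  assumes b: "b > 0"
begin

lemma res_fun_minus_2_Hdom: "res_fun b (- 2) \<in> Hdom b"
proof -
  have pos: "symb b k + 2 > 0" for k using symb_ge_2[of b k] by linarith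
  have c: "(norm (complex_of_real (2 * cosh (pi * b * k)) * res_fun b (- 2) k))\<^sup>2 = 1 / (symb b k + 2)" for k
    unfolding res_fun_minus_2 norm_mult power_mult_distrib
    unfolding norm_of_real power2_abs symb_cosh_sq[symmetric]
    using pos[of k] by (simp add: power2_eq_square)
  have C: "(\<lambda>k. complex_of_real (2 * cosh (pi * b * k)) * res_fun b (- 2) k) \<in> Lsq lborel"
    by (rule LsqI, measurable) (simp only: c symb_integral[OF b])
  have "res_fun b (- 2) \<in> Lsq lborel"
  proof (rule Lsq_bounded[OF C, where C=1])
    show "norm (res_fun b (- 2) k) \<le> 1 * norm (complex_of_real (2 * cosh (pi * b * k)) * res_fun b (- 2) k)" for k
      using mult_right_mono[of 1 "2 * cosh (pi * b * k)" "norm (res_fun b (- 2) k)"] cosh_real_ge_1[of "pi * b * k"]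
      by (simp add: norm_mult)
  qed measurable
  then show ?thesis using C by (simp add: Hdom_def)
qed

lemma res_fun_Hdom:
  assumes z: "Re z \<le> - 1" shows "res_fun b z \<in> Hdom b"
proof (rule Hdom_bounded[OF res_fun_minus_2_Hdom])
  show "norm (res_fun b z k) \<le> 4 / 3 * norm (res_fun b (- 2) k)" for k
  proof -
    have "norm (res_fun b z k) \<le> 1 / (symb b k + 1)" by (rule res_fun_bounds(2)[OF z])
    also have "\<dots> \<le> 4 / 3 * (1 / (symb b k + 2))" using symb_ge_2[of b k] by (simp add: field_simps)
    also have "1 / (symb b k + 2) = norm (res_fun b (- 2) k)"
      unfolding res_fun_minus_2 norm_of_real using symb_ge_2[of b k] by simp
    finally show ?thesis .
  qed
qed measurable

text \<open>The resolvent of \<open>W\<^sub>0(b)\<close> maps into the form domain, because \<open>2 cosh(\<pi>bk) \<le> 2 cosh(2\<pi>bk) + 1\<close>.\<close>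

lemma res_fun_mult_Hdom:
  assumes z: "Re z \<le> - 1" and p: "p \<in> Lsq lborel" shows "(\<lambda>k. p k * res_fun b z k) \<in> Hdom b"
proof -
  have [measurable]: "p \<in> borel_measurable borel" using p by auto
  have bd: "norm (res_fun b z k) * (2 * cosh (pi * b * k)) \<le> 1" "norm (res_fun b z k) \<le> 1" for k
  proof -
    have "2 * cosh (pi * b * k) \<le> symb b k + 1"
    proof (rule power2_le_imp_le)
      show "(2 * cosh (pi * b * k))\<^sup>2 \<le> (symb b k + 1)\<^sup>2"
        unfolding symb_cosh_sq[symmetric] using symb_ge_2[of b k] mult_mono[of 1 "symb b k" 1 "symb b k"] by (simp add: power2_eq_square algebra_simps)
    qed (use symb_ge_2[of b k] in simp)
    then have "norm (res_fun b z k) * (2 * cosh (pi * b * k)) \<le> 1 / (symb b k + 1) * (symb b k + 1)"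
      using res_fun_bounds(2)[OF z, of b k] symb_ge_2[of b k] by (intro mult_mono) auto
    then show "norm (res_fun b z k) * (2 * cosh (pi * b * k)) \<le> 1" using symb_ge_2[of b k] by simp
    show "norm (res_fun b z k) \<le> 1" 
      using res_fun_bounds(2)[OF z, of b k] symb_ge_2[of b k] by (elim order_trans) simp
  qed
  have "(\<lambda>k. p k * res_fun b z k) \<in> Lsq lborel"
    by (rule Lsq_bounded[OF p, where C=1]) (use bd(2) in \<open>auto simp: norm_mult mult_left_le\<close>)
  moreover have "(\<lambda>k. complex_of_real (2 * cosh (pi * b * k)) * (p k * res_fun b z k)) \<in> Lsq lborel"
  proof (rule Lsq_bounded[OF p, where C=1])
    show "norm (complex_of_real (2 * cosh (pi * b * k)) * (p k * res_fun b z k)) \<le> 1 * norm (p k)" for k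
      using mult_left_mono[OF bd(1)[of k], of "norm (p k)"] by (simp add: norm_mult mult_ac)
  qed measurable
  ultimately show ?thesis by (simp add: Hdom_def)
qed

text \<open>Multiplication by \<open>res_fun b z\<close> inverts \<open>W\<^sub>0(b) - z\<close>, and pairing with the constant function \<open>1\<close> is
  evaluation of \<open>iFT\<close> at the origin.\<close>

lemma sesq_res_fun:
  assumes z: "Re z \<le> - 1" and g: "g \<in> Hdom b"
  shows "sesq b g (res_fun b z) - z * ip lborel g (res_fun b z) = cnj (iFT g 0)"
    and "p \<in> Lsq lborel \<Longrightarrow> sesq b g (\<lambda>k. p k * res_fun b z k) - z * ip lborel g (\<lambda>k. p k * res_fun b z k) = ip lborel g p"
proof -
  have key: "sesq b g h - z * ip lborel g h = (LINT k|lborel. cnj (g k) * q k)"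
    if h: "h \<in> Hdom b" "\<And>k. (of_real (symb b k) - z) * h k = q k" for h q
  proof -
    have "sesq b g h - z * ip lborel g h = (LINT k|lborel. of_real (symb b k) * (cnj (g k) * h k)) - (LINT k|lborel. z * (cnj (g k) * h k))"
      unfolding sesq_def ip_def by simp
    also have "\<dots> = (LINT k|lborel. of_real (symb b k) * (cnj (g k) * h k) - z * (cnj (g k) * h k))"
      by (intro Bochner_Integration.integral_diff[symmetric] sesq_ip(1)[OF g h(1)] integrable_mult_right integrable_ip[OF Hdom_Lsq[OF g] Hdom_Lsq[OF h(1)]])
    also have "\<dots> = (LINT k|lborel. cnj (g k) * q k)"
      unfolding h(2)[symmetric] by (simp add: algebra_simps)
    finally show ?thesis .
  qed
  have one: "(of_real (symb b k) - z) * res_fun b z k = 1" for k using res_fun_bounds(1)[OF z] by (simp add: res_fun_def)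
  show "sesq b g (res_fun b z) - z * ip lborel g (res_fun b z) = cnj (iFT g 0)"
    using key[OF res_fun_Hdom[OF z] one] by (simp add: iFT_def FT_def)
  show "sesq b g (\<lambda>k. p k * res_fun b z k) - z * ip lborel g (\<lambda>k. p k * res_fun b z k) = ip lborel g p" if "p \<in> Lsq lborel"
    unfolding ip_def[of lborel g p]
  proof (rule key[OF res_fun_mult_Hdom[OF z that]])
    show "(of_real (symb b k) - z) * (p k * res_fun b z k) = p k" for k using one[of k] by (simp add: mult.left_commute)
  qed
qed

text \<open>At \<open>z = - 2\<close> the integral of \<open>res_fun b z\<close> is \<open>1 / (2\<pi>b)\<close>. If it took this value at another \<open>z\<close>,
  the resolvent identity would make the integral of \<open>res_fun b z\<close> times \<open>res_fun b (- 2)\<close> vanish,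
  whereas its real part is positive.\<close>

lemma res_fun_resonance:
  assumes z: "Re z \<le> - 1" and eq: "of_real (2 * pi * b) * iFT (res_fun b z) 0 = 1"
  shows "z = - 2"
proof (rule ccontr)
  assume ne: "z \<noteq> - 2"
  let ?h = "res_fun b (- 2)" and ?w = "res_fun b z"
  have i: "integrable lborel ?w" "integrable lborel ?h" using Hdom_L1[OF b] res_fun_Hdom[OF z] res_fun_minus_2_Hdom by auto
  have I: "iFT u 0 = (LINT k|lborel. u k)" for u by (simp add: iFT_def FT_def)
  have "(LINT k|lborel. ?h k) = of_real (1 / (2 * pi * b))"
    unfolding res_fun_minus_2 symb_integral(2)[OF b, symmetric] by (rule integral_complex_of_real)
  then have "of_real (2 * pi * b) * (LINT k|lborel. ?h k) = 1" using b by simp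
  then have "of_real (2 * pi * b) * ((LINT k|lborel. ?w k) - (LINT k|lborel. ?h k)) = 0"
    using eq unfolding I right_diff_distrib by (simp only: diff_self)
  then have "(LINT k|lborel. ?w k) - (LINT k|lborel. ?h k) = 0" using b by simp
  then have "(LINT k|lborel. ?w k - ?h k) = 0" using i by simp
  moreover have "?w k - ?h k = (z + 2) * (?w k * ?h k)" for k
    using res_fun_bounds(1)[OF z, of b k] res_fun_bounds(1)[of "- 2" b k] unfolding res_fun_def by (simp add: field_simps)
  ultimately have "(z + 2) * (LINT k|lborel. ?w k * ?h k) = 0" by simp
  then have z0: "(LINT k|lborel. ?w k * ?h k) = 0" using ne by (simp add: add_eq_0_iff2)
  have wh: "integrable lborel (\<lambda>k. ?w k * ?h k)"
    by (intro integrable_mult Hdom_Lsq[OF res_fun_Hdom[OF z]] Hdom_Lsq[OF res_fun_minus_2_Hdom])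
  have pos: "Re (?w k * ?h k) > 0" for k
  proof -
    have "Re (?w k) = (symb b k - Re z) / (norm (of_real (symb b k) - z))\<^sup>2"
      unfolding res_fun_def by (simp add: Re_divide cmod_power2)
    also have "\<dots> > 0" using res_fun_bounds(1)[OF z, of b k] symb_ge_2[of b k] z by (intro divide_pos_pos) auto
    finally have "Re (?w k) > 0" .
    moreover have "1 / (symb b k + 2) > 0" using symb_ge_2[of b k] by (simp add: add_pos_pos)
    ultimately show ?thesis unfolding res_fun_minus_2 by (simp del: of_real_divide of_real_add)
  qed
  have "(LINT k|lborel. Re (?w k * ?h k)) = 0" unfolding integral_Re[OF wh] z0 by simp
  then have "AE k in lborel. Re (?w k * ?h k) = 0"
    using integral_nonneg_eq_0_iff_AE[OF integrable_Re[OF wh]] pos by (simp add: less_imp_le)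
  then have "AE k in (lborel :: real measure). False" by eventually_elim (use pos in \<open>metis less_irrefl\<close>)
  then show False using not_AE_False by simp
qed

text \<open>The point mass \<open>2\<pi>b \<delta>\<^sub>0\<close>, the strongest one at the origin for which \<open>W \<ge> - 2\<close>.\<close>

definition dirac :: "real measure" where
  "dirac = density (return borel 0) (\<lambda>_. ennreal (2 * pi * b))"

lemma dirac_props:
  shows "sets dirac = sets borel" "finite_measure dirac" "measure dirac UNIV = 2 * pi * b"
    "f \<in> borel_measurable borel \<Longrightarrow> (LINT x|dirac. f x) = of_real (2 * pi * b) * (f 0 :: complex)"
proof -
  show s: "sets dirac = sets borel" by (simp add: dirac_def)
  have e: "emeasure dirac UNIV = ennreal (2 * pi * b)" unfolding dirac_def
    by (subst emeasure_density) auto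
  show "finite_measure dirac" by (rule finite_measureI) (use e sets_eq_imp_space_eq[OF s] in simp)
  show "measure dirac UNIV = 2 * pi * b" using e b by (simp add: measure_def)
  show "(LINT x|dirac. f x) = of_real (2 * pi * b) * f 0" if "f \<in> borel_measurable borel"
    unfolding dirac_def using that b by (subst integral_density) (auto simp: integral_return scaleR_conv_of_real)
qed

lemma qform_dirac:
  assumes "g \<in> Hdom b" "h \<in> Hdom b"
  shows "qform b dirac g h = sesq b g h - of_real (2 * pi * b) * (cnj (iFT g 0) * iFT h 0)"
proof -
  have [measurable]: "iFT g \<in> borel_measurable borel" "iFT h \<in> borel_measurable borel"
    using iFT_measurable Hdom_L1[OF b] assms by auto
  have "(\<lambda>x. cnj (iFT g x) * iFT h x) \<in> borel_measurable borel" by measurable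
  from dirac_props(4)[OF this] show ?thesis unfolding qform_def ip_def by simp
qed

text \<open>By the weighted bound, \<open>|\<psi>(0)|\<^sup>2\<close> is at most the form of \<open>W\<^sub>0(b) + 2\<close> times the integral of
  \<open>1 / (2 cosh(2\<pi>bk) + 2)\<close>, and that integral is \<open>1 / (2\<pi>b)\<close>.\<close>

lemma dirac_bounded_below: "W_bounded_below b (measure_form dirac) (- 2)"
  unfolding W_bounded_below_measure_iff[OF b]
proof
  fix h assume h: "h \<in> Hdom b"
  have [measurable]: "h \<in> borel_measurable borel" using Hdom_Lsq[OF h] by auto
  note w = Hdom_weighted(1,2)[OF h, of 2]
  have pos: "symb b k + 2 > 0" for k using symb_ge_2[of b k] by linarith
  have "(norm (iFT h 0))\<^sup>2 \<le> (LINT k|lborel. norm (h k))\<^sup>2" by (intro power_mono norm_iFT_le) auto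
  also have "\<dots> \<le> 1 / (2 * pi * b) * (Re (sesq b h h) + 2 * (nrm lborel h)\<^sup>2)"
    using weighted_L1_bound(2)[of "\<lambda>k. symb b k + 2" h, OF _ _ pos symb_integral(1)[OF b] w(1)] unfolding w(2) symb_integral(2)[OF b] by simp
  finally have "2 * pi * b * (norm (iFT h 0))\<^sup>2 \<le> Re (sesq b h h) + 2 * (nrm lborel h)\<^sup>2"
    using b by (simp add: field_simps)
  moreover have "Re (of_real (2 * pi * b) * (cnj (iFT h 0) * iFT h 0)) = 2 * pi * b * (norm (iFT h 0))\<^sup>2"
    unfolding cmod_power2 by (simp add: power2_eq_square)
  ultimately show "- 2 * (nrm lborel h)\<^sup>2 \<le> Re (qform b dirac h h)"
    unfolding qform_dirac[OF h h] minus_complex.simps by linarith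
qed

text \<open>The potential has rank one, so the equation \<open>(W - z) h = 0\<close> reads
  \<open>(W\<^sub>0(b) - z) h = 2\<pi>b \<psi>(0) \<delta>\<^sub>0\<close>. The difference of \<open>h\<close> and the resulting
  multiple of \<open>res_fun b z\<close> solves the equation of \<open>W\<^sub>0(b)\<close>, and testing with itself shows that it
  vanishes. For \<open>z = - 2\<close> this means that the eigenspace is one-dimensional.\<close>

lemma dirac_solution_unique:
  assumes z: "Re z \<le> - 1" and h: "h \<in> Hdom b" and q: "\<And>g. g \<in> Hdom b \<Longrightarrow> qform b dirac g h = z * ip lborel g h"
  shows "AE k in lborel. h k = of_real (2 * pi * b) * iFT h 0 * res_fun b z k"
proof -
  let ?c = "of_real (2 * pi * b) * iFT h 0"
  define v where "v k = h k + (- ?c) * res_fun b z k" for k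
  have r: "res_fun b z \<in> Hdom b" by (rule res_fun_Hdom[OF z])
  have r': "(\<lambda>k. (- ?c) * res_fun b z k) \<in> Hdom b" by (rule Hdom_cmult[OF r])
  have v: "v \<in> Hdom b" unfolding v_def by (rule Hdom_add[OF h r'])
  have "sesq b g v - z * ip lborel g v = 0" if g: "g \<in> Hdom b" for g
  proof -
    have 1: "sesq b g v = sesq b g h - ?c * sesq b g (res_fun b z)"
      unfolding v_def sesq_add_right[OF g h r'] sesq_cmult_right by simp
    have 2: "ip lborel g v = ip lborel g h - ?c * ip lborel g (res_fun b z)"
      unfolding v_def ip_add_right[OF Hdom_Lsq[OF g] Hdom_Lsq[OF h] Hdom_Lsq[OF r']] ip_cmult_right by simp
    have 3: "sesq b g h - z * ip lborel g h = ?c * cnj (iFT g 0)" using q[OF g] unfolding qform_dirac[OF g h] by (simp add: algebra_simps)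
    have "sesq b g v - z * ip lborel g v = (sesq b g h - z * ip lborel g h) - ?c * (sesq b g (res_fun b z) - z * ip lborel g (res_fun b z))"
      unfolding 1 2 by (simp add: algebra_simps)
    then show ?thesis unfolding 3 sesq_res_fun(1)[OF z g] by simp
  qed
  from this[OF v] have "Re (sesq b v v) - Re z * (nrm lborel v)\<^sup>2 = 0" unfolding ip_self
    by (metis Re_complex_of_real minus_complex.simps(1) mult.commute of_real_0 scaleR_complex.simps(1) scaleR_conv_of_real)
  moreover have "Re (sesq b v v) + 0 * (nrm lborel v)\<^sup>2 \<ge> 0"
    unfolding Hdom_weighted(2)[OF v, symmetric] using symb_ge_2[of b] by (intro integral_nonneg_AE) (auto intro!: AE_I2 mult_nonneg_nonneg order_trans[of 0 2 "symb b _"])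
  moreover have "1 * (nrm lborel v)\<^sup>2 \<le> - Re z * (nrm lborel v)\<^sup>2" using z by (intro mult_right_mono) auto
  ultimately have "(nrm lborel v)\<^sup>2 \<le> 0" unfolding mult_minus_left mult_zero_left by linarith
  then have "nrm lborel v = 0" by simp
  then have "AE k in lborel. v k = 0" using nrm_eq_0_iff[OF Hdom_Lsq[OF v]] by simp
  then show ?thesis by eventually_elim (simp add: v_def)
qed

lemma dirac_ground_state: "eigenpair b dirac (- 2) (res_fun b (- 2))"
  unfolding eigenpair_def
proof (intro conjI ballI res_fun_minus_2_Hdom)
  fix g assume g: "g \<in> Hdom b"
  have "iFT (res_fun b (- 2)) 0 = of_real (1 / (2 * pi * b))"
    unfolding iFT_def FT_def res_fun_minus_2 symb_integral(2)[OF b, symmetric] by (subst integral_complex_of_real[symmetric]) simp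
  then have "of_real (2 * pi * b) * (cnj (iFT g 0) * iFT (res_fun b (- 2)) 0) = cnj (iFT g 0)" using b by simp
  then show "qform b dirac g (res_fun b (- 2)) = of_real (- 2) * ip lborel g (res_fun b (- 2))"
    using sesq_res_fun(1)[of "- 2" g] g unfolding qform_dirac[OF g res_fun_minus_2_Hdom] by (simp add: algebra_simps)
qed

text \<open>To solve \<open>(W - z) \<psi> = f\<close>, note that the Fourier transform \<open>h\<close> of \<open>\<psi>\<close> must be
  \<open>(p + 2\<pi>b \<beta>) res_fun b z\<close>, where \<open>p\<close> is the transform of \<open>f\<close> and \<open>\<beta> = \<psi>(0)\<close>. Evaluating at the
  origin gives \<open>\<beta> D\<close> equal to the integral of \<open>p\<close> times \<open>res_fun b z\<close>, with
  \<open>D = 1 - 2\<pi>b \<integral> res_fun b z\<close>, and \<open>D\<close> vanishes only at \<open>z = - 2\<close>.\<close>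

lemma dirac_resolvent:
  assumes z: "Re z \<le> - 1" and ne: "z \<noteq> - 2"
  shows "z \<in> resolvent_set (W_op b (measure_form dirac))"
proof -
  let ?T = "W_op b (measure_form dirac)"
  let ?w = "res_fun b z"
  define D where "D = 1 - of_real (2 * pi * b) * iFT ?w 0"
  have D: "D \<noteq> 0" using res_fun_resonance[OF z] ne by (auto simp: D_def)
  have w: "?w \<in> Hdom b" by (rule res_fun_Hdom[OF z])
  note wL = Hdom_Lsq[OF w]
  have inj: "AE x in lborel. \<psi> x = 0" if op: "(\<psi>, \<eta>) \<in> ?T" and ae: "AE x in lborel. \<eta> x = z * \<psi> x" for \<psi> \<eta>
  proof -
    have psi: "\<psi> \<in> Lsq lborel" "fourier \<psi> \<in> Hdom b" and eta: "\<eta> \<in> Lsq lborel"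
      and q: "\<And>g. g \<in> Hdom b \<Longrightarrow> qform b dirac g (fourier \<psi>) = ip lborel g (fourier \<eta>)"
      using op unfolding W_op_measure_iff[OF b] form_domain_Hdom by auto
    have "fourier \<eta> = fourier (\<lambda>x. z * \<psi> x)" by (rule fourier_cong_Lsq[OF ae eta Lsq_cmult[OF psi(1)]])
    then have fe: "AE k in lborel. fourier \<eta> k = z * fourier \<psi> k" using fourier_cmult[OF psi(1)] by simp
    have "qform b dirac g (fourier \<psi>) = z * ip lborel g (fourier \<psi>)" if g: "g \<in> Hdom b" for g
      unfolding q[OF g] ip_cmult_right[symmetric]
      by (intro ip_cong_Lsq fe Hdom_Lsq[OF g] fourier_Lsq eta Lsq_cmult psi(1))
    from dirac_solution_unique[OF z psi(2) this]
    have h: "AE k in lborel. fourier \<psi> k = of_real (2 * pi * b) * iFT (fourier \<psi>) 0 * ?w k" .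
    have "iFT (fourier \<psi>) = iFT (\<lambda>k. of_real (2 * pi * b) * iFT (fourier \<psi>) 0 * ?w k)"
      by (intro iFT_cong_AE h Hdom_Lsq[OF psi(2)] Lsq_cmult wL)
    then have "iFT (fourier \<psi>) 0 = of_real (2 * pi * b) * iFT (fourier \<psi>) 0 * iFT ?w 0" using iFT_cmult by metis
    then have "D * iFT (fourier \<psi>) 0 = 0" unfolding D_def by (simp add: algebra_simps)
    then have "iFT (fourier \<psi>) 0 = 0" using D by simp
    then have "AE k in lborel. fourier \<psi> k = 0" using h by simp
    then show ?thesis by (rule fourier_AE_zero[OF psi(1)])
  qed
  define K where "K = 1 + 2 * pi * b * (nrm lborel ?w)\<^sup>2 / norm D"
  have surj: "\<exists>(\<psi>, \<eta>)\<in>?T. (AE x in lborel. \<eta> x - z * \<psi> x = f x) \<and> L2_norm \<psi> \<le> K * L2_norm f" if "f \<in> L2" for f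
  proof -
    have f: "f \<in> Lsq lborel" using that by (simp add: L2_Lsq)
    define p where "p = fourier f"
    have p: "p \<in> Lsq lborel" unfolding p_def by (rule fourier_Lsq[OF f])
    let ?pw = "\<lambda>k. p k * ?w k"
    have pw: "?pw \<in> Hdom b" by (rule res_fun_mult_Hdom[OF z p])
    define \<beta> where "\<beta> = iFT ?pw 0 / D"
    let ?c = "of_real (2 * pi * b) * \<beta>"
    define h where "h k = ?pw k + ?c * ?w k" for k
    have cw: "(\<lambda>k. ?c * ?w k) \<in> Hdom b" by (rule Hdom_cmult[OF w])
    have h: "h \<in> Hdom b" unfolding h_def by (rule Hdom_add[OF pw cw])
    have beta: "iFT h 0 = \<beta>"
    proof -
      have "iFT h 0 = iFT ?pw 0 + ?c * iFT ?w 0"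
        unfolding h_def using iFT_add[OF Hdom_L1[OF b pw] Hdom_L1[OF b cw]] iFT_cmult by simp
      also have "iFT ?pw 0 = \<beta> * D" using D by (simp add: \<beta>_def)
      finally show ?thesis by (simp add: D_def algebra_simps)
    qed
    have q: "qform b dirac g h = ip lborel g (\<lambda>k. z * h k + 1 * p k)" if g: "g \<in> Hdom b" for g
    proof -
      have 1: "sesq b g h = sesq b g ?pw + ?c * sesq b g ?w"
        unfolding h_def sesq_add_right[OF g pw cw] sesq_cmult_right ..
      have 2: "ip lborel g h = ip lborel g ?pw + ?c * ip lborel g ?w"
        unfolding h_def ip_add_right[OF Hdom_Lsq[OF g] Hdom_Lsq[OF pw] Hdom_Lsq[OF cw]] ip_cmult_right ..
      have "sesq b g h - z * ip lborel g h = (sesq b g ?pw - z * ip lborel g ?pw) + ?c * (sesq b g ?w - z * ip lborel g ?w)"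
        unfolding 1 2 by (simp add: algebra_simps)
      also have "\<dots> = ip lborel g p + ?c * cnj (iFT g 0)"
        unfolding sesq_res_fun(1)[OF z g] sesq_res_fun(2)[OF z g p] ..
      finally have "qform b dirac g h = z * ip lborel g h + ip lborel g p"
        unfolding qform_dirac[OF g h] beta by (simp add: algebra_simps)
      then show ?thesis
        using ip_add_right[OF Hdom_Lsq[OF g] Lsq_cmult[OF Hdom_Lsq[OF h], of z] Lsq_cmult[OF p, of 1]] by (simp add: ip_cmult_right)
    qed
    let ?\<psi> = "inv_fourier h"
    let ?\<eta> = "\<lambda>x. z * ?\<psi> x + 1 * f x"
    have psi: "?\<psi> \<in> form_domain b" "AE k in lborel. fourier ?\<psi> k = h k" by (rule inv_fourier_form_domain[OF h])+
    have psiL: "?\<psi> \<in> Lsq lborel" and psiH: "fourier ?\<psi> \<in> Hdom b" using psi(1) form_domain_Hdom by auto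
    have eta: "?\<eta> \<in> Lsq lborel" by (intro Lsq_add Lsq_cmult psiL f)
    have feta: "AE k in lborel. fourier ?\<eta> k = z * h k + 1 * p k"
      using fourier_lincomb[OF psiL f, of z 1] psi(2) by eventually_elim (simp add: p_def)
    have "qform b dirac g (fourier ?\<psi>) = ip lborel g (fourier ?\<eta>)" if g: "g \<in> Hdom b" for g
    proof -
      have "qform b dirac g (fourier ?\<psi>) = qform b dirac g h"
        using qform_cong_AE[OF _ psi(2) g g psiH h] by simp
      also have "\<dots> = ip lborel g (\<lambda>k. z * h k + 1 * p k)" by (rule q[OF g])
      also have "\<dots> = ip lborel g (fourier ?\<eta>)"
        by (rule ip_cong_Lsq[OF feta Hdom_Lsq[OF g] fourier_Lsq[OF eta], symmetric]) (intro Lsq_add Lsq_cmult Hdom_Lsq[OF h] p)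
      finally show ?thesis .
    qed
    then have mem: "(?\<psi>, ?\<eta>) \<in> ?T" unfolding W_op_measure_iff[OF b] using psi(1) eta by blast
    have "L2_norm ?\<psi> \<le> K * L2_norm f"
    proof -
      have np: "nrm lborel p = nrm lborel f" unfolding p_def by (rule fourier_plancherel[OF f])
      have "nrm lborel ?\<psi> = nrm lborel h" by (rule nrm_inv_fourier[OF Hdom_Lsq[OF h]])
      also have "\<dots> \<le> nrm lborel ?pw + nrm lborel (\<lambda>k. ?c * ?w k)"
        unfolding h_def by (rule nrm_triangle[OF Hdom_Lsq[OF pw] Hdom_Lsq[OF cw]])
      also have "nrm lborel ?pw \<le> nrm lborel p"
      proof (rule power2_le_imp_le)
        have "norm (?w k) \<le> 1" for k
          using res_fun_bounds(2)[OF z, of b k] symb_ge_2[of b k] by (elim order_trans) simp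
        then have "(norm (?pw k))\<^sup>2 \<le> (norm (p k))\<^sup>2" for k by (intro power_mono) (simp_all add: norm_mult mult_left_le)
        then show "(nrm lborel ?pw)\<^sup>2 \<le> (nrm lborel p)\<^sup>2"
          unfolding nrm_sq using Hdom_Lsq[OF pw] p by (intro integral_mono) auto
      qed simp
      also have "nrm lborel (\<lambda>k. ?c * ?w k) = 2 * pi * b * norm \<beta> * nrm lborel ?w"
        unfolding nrm_cmult norm_mult norm_of_real using b by simp
      also have "norm \<beta> \<le> nrm lborel ?w * nrm lborel p / norm D"
      proof -
        have "iFT ?pw 0 = ip lborel (\<lambda>k. cnj (?w k)) p" by (simp add: iFT_def FT_def ip_def mult.commute)
        then have "norm (iFT ?pw 0) \<le> nrm lborel ?w * nrm lborel p" using norm_ip_le[OF Lsq_cnj[OF wL] p] by (simp add: nrm_cnj)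
        then show ?thesis unfolding \<beta>_def norm_divide by (rule divide_right_mono) simp
      qed
      finally have "nrm lborel ?\<psi> \<le> nrm lborel p + 2 * pi * b * (nrm lborel ?w * nrm lborel p / norm D) * nrm lborel ?w"
        using b by (simp add: mult_left_mono mult_right_mono)
      also have "\<dots> = K * nrm lborel f" unfolding K_def np by (simp add: algebra_simps power2_eq_square)
      finally show ?thesis by (simp add: L2_norm_nrm)
    qed
    then show ?thesis by (intro bexI[OF _ mem]) simp
  qed
  have 1: "\<forall>(\<psi>, \<eta>)\<in>?T. (AE x in lborel. \<eta> x = z * \<psi> x) \<longrightarrow> (AE x in lborel. \<psi> x = 0)"
    using inj by (intro ballI) (simp only: split_beta prod.collapse, metis prod.collapse)
  show ?thesis unfolding resolvent_set_def mem_Collect_eq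
    by (rule conjI[OF 1 exI[of _ K]]) (intro ballI surj)
qed

lemma dirac_eigenspace_basis: "ae_basis 1 (\<lambda>_. inv_fourier (res_fun b (- 2))) (eigenspace (W_op b (measure_form dirac)) (- 2))"
  and dirac_eigenvector: "inv_fourier (res_fun b (- 2)) \<in> eigenspace (W_op b (measure_form dirac)) (- 2)" 
    "\<not> (AE x in lborel. inv_fourier (res_fun b (- 2)) x = 0)"
proof -
  let ?h = "res_fun b (- 2)"
  let ?\<psi> = "inv_fourier ?h"
  note es = eigenspace_eigenpair[OF b dirac_props(2,1)]
  note psi = inv_fourier_form_domain[OF res_fun_minus_2_Hdom]
  have L: "?\<psi> \<in> Lsq lborel" and H: "fourier ?\<psi> \<in> Hdom b" using psi(1) form_domain_Hdom by auto
  have "eigenpair b dirac (- 2) (fourier ?\<psi>)"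
    unfolding eigenpair_def
  proof (intro conjI ballI H)
    fix g assume g: "g \<in> Hdom b"
    have "qform b dirac g (fourier ?\<psi>) = qform b dirac g ?h"
      using qform_cong_AE[OF _ psi(2) g g H res_fun_minus_2_Hdom] by simp
    also have "\<dots> = of_real (- 2) * ip lborel g ?h" using dirac_ground_state g by (simp add: eigenpair_def)
    also have "ip lborel g ?h = ip lborel g (fourier ?\<psi>)"
      by (rule ip_cong_Lsq[OF psi(2) Hdom_Lsq[OF g] Hdom_Lsq[OF H] Hdom_Lsq[OF res_fun_minus_2_Hdom], symmetric])
    finally show "qform b dirac g (fourier ?\<psi>) = of_real (- 2) * ip lborel g (fourier ?\<psi>)" .
  qed
  then show mem: "?\<psi> \<in> eigenspace (W_op b (measure_form dirac)) (- 2)" unfolding es using L by blast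
  show ne: "\<not> (AE x in lborel. ?\<psi> x = 0)"
  proof
    assume "AE x in lborel. ?\<psi> x = 0"
    then have "nrm lborel ?\<psi> = 0" using nrm_eq_0_iff[OF L] by simp
    then have "AE k in lborel. fourier ?\<psi> k = 0"
      using nrm_eq_0_iff[OF Hdom_Lsq[OF H]] fourier_plancherel[OF L] by simp
    then have "AE k in (lborel :: real measure). False" using psi(2)
      by eventually_elim (use res_fun_bounds(1)[of "- 2" b] in \<open>simp add: res_fun_def\<close>)
    then show False using not_AE_False by simp
  qed
  show "ae_basis 1 (\<lambda>_. ?\<psi>) (eigenspace (W_op b (measure_form dirac)) (- 2))"
    unfolding ae_basis_def
  proof (intro conjI allI impI ballI)
    fix c :: "nat \<Rightarrow> complex" and i :: nat assume "AE x in lborel. (\<Sum>i<1. c i * ?\<psi> x) = 0" and "i < 1"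
    then have "AE x in lborel. c i * ?\<psi> x = 0" by simp
    then show "c i = 0" using ne by auto
  next
    fix f assume "f \<in> eigenspace (W_op b (measure_form dirac)) (- 2)"
    then have f: "f \<in> Lsq lborel" and ep: "eigenpair b dirac (- 2) (fourier f)" unfolding es by auto
    let ?a = "of_real (2 * pi * b) * iFT (fourier f) 0"
    have fh: "AE k in lborel. fourier f k = ?a * ?h k"
      by (rule dirac_solution_unique) (use ep in \<open>auto simp: eigenpair_def\<close>)
    have "AE x in lborel. 1 * f x + (- ?a) * ?\<psi> x = 0"
    proof (rule fourier_AE_zero)
      show "(\<lambda>x. 1 * f x + (- ?a) * ?\<psi> x) \<in> Lsq lborel" by (intro Lsq_add Lsq_cmult f L)
      show "AE k in lborel. fourier (\<lambda>x. 1 * f x + (- ?a) * ?\<psi> x) k = 0"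
        using fourier_lincomb[OF f L, of 1 "- ?a"] fh psi(2) by eventually_elim simp
    qed
    then have "AE x in lborel. f x = (\<Sum>i<1::nat. ?a * ?\<psi> x)" by eventually_elim simp
    then show "\<exists>c. AE x in lborel. f x = (\<Sum>i<1::nat. c i * ?\<psi> x)" by (intro exI[of _ "\<lambda>_. ?a"])
  qed (use mem in simp)
qed

text \<open>The disc of radius \<open>1\<close> around \<open>- 2\<close> lies in the half-plane \<open>Re z \<le> - 1\<close> where the resolvent was
  computed.\<close>

lemma dirac_discrete_eigenvalue: "- 2 \<in> discrete_eigenvalues (W_op b (measure_form dirac))"
proof -
  let ?T = "W_op b (measure_form dirac)"
  from dirac_eigenvector(1) obtain \<eta> where op: "(inv_fourier (res_fun b (- 2)), \<eta>) \<in> ?T"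
    and ae: "AE x in lborel. \<eta> x = of_real (- 2) * inv_fourier (res_fun b (- 2)) x" unfolding eigenspace_def by blast
  have "complex_of_real (- 2) \<notin> resolvent_set ?T"
    unfolding resolvent_set_def using op ae dirac_eigenvector(2) by blast
  then have mem: "complex_of_real (- 2) \<in> spectrum ?T" by (simp add: spectrum_def)
  have "ball (complex_of_real (- 2)) 1 \<inter> spectrum ?T = {complex_of_real (- 2)}"
  proof (intro equalityI subsetI)
    fix z assume z: "z \<in> ball (complex_of_real (- 2)) 1 \<inter> spectrum ?T"
    then have "norm (z + 2) < 1" by (simp add: dist_norm norm_minus_commute)
    then have "Re z \<le> - 1" using complex_Re_le_cmod[of "z + 2"] by simp
    then show "z \<in> {complex_of_real (- 2)}" using dirac_resolvent z by (auto simp: spectrum_def)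
  qed (use mem in simp)
  then have "complex_of_real (- 2) isolated_in spectrum ?T"
    unfolding isolated_in_def using mem open_ball by blast
  then show ?thesis unfolding discrete_eigenvalues_def using dirac_eigenvector dirac_eigenspace_basis by blast
qed

text \<open>The general inequality bounds the sum by \<open>1\<close>, and the simple eigenvalue \<open>- 2\<close>, for which
  \<open>\<omega> = 0\<close>, already contributes \<open>1\<close>.\<close>

lemma dirac_sinc_sum: "sinc_sum (W_op b (measure_form dirac)) = ennreal (1 / (2 * pi * b) * measure dirac UNIV)"
proof (rule antisym)
  let ?T = "W_op b (measure_form dirac)"
  show "sinc_sum ?T \<le> ennreal (1 / (2 * pi * b) * measure dirac UNIV)"
    by (rule sinc_sum_le[OF b dirac_props(2,1) dirac_bounded_below])
  have "ennreal (1 / (2 * pi * b) * measure dirac UNIV) = 1" using b by (simp add: dirac_props(3))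
  also have "1 = (\<Sum>\<mu>\<in>{- 2}. of_nat (multiplicity ?T \<mu>) * ennreal (sinc (arccos (- \<mu> / 2))))"
    using multiplicity_eq[OF dirac_eigenspace_basis] by simp
  also have "\<dots> \<le> sinc_sum ?T"
    unfolding sinc_sum_def
    by (subst nonneg_infsum_complete, simp, rule SUP_upper) (use dirac_discrete_eigenvalue in simp)
  finally show "ennreal (1 / (2 * pi * b) * measure dirac UNIV) \<le> sinc_sum ?T" .
qed

end

section \<open>The sharp inequality\<close>

lemma potential_sinc_sum_le:
  assumes b: "b > 0" and V: "integrable lborel V" "AE x in lborel. V x \<ge> 0" and bd: "W_bounded_below b (potential_form V) (- 2)"
  shows "discrete_eigenvalues (W_op b (potential_form V)) \<subseteq> {- 2..<2}"
    "sinc_sum (W_op b (potential_form V)) \<le> ennreal (1 / (2 * pi * b) * (LINT x|lborel. V x))"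
proof -
  define M where "M = density lborel (\<lambda>x. ennreal (V x))"
  have sM: "sets M = sets borel" by (simp add: M_def)
  have [measurable]: "V \<in> borel_measurable borel" using V by auto
  have e: "emeasure M UNIV = ennreal (LINT x|lborel. V x)"
    unfolding M_def by (subst emeasure_density) (auto simp: nn_integral_eq_integral[OF V])
  have M: "finite_measure M" by (rule finite_measureI) (use e sets_eq_imp_space_eq[OF sM] in simp)
  have m: "measure M UNIV = (LINT x|lborel. V x)" using e V(2) by (simp add: measure_def integral_nonneg_AE)
  note eq = W_potential_measure[OF b V, folded M_def]
  note bd' = bd[unfolded eq(2)]
  show "discrete_eigenvalues (W_op b (potential_form V)) \<subseteq> {- 2..<2}"
    unfolding eq(1) by (rule discrete_eigenvalues_range[OF b M sM bd'])
  show "sinc_sum (W_op b (potential_form V)) \<le> ennreal (1 / (2 * pi * b) * (LINT x|lborel. V x))"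
    unfolding eq(1) m[symmetric] by (rule sinc_sum_le[OF b M sM bd'])
qed

theorem theorem1p1:
  fixes b :: real
  assumes "b > 0"
  shows "(\<forall>V :: real \<Rightarrow> real.
            integrable lborel V \<and> (AE x in lborel. V x \<ge> 0) \<and>
            W_bounded_below b (potential_form V) (- 2) \<longrightarrow>
              discrete_eigenvalues (W_op b (potential_form V)) \<subseteq> {- 2..<2} \<and>
              sinc_sum (W_op b (potential_form V))
                \<le> ennreal (1 / (2 * pi * b) * (LINT x|lborel. V x)))
       \<and> (\<exists>V :: real \<Rightarrow> real.
            integrable lborel V \<and> (AE x in lborel. V x \<ge> 0) \<and>
            W_bounded_below b (potential_form V) (- 2) \<and>
            sinc_sum (W_op b (potential_form V))
              = ennreal (1 / (2 * pi * b) * (LINT x|lborel. V x)))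
       \<and> (\<exists>M :: real measure.
            sets M = sets borel \<and> finite_measure M \<and> measure M UNIV > 0 \<and>
            W_bounded_below b (measure_form M) (- 2) \<and>
            discrete_eigenvalues (W_op b (measure_form M)) \<subseteq> {- 2..<2} \<and>
            sinc_sum (W_op b (measure_form M))
              = ennreal (1 / (2 * pi * b) * measure M UNIV))"
proof (intro conjI)
  note b = assms
  show "\<forall>V :: real \<Rightarrow> real. integrable lborel V \<and> (AE x in lborel. V x \<ge> 0) \<and> W_bounded_below b (potential_form V) (- 2) \<longrightarrow>
      discrete_eigenvalues (W_op b (potential_form V)) \<subseteq> {- 2..<2} \<and>
      sinc_sum (W_op b (potential_form V)) \<le> ennreal (1 / (2 * pi * b) * (LINT x|lborel. V x))"
    using potential_sinc_sum_le[OF b] by blast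
  show "\<exists>V :: real \<Rightarrow> real. integrable lborel V \<and> (AE x in lborel. V x \<ge> 0) \<and> W_bounded_below b (potential_form V) (- 2) \<and>
      sinc_sum (W_op b (potential_form V)) = ennreal (1 / (2 * pi * b) * (LINT x|lborel. V x))"
  proof (intro exI conjI)
    let ?V = "\<lambda>_::real. 0::real"
    show i: "integrable lborel ?V" and p: "AE x in lborel. ?V x \<ge> 0" by simp_all
    show bd: "W_bounded_below b (potential_form ?V) (- 2)"
      unfolding W_bounded_below_def W_form_potential_diag
    proof (intro ballI)
      fix \<psi> :: "real \<Rightarrow> complex"
      have "(LINT k|lborel. (norm (complex_of_real (2 * sinh (pi * b * k)) * fourier \<psi> k))\<^sup>2) \<ge> 0"
        by (intro integral_nonneg_AE) simp
      then show "- 2 * (L2_norm \<psi>)\<^sup>2 \<le> Re (complex_of_real (2 * (L2_norm \<psi>)\<^sup>2 +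
          (LINT k|lborel. (norm (complex_of_real (2 * sinh (pi * b * k)) * fourier \<psi> k))\<^sup>2) - (LINT x|lborel. 0 * (norm (\<psi> x))\<^sup>2)))"
        using zero_le_power2[of "L2_norm \<psi>"] by simp
    qed
    show "sinc_sum (W_op b (potential_form ?V)) = ennreal (1 / (2 * pi * b) * (LINT x|lborel. ?V x))"
      using potential_sinc_sum_le(2)[OF b i p bd] by simp
  qed
  show "\<exists>M :: real measure. sets M = sets borel \<and> finite_measure M \<and> measure M UNIV > 0 \<and>
      W_bounded_below b (measure_form M) (- 2) \<and> discrete_eigenvalues (W_op b (measure_form M)) \<subseteq> {- 2..<2} \<and>
      sinc_sum (W_op b (measure_form M)) = ennreal (1 / (2 * pi * b) * measure M UNIV)"
    using dirac_props[OF b] dirac_bounded_below[OF b] dirac_sinc_sum[OF b] b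
      discrete_eigenvalues_range[OF b dirac_props(2,1)[OF b] dirac_bounded_below[OF b]]
    by (intro exI[of _ "dirac b"] conjI) auto
qed

end
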